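(* Let $\Phi$ be a symmetric norming function and let $\mathscr{A}\colon\Omega\to\mathcal{B}(\mathcal{H})$ be a weakly$^*$ integrable function such that $0\leqslant\mathscr{A}_t\in\mathcal{C}_\Phi^{(\circ)}(\mathcal{H})$ for all $t\in\Omega$. Then $\mathscr{A}\in\mathbb{P}(\Omega,\mu,\mathcal{C}_\Phi^{(\circ)}(\mathcal{H}))$ if and only if $\int_\Omega\mathscr{A}\,d\mu\in\mathcal{C}_\Phi^{(\circ)}(\mathcal{H})$, and in this case $$\|\mathscr{A}\|_{\mathbb{P}}=\left\|\int_\Omega\mathscr{A}\,d\mu\right\|_\Phi .$$
   Context: $\mathcal{H}$ is an infinite-dimensional separable complex Hilbert space, $\mathcal{B}(\mathcal{H})$ the bounded linear operators on it. $(\Omega,\mathfrak{M},\mu)$ is a measure space with complete measure $\mu$ (not assumed finite). Symmetric norming (s.n.) function: a norm $\Phi$ on finitely supported sequences with $\Phi(1,0,0,\dots)=1$, depending only on the absolute values of the entries and invariant under permutations of the entries. It is extended by $\Phi(a)=\lim_n\Phi(a_1,\dots,a_n,0,0,\dots)$, and $\mathfrak{c}_\Phi$ is the set of complex sequences $a$ converging to $0$ with $\Phi(a)<+\infty$. $\mathcal{C}_\Phi(\mathcal{H})$ is the ideal of compact operators $A$ whose singular value sequence $(s_n(A))_{n\ge1}$ lies in $\mathfrak{c}_\Phi$, with norm $\|A\|_\Phi=\Phi((s_n(A))_n)$. $\mathcal{C}_\Phi^{(\circ)}(\mathcal{H})$ is the $\|\cdot\|_\Phi$-closure of the finite-rank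 operators in $\mathcal{C}_\Phi(\mathcal{H})$. A scalar function on $\Omega$ is $\mu$-measurable if it is a $\mu$-a.e. limit of $\mu$-simple functions $\sum_{k=1}^m x_k\chi_{A_k}$ with $A_k\in\mathfrak{M}$ disjoint of finite measure. $\mathscr{A}\colon\Omega\to\mathcal{B}(\mathcal{H})$, $t\mapsto\mathscr{A}_t$, is weakly$^*$ integrable if for every $f\in\mathcal{H}$ the function $t\mapsto\langle\mathscr{A}_tf,f\rangle$ is $\mu$-measurable and integrable. Then for $E\in\mathfrak{M}$ the weak$^*$ integral $\int_E\mathscr{A}\,d\mu\in\mathcal{B}(\mathcal{H})$ is the unique operator with $\langle(\int_E\mathscr{A}\,d\mu)f,g\rangle=\int_E\langle\mathscr{A}_tf,g\rangle\,d\mu(t)$ for all $f,g\in\mathcal{H}$. For a Banach space $X$, $\varphi\colon\Omega\to X$ is Pettis integrable ($\varphi\in\mathbb{P}(\Omega,\mu,X)$) if $t\mapsto\langle\varphi(t),x^*\rangle$ is $\mu$-measurable and integrable for every $x^*\in X^*$ and for every $E\in\mathfrak{M}$ there is $\varphi_E\in X$ with $\langle\varphi_E,x^*\rangle=\int_E\langle\varphi(t),x^*\rangle\,d\mu(t)$ for every $x^*\in X^*$. The Pettis norm is $\|\varphi\|_{\mathbb{P}}=\sup_{\|x^*\|_{X^*}=1}\int_\Omega|\langle\varphi(t),x^*\rangle|\,d\mu(t)$. *)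

theory Defs
  imports "HOL-Analysis.Analysis"
begin

section \<open>Complex Hilbert spaces\<close>

class complex_vector = real_vector +
  fixes scaleC :: "complex \<Rightarrow> 'a \<Rightarrow> 'a"  (infixr \<open>*\<^sub>C\<close> 75)
  assumes scaleC_add_right: "a *\<^sub>C (x + y) = a *\<^sub>C x + a *\<^sub>C y"
    and scaleC_add_left: "(a + b) *\<^sub>C x = a *\<^sub>C x + b *\<^sub>C x"
    and scaleC_scaleC: "a *\<^sub>C b *\<^sub>C x = (a * b) *\<^sub>C x"
    and scaleR_scaleC: "r *\<^sub>R x = complex_of_real r *\<^sub>C x"

global_interpretation complex_vector: vector_space "scaleC :: complex \<Rightarrow> 'a \<Rightarrow> 'a :: complex_vector"
  defines cspan = complex_vector.span
    and cdim = complex_vector.dim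
proof
  show "1 *\<^sub>C x = x" for x :: 'a
    using scaleR_scaleC[of 1 x] by simp
qed (simp_all add: scaleC_add_right scaleC_add_left scaleC_scaleC)

text \<open>The inner product is linear in its first argument. The topology and the norm are those
  of the underlying real inner product space, whose inner product is the real part of
  \<open>cinner\<close>, so that \<open>(norm x)\<^sup>2 = cinner x x\<close>.\<close>

class complex_inner = complex_vector + real_inner +
  fixes cinner :: "'a \<Rightarrow> 'a \<Rightarrow> complex"
  assumes cinner_commute: "cinner x y = cnj (cinner y x)"
    and cinner_add_left: "cinner (x + y) z = cinner x z + cinner y z"
    and cinner_scaleC_left: "cinner (c *\<^sub>C x) y = c * cinner x y"
    and inner_eq_Re_cinner: "inner x y = Re (cinner x y)"

class chilbert_space = complex_inner + complete_space

lemma cinner_scaleC_right: "cinner x (c *\<^sub>C y) = cnj c * cinner x y"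
  for x y :: "'a :: complex_inner"
  by (metis cinner_commute cinner_scaleC_left complex_cnj_mult)

lemma cinner_self: "cinner x x = complex_of_real ((norm x)\<^sup>2)"
  for x :: "'a :: complex_inner"
proof (rule complex_eqI)
  show "Re (cinner x x) = Re (complex_of_real ((norm x)\<^sup>2))"
    by (simp add: inner_eq_Re_cinner[symmetric] dot_square_norm)
  have "Im (cinner x x) = Im (cnj (cinner x x))"
    using cinner_commute[of x x] by simp
  then show "Im (cinner x x) = Im (complex_of_real ((norm x)\<^sup>2))"
    by simp
qed

lemma norm_scaleC: "norm (c *\<^sub>C x) = cmod c * norm x"
  for x :: "'a :: complex_inner"
proof -
  have "complex_of_real ((norm (c *\<^sub>C x))\<^sup>2) = c * cnj c * complex_of_real ((norm x)\<^sup>2)"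
    by (simp only: cinner_self[symmetric] cinner_scaleC_left cinner_scaleC_right mult.assoc mult.left_commute)
  also have "\<dots> = complex_of_real ((cmod c * norm x)\<^sup>2)"
    by (simp only: complex_norm_square[symmetric] power_mult_distrib of_real_mult of_real_power)
  finally have "(norm (c *\<^sub>C x))\<^sup>2 = (cmod c * norm x)\<^sup>2"
    by (simp only: of_real_eq_iff)
  then show ?thesis
    by (simp add: power2_eq_iff_nonneg)
qed

section \<open>Bounded operators\<close>

instantiation blinfun :: (real_normed_vector, complex_inner) complex_vector
begin

lift_definition scaleC_blinfun :: "complex \<Rightarrow> ('a \<Rightarrow>\<^sub>L 'b) \<Rightarrow> ('a \<Rightarrow>\<^sub>L 'b)"
  is "\<lambda>c A x. c *\<^sub>C A x"
proof -
  fix c :: complex and A :: "'a \<Rightarrow> 'b"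
  assume "bounded_linear A"
  then interpret A: bounded_linear A .
  obtain K where K: "\<And>x. norm (A x) \<le> norm x * K"
    using A.bounded by blast
  show "bounded_linear (\<lambda>x. c *\<^sub>C A x)"
  proof (rule bounded_linear_intro)
    show "c *\<^sub>C A (x + y) = c *\<^sub>C A x + c *\<^sub>C A y" for x y
      by (simp add: A.add scaleC_add_right)
    show "c *\<^sub>C A (r *\<^sub>R x) = r *\<^sub>R c *\<^sub>C A x" for r x
      by (simp add: A.scaleR scaleR_scaleC scaleC_scaleC mult.commute)
    show "norm (c *\<^sub>C A x) \<le> norm x * (cmod c * K)" for x
      using mult_left_mono[OF K, of "cmod c" x] by (simp add: norm_scaleC ac_simps)
  qed
qed

instance
  by standard
    (transfer, simp add: fun_eq_iff scaleC_add_right scaleC_add_left scaleC_scaleC scaleR_scaleC)+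

end

text \<open>The type \<open>'h \<Rightarrow>\<^sub>L 'h\<close> consists of the real-linear bounded operators;
  the following set, \<open>B(H)\<close>, is that of the complex-linear ones.\<close>

definition bounded_ops :: "('h::complex_inner \<Rightarrow>\<^sub>L 'h) set" where
  "bounded_ops = {A. \<forall>c x. blinfun_apply A (c *\<^sub>C x) = c *\<^sub>C blinfun_apply A x}"

definition positive_op :: "('h::complex_inner \<Rightarrow>\<^sub>L 'h) \<Rightarrow> bool" where
  "positive_op A \<longleftrightarrow> A \<in> bounded_ops \<and> (\<forall>x. cinner (blinfun_apply A x) x \<in> \<real>\<^sub>\<ge>\<^sub>0)"

definition compact_op :: "('h::complex_inner \<Rightarrow>\<^sub>L 'h) \<Rightarrow> bool" where
  "compact_op A \<longleftrightarrow> A \<in> bounded_ops \<and> compact (closure (blinfun_apply A ` cball 0 1))"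

definition finite_rank_op :: "('h::complex_inner \<Rightarrow>\<^sub>L 'h) \<Rightarrow> bool" where
  "finite_rank_op A \<longleftrightarrow> A \<in> bounded_ops \<and> (\<exists>S. finite S \<and> range (blinfun_apply A) \<subseteq> cspan S)"

definition cadjoint :: "('h::chilbert_space \<Rightarrow>\<^sub>L 'h) \<Rightarrow> ('h \<Rightarrow>\<^sub>L 'h)" where
  "cadjoint A = (THE B. B \<in> bounded_ops \<and>
     (\<forall>x y. cinner (blinfun_apply A x) y = cinner x (blinfun_apply B y)))"

definition eigenspace :: "('h::complex_inner \<Rightarrow>\<^sub>L 'h) \<Rightarrow> complex \<Rightarrow> 'h set" where
  "eigenspace A l = {x. blinfun_apply A x = l *\<^sub>C x}"

text \<open>The singular values of a compact operator \<open>A\<close> are the square roots of the eigenvalues of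
  \<open>A\<^sup>* A\<close>, in nonincreasing order and repeated according to multiplicity; the sequence is
  continued by zeros when there are only finitely many positive ones. Indices start at \<open>0\<close>,
  so \<open>singular_values A n\<close> is \<open>s\<^bsub>n+1\<^esub>(A)\<close>. The convergence to \<open>0\<close> makes the sets
  whose cardinality is taken finite.\<close>

definition singular_values :: "('h::chilbert_space \<Rightarrow>\<^sub>L 'h) \<Rightarrow> nat \<Rightarrow> real" where
  "singular_values A = (THE s. decseq s \<and> (\<forall>n. 0 \<le> s n) \<and> s \<longlonglongrightarrow> 0 \<and>
     (\<forall>\<sigma>>0. card {n. s n = \<sigma>} =
        cdim (eigenspace (cadjoint A o\<^sub>L A) (complex_of_real (\<sigma>\<^sup>2)))))"

section \<open>Symmetric norming functions and the associated ideals\<close>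

definition fin_supp :: "(nat \<Rightarrow> complex) \<Rightarrow> bool" where
  "fin_supp a \<longleftrightarrow> finite {n. a n \<noteq> 0}"

text \<open>Only the values of \<open>\<Phi>\<close> at finitely supported sequences matter.\<close>

definition sn_function :: "((nat \<Rightarrow> complex) \<Rightarrow> real) \<Rightarrow> bool" where
  "sn_function \<Phi> \<longleftrightarrow>
     (\<forall>a. fin_supp a \<longrightarrow> 0 \<le> \<Phi> a \<and> (\<Phi> a = 0 \<longleftrightarrow> a = (\<lambda>_. 0))) \<and>
     (\<forall>a c. fin_supp a \<longrightarrow> \<Phi> (\<lambda>n. c * a n) = cmod c * \<Phi> a) \<and>
     (\<forall>a b. fin_supp a \<longrightarrow> fin_supp b \<longrightarrow> \<Phi> (\<lambda>n. a n + b n) \<le> \<Phi> a + \<Phi> b) \<and>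
     \<Phi> (\<lambda>n. if n = 0 then 1 else 0) = 1 \<and>
     (\<forall>a b. fin_supp a \<longrightarrow> fin_supp b \<longrightarrow> (\<forall>n. cmod (a n) = cmod (b n)) \<longrightarrow> \<Phi> a = \<Phi> b) \<and>
     (\<forall>a \<pi>. fin_supp a \<longrightarrow> bij \<pi> \<longrightarrow> \<Phi> (a \<circ> \<pi>) = \<Phi> a)"

definition sn_extend :: "((nat \<Rightarrow> complex) \<Rightarrow> real) \<Rightarrow> (nat \<Rightarrow> complex) \<Rightarrow> ereal" where
  "sn_extend \<Phi> a = lim (\<lambda>n. ereal (\<Phi> (\<lambda>k. if k < n then a k else 0)))"

definition sn_sequences :: "((nat \<Rightarrow> complex) \<Rightarrow> real) \<Rightarrow> (nat \<Rightarrow> complex) set" where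
  "sn_sequences \<Phi> = {a. a \<longlonglongrightarrow> 0 \<and> sn_extend \<Phi> a < \<infinity>}"

definition sn_ideal :: "((nat \<Rightarrow> complex) \<Rightarrow> real) \<Rightarrow> ('h::chilbert_space \<Rightarrow>\<^sub>L 'h) set" where
  "sn_ideal \<Phi> =
     {A. compact_op A \<and> (\<lambda>n. complex_of_real (singular_values A n)) \<in> sn_sequences \<Phi>}"

definition sn_norm :: "((nat \<Rightarrow> complex) \<Rightarrow> real) \<Rightarrow> ('h::chilbert_space \<Rightarrow>\<^sub>L 'h) \<Rightarrow> real" where
  "sn_norm \<Phi> A = real_of_ereal (sn_extend \<Phi> (\<lambda>n. complex_of_real (singular_values A n)))"

definition sn_ideal_closure :: "((nat \<Rightarrow> complex) \<Rightarrow> real) \<Rightarrow> ('h::chilbert_space \<Rightarrow>\<^sub>L 'h) set" where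
  "sn_ideal_closure \<Phi> =
     {A \<in> sn_ideal \<Phi>. \<forall>e>0. \<exists>F \<in> sn_ideal \<Phi>. finite_rank_op F \<and> sn_norm \<Phi> (A - F) < e}"

section \<open>Weak* and Pettis integrals\<close>

definition mu_simple :: "'w measure \<Rightarrow> ('w \<Rightarrow> complex) \<Rightarrow> bool" where
  "mu_simple M f \<longleftrightarrow> (\<exists>m (x :: nat \<Rightarrow> complex) A.
     (\<forall>k<m. A k \<in> sets M \<and> emeasure M (A k) < \<infinity>) \<and> disjoint_family_on A {..<m} \<and>
     (\<forall>t\<in>space M. f t = (\<Sum>k<m. x k * indicator (A k) t)))"

definition mu_measurable :: "'w measure \<Rightarrow> ('w \<Rightarrow> complex) \<Rightarrow> bool" where
  "mu_measurable M f \<longleftrightarrow>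
     (\<exists>s. (\<forall>n. mu_simple M (s n)) \<and> (AE t in M. (\<lambda>n. s n t) \<longlonglongrightarrow> f t))"

definition weak_star_integrable ::
    "'w measure \<Rightarrow> ('w \<Rightarrow> ('h::chilbert_space \<Rightarrow>\<^sub>L 'h)) \<Rightarrow> bool" where
  "weak_star_integrable M A \<longleftrightarrow> (\<forall>t\<in>space M. A t \<in> bounded_ops) \<and>
     (\<forall>f. mu_measurable M (\<lambda>t. cinner (blinfun_apply (A t) f) f) \<and>
          integrable M (\<lambda>t. cinner (blinfun_apply (A t) f) f))"

definition weak_star_integral ::
    "'w measure \<Rightarrow> 'w set \<Rightarrow> ('w \<Rightarrow> ('h::chilbert_space \<Rightarrow>\<^sub>L 'h)) \<Rightarrow> ('h \<Rightarrow>\<^sub>L 'h)" where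
  "weak_star_integral M E A = (THE B. B \<in> bounded_ops \<and>
     (\<forall>f g. cinner (blinfun_apply B f) g = (LINT t:E|M. cinner (blinfun_apply (A t) f) g)))"

text \<open>The Banach space of values is given as a complex linear subspace \<open>X\<close> of a complex vector
  space together with a norm \<open>N\<close> on \<open>X\<close>, since the ideals above do not carry the operator
  norm. Functionals are considered on \<open>X\<close> only; their values elsewhere are irrelevant.\<close>

definition dual_space :: "'b::complex_vector set \<Rightarrow> ('b \<Rightarrow> real) \<Rightarrow> ('b \<Rightarrow> complex) set" where
  "dual_space X N = {f.
     (\<forall>x\<in>X. \<forall>y\<in>X. f (x + y) = f x + f y) \<and>
     (\<forall>c. \<forall>x\<in>X. f (c *\<^sub>C x) = c * f x) \<and>
     (\<exists>K. \<forall>x\<in>X. cmod (f x) \<le> K * N x)}"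

definition dual_norm :: "'b::complex_vector set \<Rightarrow> ('b \<Rightarrow> real) \<Rightarrow> ('b \<Rightarrow> complex) \<Rightarrow> real" where
  "dual_norm X N f = (SUP x\<in>{x\<in>X. N x \<le> 1}. cmod (f x))"

definition pettis_integrable ::
    "'w measure \<Rightarrow> 'b::complex_vector set \<Rightarrow> ('b \<Rightarrow> real) \<Rightarrow> ('w \<Rightarrow> 'b) \<Rightarrow> bool" where
  "pettis_integrable M X N \<phi> \<longleftrightarrow>
     (\<forall>t\<in>space M. \<phi> t \<in> X) \<and>
     (\<forall>f\<in>dual_space X N. mu_measurable M (\<lambda>t. f (\<phi> t)) \<and> integrable M (\<lambda>t. f (\<phi> t))) \<and>
     (\<forall>E\<in>sets M. \<exists>y\<in>X. \<forall>f\<in>dual_space X N. f y = (LINT t:E|M. f (\<phi> t)))"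

definition pettis_norm ::
    "'w measure \<Rightarrow> 'b::complex_vector set \<Rightarrow> ('b \<Rightarrow> real) \<Rightarrow> ('w \<Rightarrow> 'b) \<Rightarrow> ennreal" where
  "pettis_norm M X N \<phi> =
     (SUP f\<in>{f\<in>dual_space X N. dual_norm X N f = 1}. \<integral>\<^sup>+ t. ennreal (cmod (f (\<phi> t))) \<partial>M)"

end

theory Submission
  imports Defs
begin

text \<open>
  Write \<open>B\<close> for the weak* integral of \<open>\<A>\<close> over the whole space. For a measurable weight \<open>w\<close>
  of modulus at most one, positivity gives \<open>2 \<bar>\<langle>D x, y\<rangle>\<bar> \<le> \<langle>B x, x\<rangle> + \<langle>B y, y\<rangle>\<close> for the weak* integral
  \<open>D\<close> of \<open>w \<A>\<close>. Ky Fan's description of the sums of the first singular values, together with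
  the monotonicity of \<open>\<Phi>\<close> under weak majorization, turns this into \<open>\<parallel>D\<parallel> \<le> \<parallel>B\<parallel>\<close>. If \<open>P\<close> runs through an
  increasing sequence of finite rank projections with strong limit \<open>1\<close>, the same estimates bound
  \<open>D - P D P\<close> uniformly in \<open>w\<close> by a quantity tending to \<open>0\<close>. Choosing the phase of a functional \<open>f\<close>
  as the weight, one sees that \<open>f (P \<A> P)\<close>, which is a finite combination of matrix
  coefficients, converges to \<open>f \<A>\<close> in mean; hence \<open>f D\<close> is the integral of \<open>w f \<A>\<close>. Indicator functions
  give Pettis integrability, phases give the upper bound for the Pettis norm, and a norming
  functional of \<open>B\<close> gives the lower bound. No description of the dual space is needed.
\<close>

text \<open>The obstacle is that \<open>f (\<A> t)\<close> is not known to be measurable, let alone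
  integrable, for an abstract functional \<open>f\<close>. Compressions make it accessible as a
  limit, but the weight that tests the mean distance of two compressions depends on both of them, so
  an estimate is needed that holds for all weights at once. Domination provides it: with
  \<open>P\<close> the projection and \<open>Q = 1 - P\<close>, scaling the two vectors against each
  other bounds the norm of \<open>D - P D P\<close> by \<open>r\<close> times the norm of
  \<open>Q B Q\<close> plus \<open>1 / r\<close> times the norm of \<open>B\<close>, for every
  \<open>r > 0\<close>. A large \<open>r\<close> is fixed to make the second term small, and then
  \<open>P\<close> is enlarged to make the first one small; the latter is possible because
  \<open>B\<close> is a limit of finite rank operators. Domination is stated with an arithmetic mean
  instead of a geometric one, since that form survives integration over \<open>t\<close> and
  summation over a family of vectors without further work. Ky Fan sums run over Bessel families
  instead of orthonormal systems, because \<open>P\<close> and \<open>Q\<close> carry Bessel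
  families to Bessel families.\<close>

lemma cinner_add_right: "cinner x (y + z) = cinner x y + cinner x z"
  for x y z :: "'a :: complex_inner"
  by (metis cinner_add_left cinner_commute complex_cnj_add)

lemma cinner_scaleR_left: "cinner (r *\<^sub>R x) y = r *\<^sub>R cinner x y"
  for x y :: "'a :: complex_inner"
  by (simp add: scaleR_scaleC cinner_scaleC_left scaleR_conv_of_real)

lemma cinner_scaleR_right: "cinner x (r *\<^sub>R y) = r *\<^sub>R cinner x y"
  for x y :: "'a :: complex_inner"
  by (simp add: scaleR_scaleC cinner_scaleC_right scaleR_conv_of_real)

lemma ex_phase: "\<exists>c. cmod c = 1 \<and> c * z = complex_of_real (cmod z)"
proof (cases "z = 0")
  case False
  then show ?thesis
    by (intro exI[of _ "complex_of_real (cmod z) / z"]) (simp add: norm_divide)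
qed (auto intro: exI[of _ 1])

text \<open>Rotating \<open>x\<close> by a phase makes the complex inner product equal to its real
  part, to which the real Cauchy-Schwarz inequality applies.\<close>

lemma norm_cinner_le: "cmod (cinner x y) \<le> norm x * norm y"
  for x y :: "'a :: complex_inner"
proof -
  obtain c where c: "cmod c = 1" "c * cinner x y = complex_of_real (cmod (cinner x y))"
    using ex_phase by blast
  have "cmod (cinner x y) = Re (cinner (c *\<^sub>C x) y)"
    by (simp add: cinner_scaleC_left c)
  also have "\<dots> \<le> norm (c *\<^sub>C x) * norm y"
    unfolding inner_eq_Re_cinner[symmetric] by (rule norm_cauchy_schwarz)
  finally show ?thesis
    by (simp add: norm_scaleC c)
qed

lemma bounded_bilinear_cinner:
  "bounded_bilinear (cinner :: 'a::complex_inner \<Rightarrow> 'a \<Rightarrow> complex)"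
  by (standard; (intro exI[of _ 1])?)
     (simp_all add: cinner_add_left cinner_add_right cinner_scaleR_left cinner_scaleR_right norm_cinner_le)

interpretation cinner: bounded_bilinear "cinner :: 'a::complex_inner \<Rightarrow> 'a \<Rightarrow> complex"
  by (rule bounded_bilinear_cinner)

lemma scaleC_scaleR: "c *\<^sub>C r *\<^sub>R x = r *\<^sub>R c *\<^sub>C x"
  for x :: "'a :: complex_vector"
  by (simp add: scaleR_scaleC scaleC_scaleC mult.commute)

lemma bounded_bilinear_scaleC:
  "bounded_bilinear (scaleC :: complex \<Rightarrow> 'a::complex_inner \<Rightarrow> 'a)"
  by (standard; (intro exI[of _ 1])?)
     (simp_all add: scaleC_add_left scaleC_add_right norm_scaleC scaleC_scaleR, simp add: scaleR_scaleC scaleC_scaleC scaleR_conv_of_real)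

interpretation scaleC: bounded_bilinear "scaleC :: complex \<Rightarrow> 'a::complex_inner \<Rightarrow> 'a"
  by (rule bounded_bilinear_scaleC)

lemma cinner_eqI: "(\<And>z. cinner x z = cinner y z) \<Longrightarrow> x = y"
  for x y :: "'a :: complex_inner"
  by (metis cinner.diff_left cinner_self eq_iff_diff_eq_0 norm_eq_zero of_real_eq_0_iff power_eq_0_iff)

lemma Re_cinner_self: "Re (cinner x x) = (norm x)\<^sup>2"
  for x :: "'a :: complex_inner"
  by (simp add: cinner_self)

lemma norm_add_sq: "(norm (x + y))\<^sup>2 = (norm x)\<^sup>2 + (norm y)\<^sup>2 + 2 * Re (cinner x y)"
  for x y :: "'a :: complex_inner"
  by (simp add: inner_eq_Re_cinner[symmetric] power2_norm_eq_inner inner_add inner_commute)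

lemma parallelogram: "(norm (x + y))\<^sup>2 + (norm (x - y))\<^sup>2 = 2 * (norm x)\<^sup>2 + 2 * (norm y)\<^sup>2"
  for x y :: "'a :: real_inner"
  by (simp add: power2_norm_eq_inner inner_add inner_diff inner_commute)

subsection \<open>Bounded sesquilinear forms\<close>

text \<open>The representing vector minimises \<open>J x = (norm x)\<^sup>2 - 2 * \<phi> x\<close>.
  By the parallelogram law and the lower bound \<open>m\<close> at midpoints, a minimising sequence
  is Cauchy; vanishing of the first variation at the limit is the representation.\<close>

lemma Riesz_real:
  fixes \<phi> :: "'a :: {real_inner, complete_space} \<Rightarrow> real"
  assumes "bounded_linear \<phi>"
  shows "\<exists>y. \<forall>x. \<phi> x = inner y x"
proof -
  interpret \<phi>: bounded_linear \<phi> by fact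
  obtain K where K: "\<And>x. norm (\<phi> x) \<le> norm x * K" "K > 0"
    using \<phi>.pos_bounded by blast
  define J where "J x = (norm x)\<^sup>2 - 2 * \<phi> x" for x
  have lower: "- K\<^sup>2 \<le> J x" for x
  proof -
    have "2 * \<phi> x \<le> 2 * (norm x * K)"
      using K(1)[of x] by auto
    also have "\<dots> \<le> (norm x)\<^sup>2 + K\<^sup>2"
      using sum_squares_bound[of "norm x" K] by (simp add: power2_eq_square algebra_simps)
    finally show ?thesis by (simp add: J_def)
  qed
  define m where "m = (INF x. J x)"
  have bdd: "bdd_below (range J)"
    using lower by (meson bdd_below.I2)
  have m_le: "m \<le> J x" for x
    unfolding m_def by (rule cINF_lower[OF bdd]) simp
  have "\<exists>x. J x < m + 1 / real (Suc n)" for n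
  proof -
    have "m < m + 1 / real (Suc n)" by simp
    then show ?thesis
      unfolding m_def by (subst (asm) cINF_less_iff[OF _ bdd]) auto
  qed
  then obtain x where x: "\<And>n. J (x n) < m + 1 / real (Suc n)" by metis
  have par: "(norm (u - v))\<^sup>2 = 2 * J u + 2 * J v - 4 * J ((1/2) *\<^sub>R (u + v))" for u v
  proof -
    have 1: "\<phi> ((1/2) *\<^sub>R (u + v)) = (1/2) * (\<phi> u + \<phi> v)"
      by (simp only: \<phi>.scaleR \<phi>.add real_scaleR_def)
    have 2: "(norm ((1/2) *\<^sub>R (u + v)))\<^sup>2 = (norm (u + v))\<^sup>2 / 4"
      by (simp only: norm_scaleR power_mult_distrib) (simp add: power_divide)
    have "J ((1/2) *\<^sub>R (u + v)) = (norm (u + v))\<^sup>2 / 4 - (\<phi> u + \<phi> v)"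
      unfolding J_def 1 2 by (rule arg_cong2[of _ _ _ _ minus]) simp_all
    then show ?thesis
      using parallelogram[of u v] J_def[of u] J_def[of v] by argo
  qed
  have dist: "(norm (x i - x j))\<^sup>2 \<le> 2 / real (Suc i) + 2 / real (Suc j)" for i j
    using par[of "x i" "x j"] x[of i] x[of j] m_le[of "(1/2) *\<^sub>R (x i + x j)"] by linarith
  have "Cauchy x"
  proof (rule metric_CauchyI)
    fix e :: real assume "0 < e"
    \<comment> \<open>Both terms of \<open>dist\<close> are at most \<open>2 / (N + 1)\<close>, so a
      quarter of \<open>e\<^sup>2\<close> is the right threshold.\<close>
    then obtain N where N: "inverse (real (Suc N)) < e\<^sup>2 / 4"
      using reals_Archimedean[of "e\<^sup>2 / 4"] by auto
    have "dist (x i) (x j) < e" if "i \<ge> N" "j \<ge> N" for i j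
    proof -
      have "inverse (real (Suc i)) \<le> inverse (real (Suc N))" "inverse (real (Suc j)) \<le> inverse (real (Suc N))"
        using that by auto
      then have "(norm (x i - x j))\<^sup>2 < e\<^sup>2"
        using dist[of i j, unfolded divide_inverse[of 2]] N by linarith
      then show ?thesis
        using \<open>0 < e\<close> by (simp add: dist_norm power_less_imp_less_base)
    qed
    then show "\<exists>N. \<forall>i\<ge>N. \<forall>j\<ge>N. dist (x i) (x j) < e" by blast
  qed
  then obtain y where y: "x \<longlonglongrightarrow> y"
    using Cauchy_convergent convergent_def by blast
  have lim1: "(\<lambda>n. J (x n)) \<longlonglongrightarrow> J y"
    unfolding J_def by (intro tendsto_intros \<phi>.tendsto y)
  have lim2: "(\<lambda>n. m + 1 / real (Suc n)) \<longlonglongrightarrow> m + 0"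
    by (intro tendsto_intros LIMSEQ_Suc[OF lim_1_over_n])
  have "J y \<le> m"
    using LIMSEQ_le[OF lim1 lim2] x by (auto intro: less_imp_le)
  have "\<phi> x = inner y x" for x
  proof -
    have ineq: "0 \<le> t\<^sup>2 * (norm x)\<^sup>2 + 2 * t * (inner y x - \<phi> x)" for t :: real
    proof -
      have "J y \<le> J (y + t *\<^sub>R x)"
        using \<open>J y \<le> m\<close> m_le order_trans by blast
      also have "\<dots> = J y + t\<^sup>2 * (norm x)\<^sup>2 + 2 * t * (inner y x - \<phi> x)"
      proof -
        have "(norm (y + t *\<^sub>R x))\<^sup>2 = (norm y)\<^sup>2 + t\<^sup>2 * (norm x)\<^sup>2 + 2 * t * inner y x"
          unfolding power2_norm_eq_inner by (simp add: inner_add inner_commute power2_eq_square)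
        then show ?thesis
          by (simp add: J_def \<phi>.add \<phi>.scaleR algebra_simps)
      qed
      finally show ?thesis by simp
    qed
    \<comment> \<open>The value \<open>t = - d / a\<close> nearly minimises the quadratic in
      \<open>ineq\<close>; the summand 1 in \<open>a\<close> keeps the denominator positive when
      \<open>x = 0\<close>.\<close>
    define d where "d = inner y x - \<phi> x"
    define a where "a = (norm x)\<^sup>2 + 1"
    have "a > 0" unfolding a_def by (simp add: add_nonneg_pos)
    have "0 \<le> (- d / a)\<^sup>2 * (norm x)\<^sup>2 + 2 * (- d / a) * d"
      using ineq[of "- d / a"] unfolding d_def .
    also have "\<dots> \<le> (- d / a)\<^sup>2 * a + 2 * (- d / a) * d"
      unfolding a_def by (simp add: mult_left_mono)
    also have "\<dots> = - d\<^sup>2 / a"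
      using \<open>a > 0\<close> by (simp add: field_simps power2_eq_square)
    finally show ?thesis
      using \<open>a > 0\<close> unfolding d_def
      by (simp add: divide_simps)
  qed
  then show ?thesis by blast
qed

text \<open>For fixed \<open>x\<close> the real part of the form is a bounded real functional of
  \<open>y\<close> and so has a representing vector \<open>d x\<close>. Testing the form at
  \<open>y = d x\<close> bounds the norm of \<open>d x\<close>, and linearity of \<open>d\<close>
  follows from uniqueness of the representation.\<close>

lemma ex_bounded_op_of_form:
  fixes b :: "'h::chilbert_space \<Rightarrow> 'h \<Rightarrow> complex"
  assumes add_left: "\<And>x y z. b (x + y) z = b x z + b y z"
    and add_right: "\<And>x y z. b x (y + z) = b x y + b x z"
    and scale_left: "\<And>c x y. b (c *\<^sub>C x) y = c * b x y"
    and scale_right: "\<And>c x y. b x (c *\<^sub>C y) = cnj c * b x y"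
    and bound: "\<And>x y. cmod (b x y) \<le> K * norm x * norm y"
  shows "\<exists>D\<in>bounded_ops. \<forall>x y. cinner (blinfun_apply D x) y = b x y"
proof -
  have scR: "b (r *\<^sub>R x) y = r *\<^sub>R b x y" "b x (r *\<^sub>R y) = r *\<^sub>R b x y" for r x y
    by (simp_all add: scaleR_scaleC scale_left scale_right scaleR_conv_of_real)
  have "bounded_linear (\<lambda>y. Re (b x y))" for x
    by (rule bounded_linear_intro[where K = "K * norm x"])
       (use bound[of x] abs_Re_le_cmod in \<open>auto simp: add_right scR mult.commute intro: order_trans\<close>)
  then have "\<forall>x. \<exists>d. \<forall>y. Re (b x y) = inner d y"
    using Riesz_real by blast
  then obtain d where d: "\<And>x y. Re (b x y) = inner (d x) y"
    by metis
  have dc: "cinner (d x) y = b x y" for x y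
  proof (rule complex_eqI)
    show "Re (cinner (d x) y) = Re (b x y)"
      by (simp add: d inner_eq_Re_cinner)
    \<comment> \<open>Only real parts agree by construction; replacing \<open>y\<close> by
      \<open>\<i> *\<^sub>C y\<close> turns the imaginary part into a real one.\<close>
    have "Re (cinner (d x) (\<i> *\<^sub>C y)) = Re (b x (\<i> *\<^sub>C y))"
      by (simp only: d inner_eq_Re_cinner)
    then show "Im (cinner (d x) y) = Im (b x y)"
      by (simp add: cinner_scaleC_right scale_right)
  qed
  have nd: "norm (d x) \<le> norm x * K" for x
  proof (cases "d x = 0")
    case True
    have "0 \<le> K * norm x * norm x" if "x \<noteq> 0"
      using bound[of x x] norm_ge_zero order_trans by blast
    then have "0 \<le> norm x * K"
      by (cases "x = 0") (auto simp: zero_le_mult_iff)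
    then show ?thesis using True by simp
  next
    case False
    have "(norm (d x))\<^sup>2 = cmod (b x (d x))"
      by (simp add: dc[symmetric] cinner_self norm_power)
    also have "\<dots> \<le> K * norm x * norm (d x)" by (rule bound)
    finally show ?thesis using False by (simp add: power2_eq_square mult.commute)
  qed
  have "bounded_linear d"
  proof (rule bounded_linear_intro[OF _ _ nd])
    show "d (x + y) = d x + d y" for x y
      by (rule cinner_eqI) (simp add: dc add_left cinner_add_left)
    show "d (r *\<^sub>R x) = r *\<^sub>R d x" for r x
      by (rule cinner_eqI) (simp add: dc scR cinner_scaleR_left)
  qed
  then have ap: "blinfun_apply (Blinfun d) = d" by (rule bounded_linear_Blinfun_apply)
  have "d (c *\<^sub>C x) = c *\<^sub>C d x" for c x
    by (rule cinner_eqI) (simp add: dc scale_left cinner_scaleC_left)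
  then have "Blinfun d \<in> bounded_ops"
    by (simp add: bounded_ops_def ap)
  then show ?thesis
    by (intro bexI[of _ "Blinfun d"]) (simp_all add: ap dc)
qed

lemma bounded_opsD: "A \<in> bounded_ops \<Longrightarrow> blinfun_apply A (c *\<^sub>C x) = c *\<^sub>C blinfun_apply A x"
  by (simp add: bounded_ops_def)

lemma blinfun_eq_cinnerI:
  "(\<And>x y. cinner (blinfun_apply A x) y = cinner (blinfun_apply B x) y) \<Longrightarrow> A = B"
  for A B :: "'h::complex_inner \<Rightarrow>\<^sub>L 'h"
  by (intro blinfun_eqI cinner_eqI)

text \<open>The adjoint is the operator of the bounded form that sends \<open>x\<close> and
  \<open>y\<close> to \<open>cinner x (A y)\<close>; uniqueness then identifies it with the definite
  description.\<close>

lemma cadjoint: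
  fixes A :: "'h::chilbert_space \<Rightarrow>\<^sub>L 'h"
  assumes "A \<in> bounded_ops"
  shows "cadjoint A \<in> bounded_ops"
    and "cinner (blinfun_apply A x) y = cinner x (blinfun_apply (cadjoint A) y)"
proof -
  have bd: "cmod (cinner x (blinfun_apply A y)) \<le> norm A * norm x * norm y" for x y
  proof -
    have "cmod (cinner x (blinfun_apply A y)) \<le> norm x * norm (blinfun_apply A y)"
      by (rule norm_cinner_le)
    also have "\<dots> \<le> norm x * (norm A * norm y)"
      by (intro mult_left_mono norm_blinfun) auto
    finally show ?thesis by (simp add: ac_simps)
  qed
  have "\<exists>D\<in>bounded_ops. \<forall>x y. cinner (blinfun_apply D x) y = cinner x (blinfun_apply A y)"
    by (rule ex_bounded_op_of_form[OF _ _ _ _ bd])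
       (simp_all add: cinner_add_left cinner_add_right cinner_scaleC_left cinner_scaleC_right
         blinfun.add_right bounded_opsD[OF assms])
  then obtain D where D: "D \<in> bounded_ops" "\<And>x y. cinner (blinfun_apply D x) y = cinner x (blinfun_apply A y)"
    by blast
  have D': "cinner (blinfun_apply A x) y = cinner x (blinfun_apply D y)" for x y
    by (metis D(2) cinner_commute)
  have "B = D" if "\<forall>x y. cinner (blinfun_apply A x) y = cinner x (blinfun_apply B y)" for B
    by (rule blinfun_eq_cinnerI) (metis D(2) that cinner_commute)
  then have "cadjoint A = D"
    unfolding cadjoint_def by (intro the_equality) (use D D' in auto)
  then show "cadjoint A \<in> bounded_ops"
    and "cinner (blinfun_apply A x) y = cinner x (blinfun_apply (cadjoint A) y)"
    using D D' by auto
qed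

subsection \<open>Algebra of bounded operators\<close>

lemma bounded_opsI: "(\<And>c x. blinfun_apply A (c *\<^sub>C x) = c *\<^sub>C blinfun_apply A x) \<Longrightarrow> A \<in> bounded_ops"
  by (simp add: bounded_ops_def)

lemma scaleC_blinfun_apply [simp]: "blinfun_apply (c *\<^sub>C A) x = c *\<^sub>C blinfun_apply A x"
  by transfer simp

lemma bounded_ops_zero [intro, simp]: "0 \<in> bounded_ops"
  by (rule bounded_opsI) (simp add: scaleC.zero_right)

lemma bounded_ops_add [intro]: "A \<in> bounded_ops \<Longrightarrow> B \<in> bounded_ops \<Longrightarrow> A + B \<in> bounded_ops"
  by (rule bounded_opsI) (simp add: blinfun.add_left scaleC_add_right bounded_opsD)

lemma bounded_ops_diff [intro]: "A \<in> bounded_ops \<Longrightarrow> B \<in> bounded_ops \<Longrightarrow> A - B \<in> bounded_ops"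
  by (rule bounded_opsI) (simp add: blinfun.diff_left scaleC.diff_right bounded_opsD)

lemma bounded_ops_scaleC [intro]: "A \<in> bounded_ops \<Longrightarrow> c *\<^sub>C A \<in> bounded_ops"
  by (rule bounded_opsI) (simp add: scaleC_scaleC mult.commute bounded_opsD)

lemma bounded_ops_compose [intro]: "A \<in> bounded_ops \<Longrightarrow> B \<in> bounded_ops \<Longrightarrow> A o\<^sub>L B \<in> bounded_ops"
  by (rule bounded_opsI) (simp add: bounded_opsD)

lemma bounded_ops_sum [intro]: "(\<And>i. i \<in> I \<Longrightarrow> A i \<in> bounded_ops) \<Longrightarrow> (\<Sum>i\<in>I. A i) \<in> bounded_ops"
  by (induction I rule: infinite_finite_induct) auto

lemma bounded_ops_id [intro, simp]: "id_blinfun \<in> bounded_ops"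
  by (rule bounded_opsI) simp

definition rank_one :: "'h::complex_inner \<Rightarrow> 'h \<Rightarrow> ('h \<Rightarrow>\<^sub>L 'h)" where
  "rank_one u v = Blinfun (\<lambda>x. cinner x u *\<^sub>C v)"

lemma rank_one_apply [simp]: "blinfun_apply (rank_one u v) x = cinner x u *\<^sub>C v"
  unfolding rank_one_def
  by (subst bounded_linear_Blinfun_apply)
     (intro bounded_linear_compose[OF scaleC.bounded_linear_left] cinner.bounded_linear_left, rule refl)

lemma rank_one_bounded_ops [intro, simp]: "rank_one u v \<in> bounded_ops"
  by (rule bounded_opsI) (simp add: cinner_scaleC_left scaleC_scaleC)

subsection \<open>Compact operators\<close>

text \<open>In a complete space relative compactness of the image of the ball means that image
  sequences have Cauchy subsequences. In this form sums, products and dominated operators are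
  handled by passing to subsequences. Conversely, a point of the closure is replaced by an image
  point at distance below \<open>1 / (n + 1)\<close>.\<close>

lemma compact_op_iff_sequential:
  fixes A :: "'h::chilbert_space \<Rightarrow>\<^sub>L 'h"
  shows "compact_op A \<longleftrightarrow> A \<in> bounded_ops \<and>
    (\<forall>x :: nat \<Rightarrow> 'h. (\<forall>n. norm (x n) \<le> 1) \<longrightarrow> (\<exists>r :: nat \<Rightarrow> nat. strict_mono r \<and> Cauchy (\<lambda>n. blinfun_apply A (x (r n)))))"
    (is "_ \<longleftrightarrow> ?B \<and> ?S")
proof
  assume A: "compact_op A"
  have ?S
  proof (intro allI impI)
    fix x :: "nat \<Rightarrow> 'h" assume "\<forall>n. norm (x n) \<le> 1"
    then have "\<forall>n. blinfun_apply A (x n) \<in> closure (blinfun_apply A ` cball 0 1)"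
      by (auto intro!: subsetD[OF closure_subset])
    moreover have "seq_compact (closure (blinfun_apply A ` cball 0 1))"
      using A by (simp add: compact_op_def compact_eq_seq_compact_metric)
    ultimately obtain l r where "strict_mono r" "((\<lambda>n. blinfun_apply A (x n)) \<circ> r) \<longlonglongrightarrow> l"
      by (metis (no_types, lifting) seq_compactE)
    then show "\<exists>r. strict_mono r \<and> Cauchy (\<lambda>n. blinfun_apply A (x (r n)))"
      by (auto simp: o_def intro: LIMSEQ_imp_Cauchy)
  qed
  moreover have ?B using A by (simp add: compact_op_def)
  ultimately show "?B \<and> ?S" by (rule conjI[rotated])
next
  assume AS: "?B \<and> ?S"
  note A = conjunct1[OF AS] and S = conjunct2[OF AS]
  have "seq_compact (closure (blinfun_apply A ` cball 0 1))"
  proof (rule seq_compactI)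
    fix y :: "nat \<Rightarrow> 'h" assume y: "\<forall>n. y n \<in> closure (blinfun_apply A ` cball 0 1)"
    have "\<exists>x. norm x \<le> 1 \<and> dist (blinfun_apply A x) (y n) < inverse (real (Suc n))" for n
    proof -
      have "y n \<in> closure (blinfun_apply A ` cball 0 1)" using y ..
      then have "\<exists>z\<in>blinfun_apply A ` cball 0 1. dist z (y n) < inverse (real (Suc n))"
        unfolding closure_approachable by simp
      then show ?thesis
        by (auto simp: dist_norm)
    qed
    then obtain x where x: "\<And>n. norm (x n) \<le> 1"
      "\<And>n. dist (blinfun_apply A (x n)) (y n) < inverse (real (Suc n))"
      by metis
    from S[rule_format, of x, OF x(1)]
    obtain r where r: "strict_mono r" "Cauchy (\<lambda>n. blinfun_apply A (x (r n)))"
      by (elim exE conjE)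
    then obtain l where l: "(\<lambda>n. blinfun_apply A (x (r n))) \<longlonglongrightarrow> l"
      using Cauchy_convergent convergent_def by blast
    have inv0: "(\<lambda>n. inverse (real (Suc (r n)))) \<longlonglongrightarrow> 0"
      using LIMSEQ_subseq_LIMSEQ[OF LIMSEQ_inverse_real_of_nat r(1)] by (simp add: o_def)
    have "(\<lambda>n. dist (y (r n)) (blinfun_apply A (x (r n)))) \<longlonglongrightarrow> 0"
      by (rule real_tendsto_sandwich[OF _ _ tendsto_const inv0])
         (use less_imp_le[OF x(2)] in \<open>auto intro!: always_eventually simp: dist_commute simp del: of_nat_Suc\<close>)
    then have "(\<lambda>n. y (r n) - blinfun_apply A (x (r n))) \<longlonglongrightarrow> 0"
      by (simp add: dist_norm tendsto_norm_zero_iff)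
    from tendsto_add[OF this l] have yl: "(y \<circ> r) \<longlonglongrightarrow> l"
      by (simp add: o_def)
    moreover have "l \<in> closure (blinfun_apply A ` cball 0 1)"
      by (rule closed_sequentially[OF closed_closure _ yl]) (use y in auto)
    ultimately show "\<exists>l\<in>closure (blinfun_apply A ` cball 0 1). \<exists>r. strict_mono r \<and> (y \<circ> r) \<longlonglongrightarrow> l"
      using r(1) by blast
  qed
  with A show "compact_op A"
    by (simp add: compact_op_def compact_eq_seq_compact_metric)
qed

lemma compact_op_bounded_ops: "compact_op A \<Longrightarrow> A \<in> bounded_ops"
  by (simp add: compact_op_def)

lemma compact_op_Cauchy:
  fixes A :: "'h::chilbert_space \<Rightarrow>\<^sub>L 'h" and x :: "nat \<Rightarrow> 'h"
  assumes "compact_op A" "\<And>n. norm (x n) \<le> C"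
  shows "\<exists>r :: nat \<Rightarrow> nat. strict_mono r \<and> Cauchy (\<lambda>n. blinfun_apply A (x (r n)))"
proof -
  define D where "D = \<bar>C\<bar> + 1"
  have D: "D > 0" "\<And>n. norm (x n) \<le> D"
    using order_trans[OF assms(2), of "\<bar>C\<bar> + 1"] by (auto simp: D_def)
  then have "\<forall>n. norm ((1/D) *\<^sub>R x n) \<le> 1"
    by (simp add: field_simps)
  then obtain r where r: "strict_mono r" "Cauchy (\<lambda>n. blinfun_apply A ((1/D) *\<^sub>R x (r n)))"
    using assms(1) unfolding compact_op_iff_sequential by meson
  have "Cauchy (\<lambda>n. D *\<^sub>R blinfun_apply A ((1/D) *\<^sub>R x (r n)))"
    by (rule bounded_linear.Cauchy[OF bounded_linear_scaleR_right r(2)])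
  then show ?thesis
    using r(1) D(1) by (auto simp: blinfun.scaleR_right)
qed

lemma compact_op_add:
  fixes A B :: "'h::chilbert_space \<Rightarrow>\<^sub>L 'h"
  assumes "compact_op A" "compact_op B"
  shows "compact_op (A + B)"
  unfolding compact_op_iff_sequential
proof (intro conjI allI impI)
  show "A + B \<in> bounded_ops"
    using assms by (auto simp: compact_op_def)
  fix x :: "nat \<Rightarrow> 'h" assume x: "\<forall>n. norm (x n) \<le> 1"
  then obtain r where r: "strict_mono r" "Cauchy (\<lambda>n. blinfun_apply A (x (r n)))"
    using compact_op_Cauchy[OF assms(1)] by blast
  obtain q where q: "strict_mono q" "Cauchy (\<lambda>n. blinfun_apply B (x (r (q n))))"
    using compact_op_Cauchy[OF assms(2), of "x \<circ> r"] x by (auto simp: o_def)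
  have "Cauchy (\<lambda>n. blinfun_apply A (x (r (q n))) + blinfun_apply B (x (r (q n))))"
    using Cauchy_subseq_Cauchy[OF r(2) q(1)] q(2)
    unfolding Cauchy_convergent_iff by (intro convergent_add) (auto simp: o_def)
  then show "\<exists>r. strict_mono r \<and> Cauchy (\<lambda>n. blinfun_apply (A + B) (x (r n)))"
    using strict_mono_o[OF r(1) q(1)] by (auto simp: o_def blinfun.add_left intro!: exI[of _ "r \<circ> q"])
qed

lemma compact_op_compose_left:
  fixes A B :: "'h::chilbert_space \<Rightarrow>\<^sub>L 'h"
  assumes "compact_op A" "B \<in> bounded_ops"
  shows "compact_op (B o\<^sub>L A)"
  unfolding compact_op_iff_sequential
proof (intro conjI allI impI)
  show "B o\<^sub>L A \<in> bounded_ops"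
    using assms by (auto simp: compact_op_def)
  fix x :: "nat \<Rightarrow> 'h" assume x: "\<forall>n. norm (x n) \<le> 1"
  then obtain r where r: "strict_mono r" "Cauchy (\<lambda>n. blinfun_apply A (x (r n)))"
    using compact_op_Cauchy[OF assms(1)] by blast
  then show "\<exists>r. strict_mono r \<and> Cauchy (\<lambda>n. blinfun_apply (B o\<^sub>L A) (x (r n)))"
    using bounded_linear.Cauchy[OF blinfun.bounded_linear_right r(2), of B] by auto
qed

lemma compact_op_compose_right:
  fixes A B :: "'h::chilbert_space \<Rightarrow>\<^sub>L 'h"
  assumes "compact_op A" "B \<in> bounded_ops"
  shows "compact_op (A o\<^sub>L B)"
  unfolding compact_op_iff_sequential
proof (intro conjI allI impI)
  show "A o\<^sub>L B \<in> bounded_ops"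
    using assms by (auto simp: compact_op_def)
  fix x :: "nat \<Rightarrow> 'h" assume "\<forall>n. norm (x n) \<le> 1"
  then have "norm (blinfun_apply B (x n)) \<le> norm B" for n
    using norm_blinfun[of B "x n"] mult_left_mono[of "norm (x n)" 1 "norm B"] by (simp add: order_trans)
  then show "\<exists>r. strict_mono r \<and> Cauchy (\<lambda>n. blinfun_apply (A o\<^sub>L B) (x (r n)))"
    using compact_op_Cauchy[OF assms(1), of "\<lambda>n. blinfun_apply B (x n)" "norm B"] by simp
qed

lemma compact_op_scaleC:
  fixes A :: "'h::chilbert_space \<Rightarrow>\<^sub>L 'h"
  assumes "compact_op A"
  shows "compact_op (c *\<^sub>C A)"
proof -
  have "c *\<^sub>C A = (c *\<^sub>C id_blinfun) o\<^sub>L A"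
    by (rule blinfun_eqI) simp
  then show ?thesis
    using compact_op_compose_left[OF assms, of "c *\<^sub>C id_blinfun"] by auto
qed

text \<open>Differences of vectors from the unit ball have norm at most 2, so the quadratic bound
  transfers the Cauchy property from the images under \<open>A\<close> to those under
  \<open>D\<close>.\<close>

lemma compact_op_dominated:
  fixes A D :: "'h::chilbert_space \<Rightarrow>\<^sub>L 'h"
  assumes "compact_op A" "D \<in> bounded_ops"
    and dom: "\<And>z. (norm (blinfun_apply D z))\<^sup>2 \<le> K * (norm z * norm (blinfun_apply A z))"
  shows "compact_op D"
  unfolding compact_op_iff_sequential
proof (intro conjI allI impI)
  show "D \<in> bounded_ops" by fact
  fix x :: "nat \<Rightarrow> 'h" assume x: "\<forall>n. norm (x n) \<le> 1"
  then obtain r where r: "strict_mono r" "Cauchy (\<lambda>n. blinfun_apply A (x (r n)))"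
    using compact_op_Cauchy[OF assms(1)] by blast
  have "Cauchy (\<lambda>n. blinfun_apply D (x (r n)))"
  proof (rule metric_CauchyI)
    fix e :: real assume "0 < e"
    define C where "C = 2 * (\<bar>K\<bar> + 1)"
    have "C > 0" by (simp add: C_def add_nonneg_pos)
    then have "e\<^sup>2 / C > 0" using \<open>0 < e\<close> by simp
    from metric_CauchyD[OF r(2) this] obtain N where
      N: "\<And>i j. i \<ge> N \<Longrightarrow> j \<ge> N \<Longrightarrow> norm (blinfun_apply A (x (r i) - x (r j))) < e\<^sup>2 / C"
      by (auto simp: dist_norm blinfun.diff_right)
    have "dist (blinfun_apply D (x (r i))) (blinfun_apply D (x (r j))) < e" if "i \<ge> N" "j \<ge> N" for i j
    proof -
      define z where "z = x (r i) - x (r j)"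
      have z: "norm z \<le> 2"
        using norm_triangle_ineq4[of "x (r i)" "x (r j)"] x[rule_format, of "r i"] x[rule_format, of "r j"]
        by (simp add: z_def)
      have "(norm (blinfun_apply D z))\<^sup>2 \<le> (\<bar>K\<bar> + 1) * (norm z * norm (blinfun_apply A z))"
        using dom[of z] by (rule order_trans) (intro mult_right_mono, auto)
      also have "\<dots> \<le> (\<bar>K\<bar> + 1) * (2 * norm (blinfun_apply A z))"
        by (intro mult_left_mono mult_right_mono z) auto
      also have "\<dots> < e\<^sup>2"
        using N[OF that] \<open>C > 0\<close> by (simp add: z_def C_def field_simps)
      finally have "norm (blinfun_apply D z) < e"
        using \<open>0 < e\<close> by (simp add: power_less_imp_less_base)
      then show ?thesis
        by (simp add: z_def dist_norm blinfun.diff_right)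
    qed
    then show "\<exists>N. \<forall>i\<ge>N. \<forall>j\<ge>N. dist (blinfun_apply D (x (r i))) (blinfun_apply D (x (r j))) < e"
      by blast
  qed
  with r(1) show "\<exists>r. strict_mono r \<and> Cauchy (\<lambda>n. blinfun_apply D (x (r n)))"
    by blast
qed

lemma compact_op_rank_one:
  fixes u v :: "'h::chilbert_space"
  shows "compact_op (rank_one u v)"
  unfolding compact_op_iff_sequential
proof (intro conjI allI impI)
  show "rank_one u v \<in> bounded_ops" by simp
  fix x :: "nat \<Rightarrow> 'h" assume x: "\<forall>n. norm (x n) \<le> 1"
  have "cmod (cinner (x n) u) \<le> norm u" for n
    using norm_cinner_le[of "x n" u] mult_right_mono[of "norm (x n)" 1 "norm u"] x by (simp add: order_trans)
  then have "bounded (range (\<lambda>n. cinner (x n) u))"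
    by (auto simp: bounded_iff)
  then obtain l r where "strict_mono r" and l: "((\<lambda>n. cinner (x n) u) \<circ> r) \<longlonglongrightarrow> l"
    using bounded_imp_convergent_subsequence by blast
  moreover have "Cauchy (\<lambda>n. cinner (x (r n)) u *\<^sub>C v)"
    using bounded_linear.Cauchy[OF scaleC.bounded_linear_left LIMSEQ_imp_Cauchy[OF l]] by simp
  ultimately show "\<exists>r. strict_mono r \<and> Cauchy (\<lambda>n. blinfun_apply (rank_one u v) (x (r n)))"
    by auto
qed

subsection \<open>Symmetric norming functions\<close>

lemma fin_supp_subset: "fin_supp b \<Longrightarrow> (\<And>n. b n = 0 \<Longrightarrow> a n = 0) \<Longrightarrow> fin_supp a"
  unfolding fin_supp_def by (erule rev_finite_subset) auto

lemma fin_supp_scale: "fin_supp a \<Longrightarrow> fin_supp (\<lambda>n. c * a n)"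
  by (erule fin_supp_subset) simp

lemma fin_supp_add: "fin_supp a \<Longrightarrow> fin_supp b \<Longrightarrow> fin_supp (\<lambda>n. a n + b n)"
  unfolding fin_supp_def by (rule finite_subset[of _ "{n. a n \<noteq> 0} \<union> {n. b n \<noteq> 0}"]) auto

lemma fin_supp_upd: "fin_supp a \<Longrightarrow> fin_supp (a(i := c))"
  unfolding fin_supp_def by (rule finite_subset[of _ "insert i {n. a n \<noteq> 0}"]) auto

lemma fin_supp_perm: "fin_supp a \<Longrightarrow> bij \<pi> \<Longrightarrow> fin_supp (a \<circ> \<pi>)"
  unfolding fin_supp_def using finite_vimageI[of "{n. a n \<noteq> 0}" \<pi>] bij_is_inj
  by (auto simp: vimage_def)

abbreviation trunc :: "nat \<Rightarrow> (nat \<Rightarrow> real) \<Rightarrow> nat \<Rightarrow> complex" where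
  "trunc n s \<equiv> \<lambda>k. if k < n then complex_of_real (s k) else 0"

lemma fin_supp_trunc: "fin_supp (\<lambda>k. if k < n then f k else 0)"
  unfolding fin_supp_def by (rule finite_subset[of _ "{..<n}"]) auto

context
  fixes \<Phi> :: "(nat \<Rightarrow> complex) \<Rightarrow> real"
  assumes \<Phi>: "sn_function \<Phi>"
begin

lemma sn_nonneg: "fin_supp a \<Longrightarrow> 0 \<le> \<Phi> a"
  and sn_scale: "fin_supp a \<Longrightarrow> \<Phi> (\<lambda>n. c * a n) = cmod c * \<Phi> a"
  and sn_triangle: "fin_supp a \<Longrightarrow> fin_supp b \<Longrightarrow> \<Phi> (\<lambda>n. a n + b n) \<le> \<Phi> a + \<Phi> b"
  and sn_unit: "\<Phi> (\<lambda>n. if n = 0 then 1 else 0) = 1"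
  and sn_abs: "fin_supp a \<Longrightarrow> fin_supp b \<Longrightarrow> (\<And>n. cmod (a n) = cmod (b n)) \<Longrightarrow> \<Phi> a = \<Phi> b"
  and sn_perm: "fin_supp a \<Longrightarrow> bij \<pi> \<Longrightarrow> \<Phi> (a \<circ> \<pi>) = \<Phi> a"
  using \<Phi> unfolding sn_function_def by blast+

lemma sn_convex:
  assumes a: "fin_supp a" and b: "fin_supp b" and "\<Phi> b = \<Phi> a" and \<theta>: "0 \<le> \<theta>" "\<theta> \<le> 1"
  shows "\<Phi> (\<lambda>n. complex_of_real \<theta> * a n + complex_of_real (1 - \<theta>) * b n) \<le> \<Phi> a"
proof -
  have "\<Phi> (\<lambda>n. complex_of_real \<theta> * a n + complex_of_real (1 - \<theta>) * b n)
      \<le> \<Phi> (\<lambda>n. complex_of_real \<theta> * a n) + \<Phi> (\<lambda>n. complex_of_real (1 - \<theta>) * b n)"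
    by (intro sn_triangle fin_supp_scale a b)
  also have "\<dots> = \<theta> * \<Phi> a + (1 - \<theta>) * \<Phi> b"
    using \<theta> sn_scale[OF a, of "complex_of_real \<theta>"] sn_scale[OF b, of "complex_of_real (1 - \<theta>)"]
    by (simp only: norm_of_real)
  finally show ?thesis
    using assms(3) by (simp add: algebra_simps)
qed

text \<open>Shrinking entry \<open>i\<close> by a factor \<open>t\<close> in \<open>[0, 1]\<close>
  is a convex combination of \<open>a\<close> and of \<open>a\<close> with that entry negated, which
  has the same norm. The coefficient solves \<open>\<theta> - (1 - \<theta>) = t\<close>.\<close>

lemma sn_upd_le:
  assumes a: "fin_supp a" and c: "cmod c \<le> cmod (a i)"
  shows "\<Phi> (a(i := c)) \<le> \<Phi> a"
proof (cases "a i = 0")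
  case True
  then have "a(i := c) = a" using c by auto
  then show ?thesis by simp
next
  case False
  define t where "t = cmod c / cmod (a i)"
  define \<theta> where "\<theta> = (1 + t) / 2"
  have t: "0 \<le> t" "t \<le> 1" using c False by (auto simp: t_def)
  define b where "b = a(i := - a i)"
  have b: "fin_supp b" unfolding b_def by (rule fin_supp_upd[OF a])
  have "\<Phi> b = \<Phi> a"
    by (rule sn_abs[OF b a]) (simp add: b_def)
  have "\<Phi> (a(i := c)) = \<Phi> (\<lambda>n. complex_of_real \<theta> * a n + complex_of_real (1 - \<theta>) * b n)"
  proof (rule sn_abs)
    fix n
    have "complex_of_real \<theta> * a i + complex_of_real (1 - \<theta>) * b i = complex_of_real t * a i"
      by (simp add: b_def \<theta>_def field_simps)
    moreover have "cmod (complex_of_real t * a i) = cmod c"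
      using t False by (simp only: norm_mult norm_of_real) (simp add: t_def)
    ultimately show "cmod ((a(i := c)) n) = cmod (complex_of_real \<theta> * a n + complex_of_real (1 - \<theta>) * b n)"
      by (cases "n = i") (simp_all add: b_def algebra_simps)
  qed (intro fin_supp_upd fin_supp_add fin_supp_scale a b)+
  also have "\<dots> \<le> \<Phi> a"
    using t by (intro sn_convex a b \<open>\<Phi> b = \<Phi> a\<close>) (auto simp: \<theta>_def)
  finally show ?thesis .
qed

text \<open>The entries of \<open>b\<close> are replaced by those of \<open>a\<close> one at a time,
  and outside the finite support of \<open>b\<close> both sequences vanish.\<close>

lemma sn_mono:
  assumes b: "fin_supp b" and le: "\<And>n. cmod (a n) \<le> cmod (b n)"
  shows "\<Phi> a \<le> \<Phi> b"
proof -
  define h where "h S n = (if n \<in> S then a n else b n)" for S n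
  have az: "a n = 0" if "b n = 0" for n
    using le[of n] that by simp
  have h: "fin_supp (h S)" for S
    using b by (rule fin_supp_subset) (simp add: h_def az)
  have "\<Phi> (h S) \<le> \<Phi> b" if "finite S" for S
    using that
  proof (induction S rule: finite_induct)
    case empty
    have "h {} = b" by (auto simp: h_def)
    then show ?case by simp
  next
    case (insert i S)
    have "\<Phi> (h (insert i S)) = \<Phi> ((h S)(i := a i))"
      by (rule arg_cong[of _ _ \<Phi>]) (auto simp: h_def)
    also have "\<dots> \<le> \<Phi> (h S)"
      using insert le by (intro sn_upd_le h) (auto simp: h_def)
    finally show ?case using insert.IH by linarith
  qed
  moreover have "h {n. b n \<noteq> 0} = a"
    by (rule ext) (simp add: h_def az)
  ultimately show ?thesis
    using b unfolding fin_supp_def by metis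
qed

text \<open>The step moves as much mass as possible from a position where \<open>b\<close> exceeds \<open>a\<close> to the
  next one where it falls short. The new sequence is a convex combination of \<open>b\<close> and a
  transposed copy of \<open>b\<close>, and it differs from \<open>a\<close> in fewer positions.\<close>

lemma sn_weak_majorization:
  fixes a b :: "nat \<Rightarrow> real"
  assumes "finite {n. a n \<noteq> 0}" "finite {n. b n \<noteq> 0}"
    and "decseq a" "\<And>n. 0 \<le> a n" "\<And>n. 0 \<le> b n"
    and "\<And>n. (\<Sum>k<n. a k) \<le> (\<Sum>k<n. b k)"
  shows "\<Phi> (\<lambda>n. complex_of_real (a n)) \<le> \<Phi> (\<lambda>n. complex_of_real (b n))"
  using assms
proof (induction "card {n. a n \<noteq> b n}" arbitrary: b rule: less_induct)
  case less
  note a = less.prems(1,3,4) and b = less.prems(2,5) and part = less.prems(6)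
  have fsb: "fin_supp (\<lambda>n. complex_of_real (b n))"
    using b(1) by (simp add: fin_supp_def)
  have fin: "finite {n. a n \<noteq> b n}"
    by (rule finite_subset[of _ "{n. a n \<noteq> 0} \<union> {n. b n \<noteq> 0}"]) (use a b in auto)
  show ?case
  proof (cases "\<forall>n. a n \<le> b n")
    case True
    then show ?thesis
      using a b by (intro sn_mono fsb) auto
  next
    case False
    then have ex: "\<exists>k. b k < a k" by (simp add: not_le)
    define k where "k = (LEAST k. b k < a k)"
    have k: "b k < a k"
      unfolding k_def using ex by (rule LeastI_ex)
    have k_least: "a i \<le> b i" if "i < k" for i
      using not_less_Least[of i "\<lambda>k. b k < a k"] that by (simp add: k_def not_less)
    define J where "J = {j. j < k \<and> a j < b j}"
    \<comment> \<open>If there were no surplus before \<open>k\<close>, the partial sums would agree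
      up to \<open>k\<close> and the deficit at \<open>k\<close> would violate the hypothesis at
      \<open>Suc k\<close>.\<close>
    have "J \<noteq> {}"
    proof
      assume "J = {}"
      have "a i = b i" if "i < k" for i
      proof -
        have "i \<notin> J" using \<open>J = {}\<close> by simp
        then show ?thesis using k_least[OF that] that by (simp add: J_def)
      qed
      then have "(\<Sum>i<k. a i) = (\<Sum>i<k. b i)" by simp
      with part[of "Suc k"] k show False by simp
    qed
    have "finite J" by (simp add: J_def)
    define j where "j = Max J"
    have j: "j < k" "a j < b j"
      using Max_in[OF \<open>finite J\<close> \<open>J \<noteq> {}\<close>] by (auto simp: J_def j_def)
    have between: "a i = b i" if "j < i" "i < k" for i
    proof (rule ccontr)
      assume "a i \<noteq> b i"
      then have "i \<in> J" using that k_least[of i] by (auto simp: J_def)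
      then have "i \<le> j" unfolding j_def by (rule Max_ge[OF \<open>finite J\<close>])
      then show False using that(1) by simp
    qed
    define \<delta> where "\<delta> = min (b j - a j) (a k - b k)"
    have \<delta>: "0 < \<delta>" "\<delta> \<le> b j - a j" "\<delta> \<le> a k - b k" "\<delta> = b j - a j \<or> \<delta> = a k - b k"
      using j k by (auto simp: \<delta>_def min_def)
    define c where "c = b(j := b j - \<delta>, k := b k + \<delta>)"
    have cj: "c j = b j - \<delta>" "c k = b k + \<delta>" "\<And>i. i \<noteq> j \<Longrightarrow> i \<noteq> k \<Longrightarrow> c i = b i"
      using j by (auto simp: c_def)
    have ajk: "a k \<le> a j"
      using a(2) j(1) by (auto simp: decseq_def)
    have c_fin: "finite {n. c n \<noteq> 0}"
      by (rule finite_subset[of _ "{n. b n \<noteq> 0} \<union> {j, k}"]) (use b(1) in \<open>auto simp: c_def\<close>)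
    have c_nonneg: "0 \<le> c n" for n
      using b(2)[of n] b(2)[of k] \<delta> a(3)[of j] by (auto simp: c_def)
    have c_sum: "(\<Sum>i<n. c i) = (\<Sum>i<n. b i) - (if j < n then \<delta> else 0) + (if k < n then \<delta> else 0)" for n
    proof -
      have "c i = b i - (if i = j then \<delta> else 0) + (if i = k then \<delta> else 0)" for i
        using j by (auto simp: c_def)
      then show ?thesis
        by (simp add: sum.distrib sum_subtractf)
    qed
    \<comment> \<open>Only the partial sums with \<open>j < n \<le> k\<close> decrease, by
      \<open>\<delta>\<close>. For these, \<open>a\<close> and \<open>b\<close> agree strictly
      between \<open>j\<close> and \<open>n\<close>, so the hypothesis at \<open>j\<close> and the
      surplus at \<open>j\<close> cover the loss.\<close>
    have c_part: "(\<Sum>i<n. a i) \<le> (\<Sum>i<n. c i)" for n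
    proof (cases "j < n \<and> n \<le> k")
      case True
      have "(\<Sum>i<n. f i) = (\<Sum>i<j. f i) + f j + (\<Sum>i\<in>{Suc j..<n}. f i)" for f :: "nat \<Rightarrow> real"
        using sum.atLeastLessThan_concat[of 0 j n f] sum.atLeast_Suc_lessThan[of j n f] True
        by (simp add: atLeast0LessThan)
      note split = this
      have "(\<Sum>i\<in>{Suc j..<n}. a i) = (\<Sum>i\<in>{Suc j..<n}. b i)"
        using True between by (intro sum.cong) auto
      then have "(\<Sum>i<n. a i) \<le> (\<Sum>i<n. b i) - \<delta>"
        using part[of j] \<delta>(2) by (simp add: split[of a] split[of b])
      then show ?thesis
        using True by (simp add: c_sum)
    next
      case False
      then show ?thesis using part[of n] j(1) by (auto simp: c_sum)
    qed
    have "card {n. a n \<noteq> c n} < card {n. a n \<noteq> b n}"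
    proof (rule psubset_card_mono[OF fin])
      have ne: "a j \<noteq> b j" "a k \<noteq> b k" using j k by auto
      have "a j = c j \<or> a k = c k"
        using \<delta>(4) cj by auto
      then have "{n. a n \<noteq> c n} \<noteq> {n. a n \<noteq> b n}"
        using ne by blast
      moreover have "{n. a n \<noteq> c n} \<subseteq> {n. a n \<noteq> b n}"
      proof
        fix n assume "n \<in> {n. a n \<noteq> c n}"
        then show "n \<in> {n. a n \<noteq> b n}"
          using ne cj(3)[of n] by (cases "n = j"; cases "n = k") simp_all
      qed
      ultimately show "{n. a n \<noteq> c n} \<subset> {n. a n \<noteq> b n}" by (rule psubsetI[rotated])
    qed
    from less.hyps[OF this a(1) c_fin a(2,3) c_nonneg c_part]
    have "\<Phi> (\<lambda>n. complex_of_real (a n)) \<le> \<Phi> (\<lambda>n. complex_of_real (c n))" .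
    also have "\<dots> \<le> \<Phi> (\<lambda>n. complex_of_real (b n))"
    proof -
      \<comment> \<open>Mixing \<open>b\<close> with its transposition by weight
        \<open>\<delta> / d\<close> moves exactly \<open>\<delta>\<close> from \<open>j\<close> to
        \<open>k\<close>. Since
        \<open>b j - \<delta> \<ge> a j \<ge> a k \<ge> b k + \<delta>\<close>, this weight lies
        between 0 and 1.\<close>
      define d where "d = b j - b k"
      have d: "\<delta> \<le> d" "0 < d" using \<delta> ajk by (auto simp: d_def)
      define \<theta> where "\<theta> = 1 - \<delta> / d"
      define \<tau> where "\<tau> i = (if i = j then k else if i = k then j else i)" for i
      have \<tau>: "bij \<tau>" "\<tau> j = k" "\<tau> k = j" "\<And>i. i \<noteq> j \<Longrightarrow> i \<noteq> k \<Longrightarrow> \<tau> i = i"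
        by (auto simp: \<tau>_def intro!: involuntory_imp_bij)
      let ?b = "\<lambda>n. complex_of_real (b n)"
      have eq: "(\<lambda>n. complex_of_real (c n)) =
        (\<lambda>n. complex_of_real \<theta> * ?b n + complex_of_real (1 - \<theta>) * (?b \<circ> \<tau>) n)"
      proof
        fix n
        have "\<theta> * b j + (1 - \<theta>) * b k = b j - \<delta>"
        proof -
          have "(1 - \<theta>) * d = \<delta>" using d by (simp add: \<theta>_def)
          then show ?thesis by (simp add: d_def algebra_simps)
        qed
        moreover have "\<theta> * b k + (1 - \<theta>) * b j = b k + \<delta>"
        proof -
          have "(1 - \<theta>) * d = \<delta>" using d by (simp add: \<theta>_def)
          then show ?thesis by (simp add: d_def algebra_simps)
        qed
        ultimately have "c n = \<theta> * b n + (1 - \<theta>) * b (\<tau> n)"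
          using \<tau> cj by (cases "n = j"; cases "n = k") (auto simp: algebra_simps)
        then show "complex_of_real (c n) = complex_of_real \<theta> * ?b n + complex_of_real (1 - \<theta>) * (?b \<circ> \<tau>) n"
          by (simp only: o_def of_real_mult[symmetric] of_real_add[symmetric])
      qed
      show ?thesis
        unfolding eq using d \<delta>(1)
        by (intro sn_convex fsb fin_supp_perm \<tau>(1) sn_perm) (auto simp: \<theta>_def)
    qed
    finally show ?thesis .
  qed
qed

text \<open>Truncations increase in modulus, so their norms increase and the limit exists as a
  supremum in the extended reals.\<close>

lemma sn_extend_eq_SUP: "sn_extend \<Phi> a = (SUP n. ereal (\<Phi> (\<lambda>k. if k < n then a k else 0)))"
  unfolding sn_extend_def
  by (intro limI LIMSEQ_SUP incseq_SucI) (simp, rule sn_mono[OF fin_supp_trunc], simp)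

lemma sn_weak_majorization_trunc:
  fixes a b :: "nat \<Rightarrow> real"
  assumes "decseq a" "\<And>n. 0 \<le> a n" "\<And>n. 0 \<le> b n"
    and part: "\<And>n. (\<Sum>k<n. a k) \<le> (\<Sum>k<n. b k)"
  shows "\<Phi> (trunc n a) \<le> \<Phi> (trunc n b)"
proof -
  let ?t = "\<lambda>s k. if k < n then s k else (0::real)"
  have eq: "trunc n s = (\<lambda>k. complex_of_real (?t s k))" for s
    by auto
  have sum: "(\<Sum>k<m. ?t s k) = (\<Sum>k<min m n. s k)" for s m
    by (rule sum.mono_neutral_cong_right) auto
  have fin: "finite {k. ?t s k \<noteq> 0}" for s
    by (rule finite_subset[of _ "{..<n}"]) auto
  show ?thesis
    unfolding eq
  proof (rule sn_weak_majorization[OF fin fin])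
    show "decseq (?t a)"
      using assms(1,2) by (auto simp: decseq_def)
    show "(\<Sum>k<m. ?t a k) \<le> (\<Sum>k<m. ?t b k)" for m
      using part by (simp only: sum)
  qed (use assms in auto)
qed

end

subsection \<open>Orthonormal sequences and Bessel families\<close>

text \<open>Zero vectors are allowed, so that such sequences exist in every dimension.\<close>

definition orthonormal0 :: "(nat \<Rightarrow> 'h::complex_inner) \<Rightarrow> bool" where
  "orthonormal0 e \<longleftrightarrow> (\<forall>i j. cinner (e i) (e j) = (if i = j \<and> e i \<noteq> 0 then 1 else 0))"

definition proj :: "(nat \<Rightarrow> 'h::complex_inner) \<Rightarrow> nat \<Rightarrow> 'h \<Rightarrow>\<^sub>L 'h" where
  "proj e n = (\<Sum>k<n. rank_one (e k) (e k))"

text \<open>Families of \<open>n\<close> vectors whose synthesis map is a contraction. Unlike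
  orthonormality, this property is preserved by a map with contractive adjoint, in particular by a
  projection and its complement, and it is still strong enough for Ky Fan's inequality.\<close>

definition bessel :: "nat \<Rightarrow> (nat \<Rightarrow> 'h::complex_inner) \<Rightarrow> bool" where
  "bessel n u \<longleftrightarrow> (\<forall>x. (\<Sum>k<n. (cmod (cinner x (u k)))\<^sup>2) \<le> (norm x)\<^sup>2)"

lemma proj_apply: "blinfun_apply (proj e n) x = (\<Sum>k<n. cinner x (e k) *\<^sub>C e k)"
  by (simp add: proj_def blinfun.sum_left)

lemma proj_bounded_ops [intro, simp]: "proj e n \<in> bounded_ops"
  unfolding proj_def by (intro bounded_ops_sum) simp

lemma proj_selfadjoint: "cinner (blinfun_apply (proj e n) x) y = cinner x (blinfun_apply (proj e n) y)"
  by (simp add: proj_apply cinner.sum_left cinner.sum_right cinner_scaleC_left cinner_scaleC_right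
      cinner_commute[of _ y] mult.commute)

lemma cinner_proj:
  assumes "orthonormal0 e"
  shows "cinner (blinfun_apply (proj e n) x) (e j) = (if j < n then cinner x (e j) else 0)"
proof -
  have "cinner (blinfun_apply (proj e n) x) (e j) = (\<Sum>k<n. if k = j then cinner x (e j) else 0)"
    unfolding proj_apply cinner.sum_left cinner_scaleC_left
    using assms by (intro sum.cong) (auto simp: orthonormal0_def cinner.zero_right)
  then show ?thesis by simp
qed

lemma proj_absorb:
  assumes "orthonormal0 e" "n \<le> m"
  shows "blinfun_apply (proj e m) (blinfun_apply (proj e n) x) = blinfun_apply (proj e n) x"
proof -
  have "blinfun_apply (proj e m) (blinfun_apply (proj e n) x)
      = (\<Sum>k<m. if k < n then cinner x (e k) *\<^sub>C e k else 0)"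
    unfolding proj_apply[of e m] cinner_proj[OF assms(1)]
    by (intro sum.cong) (auto simp: scaleC.zero_left)
  also have "\<dots> = (\<Sum>k<n. cinner x (e k) *\<^sub>C e k)"
    using assms(2) by (intro sum.mono_neutral_cong_right) auto
  finally show ?thesis by (simp add: proj_apply)
qed

lemma proj_complement_orthogonal:
  assumes "orthonormal0 e" "j < n"
  shows "cinner (x - blinfun_apply (proj e n) x) (e j) = 0"
  using assms by (simp add: cinner.diff_left cinner_proj)

lemma norm_proj_pythagoras:
  assumes "orthonormal0 e"
  shows "(norm x)\<^sup>2 = (norm (blinfun_apply (proj e n) x))\<^sup>2 + (norm (x - blinfun_apply (proj e n) x))\<^sup>2"
proof -
  define p where "p = blinfun_apply (proj e n) x"
  have "cinner p (x - p) = cinner x (blinfun_apply (proj e n) (x - p))"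
    unfolding p_def by (rule proj_selfadjoint)
  also have "blinfun_apply (proj e n) (x - p) = 0"
    using proj_absorb[OF assms order_refl, of n x] by (simp add: p_def blinfun.diff_right)
  finally have "Re (cinner p (x - p)) = 0" by (simp add: cinner.zero_right)
  then show ?thesis
    using norm_add_sq[of p "x - p"] by (simp add: p_def)
qed

lemma norm_proj_le:
  assumes "orthonormal0 e"
  shows "norm (blinfun_apply (proj e n) x) \<le> norm x"
    and "norm (x - blinfun_apply (proj e n) x) \<le> norm x"
  by (rule power2_le_imp_le; use norm_proj_pythagoras[OF assms, of x n] in simp)+

lemma norm_proj_sq:
  assumes "orthonormal0 e"
  shows "(norm (blinfun_apply (proj e n) x))\<^sup>2 = (\<Sum>k<n. (cmod (cinner x (e k)))\<^sup>2)"
proof -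
  let ?p = "blinfun_apply (proj e n) x"
  have "complex_of_real ((norm ?p)\<^sup>2) = cinner ?p (\<Sum>k<n. cinner x (e k) *\<^sub>C e k)"
    unfolding cinner_self[symmetric] by (simp add: proj_apply)
  also have "\<dots> = (\<Sum>k<n. cnj (cinner x (e k)) * cinner x (e k))"
    unfolding cinner.sum_right cinner_scaleC_right cinner_proj[OF assms] by (intro sum.cong) auto
  also have "\<dots> = complex_of_real (\<Sum>k<n. (cmod (cinner x (e k)))\<^sup>2)"
    by (simp only: of_real_sum complex_norm_square mult.commute)
  finally show ?thesis by (simp only: of_real_eq_iff)
qed

lemma bessel_orthonormal0: "orthonormal0 e \<Longrightarrow> bessel n e"
  unfolding bessel_def by (simp add: norm_proj_sq[symmetric] norm_proj_le power_mono)

lemma bessel_image: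
  assumes "bessel n u" and adj: "\<And>x y. cinner x (T y) = cinner (S x) y" and "\<And>x. norm (S x) \<le> norm x"
  shows "bessel n (\<lambda>k. T (u k))"
  unfolding bessel_def
proof
  fix x
  have "(\<Sum>k<n. (cmod (cinner x (T (u k))))\<^sup>2) \<le> (norm (S x))\<^sup>2"
    using assms(1) by (simp add: bessel_def adj)
  also have "\<dots> \<le> (norm x)\<^sup>2"
    using assms(3) by (simp add: power_mono)
  finally show "(\<Sum>k<n. (cmod (cinner x (T (u k))))\<^sup>2) \<le> (norm x)\<^sup>2" .
qed

lemma bessel_proj:
  assumes "orthonormal0 e" "bessel n u"
  shows "bessel n (\<lambda>k. blinfun_apply (proj e m) (u k))"
  by (rule bessel_image[OF assms(2), of _ "blinfun_apply (proj e m)"])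
     (simp_all add: proj_selfadjoint norm_proj_le[OF assms(1)])

lemma bessel_proj_complement:
  assumes "orthonormal0 e" "bessel n u"
  shows "bessel n (\<lambda>k. u k - blinfun_apply (proj e m) (u k))"
  by (rule bessel_image[OF assms(2), of _ "\<lambda>x. x - blinfun_apply (proj e m) x"])
     (simp_all add: cinner.diff_left cinner.diff_right proj_selfadjoint norm_proj_le[OF assms(1)])

text \<open>Testing the Bessel inequality at \<open>u k\<close> itself gives
  \<open>norm (u k) ^ 4 \<le> norm (u k) ^ 2\<close>.\<close>

lemma bessel_norm_le_1:
  assumes "bessel n u" "k < n"
  shows "norm (u k) \<le> 1"
proof -
  have "((norm (u k))\<^sup>2)\<^sup>2 = (cmod (cinner (u k) (u k)))\<^sup>2"
    by (simp only: cinner_self norm_of_real abs_power2)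
  also have "\<dots> \<le> (\<Sum>j<n. (cmod (cinner (u k) (u j)))\<^sup>2)"
    using assms(2) by (intro member_le_sum) auto
  also have "\<dots> \<le> (norm (u k))\<^sup>2"
    using assms(1) by (simp add: bessel_def)
  finally have le: "(norm (u k))\<^sup>2 * (norm (u k))\<^sup>2 \<le> (norm (u k))\<^sup>2 * 1"
    by (simp only: power2_eq_square[of "(norm (u k))\<^sup>2"] mult_1_right)
  show ?thesis
  proof (cases "u k = 0")
    case False
    then have "0 < (norm (u k))\<^sup>2" by simp
    with le have "(norm (u k))\<^sup>2 \<le> 1\<^sup>2"
      by (simp only: mult_le_cancel_left_pos power_one)
    then show ?thesis by (rule power2_le_imp_le) simp
  qed simp
qed

subsection \<open>Schmidt systems of compact operators\<close>

text \<open>A maximiser of the norm of \<open>A x\<close> over the unit ball of \<open>V\<close>,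
  the building block of the Schmidt vectors. The alternative \<open>x = 0\<close> covers the case
  that \<open>A\<close> vanishes on \<open>V\<close>, in particular \<open>V = {0}\<close>.\<close>

lemma compact_op_attains_norm:
  fixes A :: "'h::chilbert_space \<Rightarrow>\<^sub>L 'h"
  assumes A: "compact_op A" and "closed V" and V: "subspace V"
  shows "\<exists>x\<in>V. (norm x = 1 \<or> x = 0) \<and> (\<forall>y\<in>V. norm (blinfun_apply A y) \<le> norm (blinfun_apply A x) * norm y)"
proof -
  define S where "S = (\<lambda>x. norm (blinfun_apply A x)) ` {x \<in> V. norm x \<le> 1}"
  define \<alpha> where "\<alpha> = Sup S"
  have bdd: "bdd_above S"
  proof (rule bdd_aboveI)
    fix s assume "s \<in> S"
    then obtain x where "s = norm (blinfun_apply A x)" "norm x \<le> 1" by (auto simp: S_def)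
    then show "s \<le> norm A"
      using norm_blinfun[of A x] mult_left_mono[of "norm x" 1 "norm A"] by simp
  qed
  have "0 \<in> S"
    unfolding S_def using subspace_0[OF V] by (intro image_eqI[of _ _ 0]) (auto simp: blinfun.zero_right)
  then have "0 \<le> \<alpha>" unfolding \<alpha>_def by (rule cSup_upper[OF _ bdd])
  have bound: "norm (blinfun_apply A y) \<le> \<alpha> * norm y" if y: "y \<in> V" for y
  proof (cases "y = 0")
    case False
    have "norm (blinfun_apply A ((1 / norm y) *\<^sub>R y)) \<le> \<alpha>"
      unfolding \<alpha>_def S_def[symmetric]
      by (rule cSup_upper[OF _ bdd])
         (use y False in \<open>auto simp: S_def intro!: imageI subspace_scale[OF V]\<close>)
    then show ?thesis
      using False by (simp add: blinfun.scaleR_right field_simps)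
  qed (simp add: blinfun.zero_right)
  show ?thesis
  proof (cases "\<alpha> = 0")
    case True
    then show ?thesis
      using bound subspace_0[OF V] by (intro bexI[of _ 0]) (auto simp: blinfun.zero_right)
  next
    case False
    with \<open>0 \<le> \<alpha>\<close> have "0 < \<alpha>" by simp
    have "\<exists>x. x \<in> V \<and> norm x \<le> 1 \<and> \<alpha> - inverse (real (Suc n)) < norm (blinfun_apply A x)" for n
    proof -
      have "\<alpha> - inverse (real (Suc n)) < Sup S" by (simp add: \<alpha>_def)
      then obtain s where "s \<in> S" "\<alpha> - inverse (real (Suc n)) < s"
        using less_cSup_iff[OF _ bdd] \<open>0 \<in> S\<close> by blast
      then show ?thesis by (auto simp: S_def)
    qed
    then obtain x0 where x0: "\<And>n. x0 n \<in> V" "\<And>n. norm (x0 n) \<le> 1"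
      "\<And>n. \<alpha> - inverse (real (Suc n)) < norm (blinfun_apply A (x0 n))"
      by metis
    obtain r :: "nat \<Rightarrow> nat" where r: "strict_mono r" and C: "Cauchy (\<lambda>n. blinfun_apply A (x0 (r n)))"
      using compact_op_Cauchy[of A x0 1, OF A x0(2)] by (elim exE conjE)
    define x where "x n = x0 (r n)" for n
    have x: "x n \<in> V" "norm (x n) \<le> 1" for n
      using x0 by (simp_all add: x_def)
    have xA: "\<alpha> - inverse (real (Suc n)) < norm (blinfun_apply A (x n))" for n
    proof -
      have "inverse (real (Suc (r n))) \<le> inverse (real (Suc n))"
        using seq_suble[OF r, of n] by simp
      then show ?thesis using x0(3)[of "r n"] unfolding x_def by linarith
    qed
    \<comment> \<open>The images converge, so the midpoints are nearly maximising as well, and the parallelogram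
      law makes the maximising sequence itself converge in norm.\<close>
    have "Cauchy x"
    proof (rule metric_CauchyI)
      fix \<epsilon> :: real assume "0 < \<epsilon>"
      \<comment> \<open>The estimate below is \<open>norm (x i + x j) > 2 - 3 * \<delta>\<close>. By
        the parallelogram law the squared distance is then less than
        \<open>4 - (2 - 3 * \<delta>)\<^sup>2\<close>, hence less than \<open>12 * \<delta>\<close>;
        the cap \<open>1/2\<close> keeps \<open>2 - 3 * \<delta>\<close> positive for the
        squaring.\<close>
      define \<delta> where "\<delta> = min (\<epsilon>\<^sup>2 / 12) (1/2)"
      have \<delta>: "0 < \<delta>" "12 * \<delta> \<le> \<epsilon>\<^sup>2" "\<delta> \<le> 1/2" using \<open>0 < \<epsilon>\<close> by (auto simp: \<delta>_def)
      obtain N1 where N1: "inverse (real (Suc N1)) < \<alpha> * \<delta>"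
        using reals_Archimedean[of "\<alpha> * \<delta>"] \<open>0 < \<alpha>\<close> \<delta>(1) by auto
      have "0 < \<alpha> * \<delta>" using \<open>0 < \<alpha>\<close> \<delta>(1) by simp
      from metric_CauchyD[OF C this] obtain N2 where
        N2: "\<And>i j. i \<ge> N2 \<Longrightarrow> j \<ge> N2 \<Longrightarrow> dist (blinfun_apply A (x i)) (blinfun_apply A (x j)) < \<alpha> * \<delta>"
        unfolding x_def by blast
      have "dist (x i) (x j) < \<epsilon>" if ij: "i \<ge> max N1 N2" "j \<ge> max N1 N2" for i j
      proof -
        have "inverse (real (Suc i)) \<le> inverse (real (Suc N1))" using ij by simp
        then have Ai: "\<alpha> - \<alpha> * \<delta> < norm (blinfun_apply A (x i))"
          using xA[of i] N1 by linarith
        have Aij: "norm (blinfun_apply A (x i) - blinfun_apply A (x j)) < \<alpha> * \<delta>"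
          using N2[of i j] ij by (simp add: dist_norm)
        have eq: "2 *\<^sub>R blinfun_apply A (x i)
            = blinfun_apply A (x i + x j) + (blinfun_apply A (x i) - blinfun_apply A (x j))"
          by (simp add: blinfun.add_right scaleR_2)
        have "2 * norm (blinfun_apply A (x i)) = norm (2 *\<^sub>R blinfun_apply A (x i))" by simp
        also have "\<dots> \<le> norm (blinfun_apply A (x i + x j)) + norm (blinfun_apply A (x i) - blinfun_apply A (x j))"
          unfolding eq by (rule norm_triangle_ineq)
        also have "\<dots> \<le> \<alpha> * norm (x i + x j) + \<alpha> * \<delta>"
          using Aij bound[OF subspace_add[OF V x(1)[of i] x(1)[of j]]] by linarith
        finally have "\<alpha> * (2 - 3 * \<delta>) < \<alpha> * norm (x i + x j)"
          using Ai by (simp add: algebra_simps)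
        then have "2 - 3 * \<delta> < norm (x i + x j)"
          using \<open>0 < \<alpha>\<close> by simp
        moreover have "0 \<le> 2 - 3 * \<delta>" using \<delta> by simp
        ultimately have "(2 - 3 * \<delta>)\<^sup>2 < (norm (x i + x j))\<^sup>2"
          by (intro power_strict_mono) auto
        moreover have "(2 - 3 * \<delta>)\<^sup>2 = 4 - 12 * \<delta> + 9 * \<delta>\<^sup>2"
          by (simp add: power2_eq_square algebra_simps)
        moreover have "(norm (x i))\<^sup>2 \<le> 1" "(norm (x j))\<^sup>2 \<le> 1"
          using x(2)[of i] x(2)[of j] by (simp_all add: power_le_one)
        moreover have "0 \<le> \<delta>\<^sup>2" by simp
        ultimately have "(norm (x i - x j))\<^sup>2 < \<epsilon>\<^sup>2"
          using parallelogram[of "x i" "x j"] \<delta>(2) by linarith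
        then show ?thesis
          using \<open>0 < \<epsilon>\<close> by (simp add: dist_norm power_less_imp_less_base)
      qed
      then show "\<exists>N. \<forall>i\<ge>N. \<forall>j\<ge>N. dist (x i) (x j) < \<epsilon>" by blast
    qed
    then obtain l where l: "x \<longlonglongrightarrow> l"
      using Cauchy_convergent convergent_def by blast
    have lV: "l \<in> V"
      using closed_sequentially[OF \<open>closed V\<close> x(1) l] .
    have l1: "norm l \<le> 1"
      by (rule LIMSEQ_le_const2[OF tendsto_norm[OF l]]) (use x(2) in auto)
    have "\<alpha> \<le> norm (blinfun_apply A l)"
    proof (rule LIMSEQ_le)
      show "(\<lambda>n. \<alpha> - inverse (real (Suc n))) \<longlonglongrightarrow> \<alpha>"
        using tendsto_diff[OF tendsto_const[of \<alpha>] LIMSEQ_inverse_real_of_nat] by simp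
      show "(\<lambda>n. norm (blinfun_apply A (x n))) \<longlonglongrightarrow> norm (blinfun_apply A l)"
        by (intro tendsto_norm blinfun.tendsto[OF tendsto_const l])
      show "\<exists>N. \<forall>n\<ge>N. \<alpha> - inverse (real (Suc n)) \<le> norm (blinfun_apply A (x n))"
        using less_imp_le[OF xA] by blast
    qed
    moreover have "\<alpha> * norm l \<le> \<alpha> * 1"
      using l1 \<open>0 < \<alpha>\<close> by (intro mult_left_mono) auto
    ultimately have "\<alpha> * norm l = \<alpha>" and A_l: "norm (blinfun_apply A l) = \<alpha>"
      using bound[OF lV] by linarith+
    then have "norm l = 1" using \<open>0 < \<alpha>\<close> by simp
    moreover have "\<forall>y\<in>V. norm (blinfun_apply A y) \<le> norm (blinfun_apply A l) * norm y"
      unfolding A_l using bound by blast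
    ultimately show ?thesis
      using lV by blast
  qed
qed

text \<open>Greedy choice: a maximiser of the norm of \<open>A x\<close> among the unit vectors
  orthogonal to the earlier choices, or zero. Quantifying over the set \<open>{..<n}\<close> makes
  the descent of the recursive calls visible.\<close>

fun schmidt_vec :: "('h::complex_inner \<Rightarrow>\<^sub>L 'h) \<Rightarrow> nat \<Rightarrow> 'h" where
  "schmidt_vec A n = (SOME x. (\<forall>k\<in>{..<n}. cinner x (schmidt_vec A k) = 0) \<and> (norm x = 1 \<or> x = 0) \<and>
     (\<forall>y. (\<forall>k\<in>{..<n}. cinner y (schmidt_vec A k) = 0) \<longrightarrow>
        norm (blinfun_apply A y) \<le> norm (blinfun_apply A x) * norm y))"

declare schmidt_vec.simps [simp del]

text \<open>The right singular vectors of \<open>A\<close>, described without its adjoint. The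
  second clause is the first order condition at a maximiser and later yields the eigenvector
  equation; the third is extremality, and the fourth records compactness.\<close>

definition schmidt_system :: "('h::complex_inner \<Rightarrow>\<^sub>L 'h) \<Rightarrow> (nat \<Rightarrow> 'h) \<Rightarrow> bool" where
  "schmidt_system A e \<longleftrightarrow> orthonormal0 e \<and>
     (\<forall>n h. (\<forall>k\<le>n. cinner h (e k) = 0) \<longrightarrow> cinner (blinfun_apply A (e n)) (blinfun_apply A h) = 0) \<and>
     (\<forall>n x. (\<forall>k<n. cinner x (e k) = 0) \<longrightarrow> norm (blinfun_apply A x) \<le> norm (blinfun_apply A (e n)) * norm x) \<and>
     (\<lambda>n. norm (blinfun_apply A (e n))) \<longlonglongrightarrow> 0"

text \<open>Moving from \<open>x\<close> along \<open>c *\<^sub>C h\<close> changes the squared norm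
  of the image to first order by \<open>2 * Re (cnj c * z)\<close>. With \<open>c = z / K\<close>
  this gain is twice \<open>(cmod z)\<^sup>2 / K\<close>, while the allowed growth is at most
  \<open>(cmod z)\<^sup>2 / K\<close>, so \<open>z\<close> must vanish. The summand 1 in
  \<open>K\<close> keeps it positive.\<close>

lemma first_variation:
  fixes A :: "'h::complex_inner \<Rightarrow>\<^sub>L 'h"
  assumes A: "A \<in> bounded_ops" and x: "norm x = 1" and xh: "cinner x h = 0"
    and max: "\<And>c. norm (blinfun_apply A (x + c *\<^sub>C h)) \<le> norm (blinfun_apply A x) * norm (x + c *\<^sub>C h)"
  shows "cinner (blinfun_apply A x) (blinfun_apply A h) = 0"
proof -
  define z where "z = cinner (blinfun_apply A x) (blinfun_apply A h)"
  define s where "s = norm (blinfun_apply A x)"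
  define K where "K = s\<^sup>2 * (norm h)\<^sup>2 + 1"
  have "K > 0" by (simp add: K_def add_nonneg_pos)
  define c where "c = complex_of_real (1 / K) * z"
  have c2: "(cmod c)\<^sup>2 = (cmod z)\<^sup>2 / K\<^sup>2"
    using \<open>K > 0\<close> by (simp add: c_def norm_mult norm_divide power_divide)
  have "(norm (blinfun_apply A (x + c *\<^sub>C h)))\<^sup>2 \<le> (s * norm (x + c *\<^sub>C h))\<^sup>2"
    unfolding s_def by (intro power_mono max) simp
  moreover have "(norm (x + c *\<^sub>C h))\<^sup>2 = 1 + (cmod c)\<^sup>2 * (norm h)\<^sup>2"
    by (simp add: norm_add_sq x xh cinner_scaleC_right norm_scaleC power_mult_distrib)
  moreover have "(norm (blinfun_apply A (x + c *\<^sub>C h)))\<^sup>2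
      = s\<^sup>2 + (cmod c)\<^sup>2 * (norm (blinfun_apply A h))\<^sup>2 + 2 * Re (cnj c * z)"
    by (simp add: blinfun.add_right bounded_opsD[OF A] norm_add_sq cinner_scaleC_right norm_scaleC
        power_mult_distrib s_def z_def)
  moreover have "Re (cnj c * z) = (cmod z)\<^sup>2 / K"
  proof -
    have "cnj c * z = complex_of_real ((cmod z)\<^sup>2 / K)"
      by (simp add: c_def complex_norm_square mult.commute[of z] del: of_real_power)
    then show ?thesis by (simp only: Re_complex_of_real)
  qed
  ultimately have "2 * ((cmod z)\<^sup>2 / K) + (cmod c)\<^sup>2 * (norm (blinfun_apply A h))\<^sup>2 \<le> (cmod c)\<^sup>2 * (s\<^sup>2 * (norm h)\<^sup>2)"
    by (simp add: power_mult_distrib algebra_simps)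
  moreover have "(cmod c)\<^sup>2 * (s\<^sup>2 * (norm h)\<^sup>2) \<le> (cmod c)\<^sup>2 * K"
    by (intro mult_left_mono) (simp_all add: K_def)
  moreover have "(cmod c)\<^sup>2 * K = (cmod z)\<^sup>2 / K"
    using \<open>K > 0\<close> by (simp add: c2 power2_eq_square[of K])
  moreover have "0 \<le> (cmod c)\<^sup>2 * (norm (blinfun_apply A h))\<^sup>2" by simp
  ultimately have "(cmod z)\<^sup>2 / K \<le> 0" by linarith
  then show ?thesis
    using \<open>K > 0\<close> by (simp add: divide_le_0_iff z_def)
qed

lemma ex_schmidt_system:
  fixes A :: "'h::chilbert_space \<Rightarrow>\<^sub>L 'h"
  assumes A: "compact_op A"
  shows "\<exists>e. schmidt_system A e"
proof -
  define e where "e = schmidt_vec A"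
  have spec: "(\<forall>k<n. cinner (e n) (e k) = 0) \<and> (norm (e n) = 1 \<or> e n = 0) \<and>
     (\<forall>y. (\<forall>k<n. cinner y (e k) = 0) \<longrightarrow>
        norm (blinfun_apply A y) \<le> norm (blinfun_apply A (e n)) * norm y)" for n
  proof -
    define V where "V = {x. \<forall>k\<in>{..<n}. cinner x (e k) = 0}"
    have "V = (\<Inter>k\<in>{..<n}. {x. cinner x (e k) = 0})" by (auto simp: V_def)
    moreover have "closed {x. cinner x (e k) = 0}" for k
      by (rule closed_Collect_eq) (intro cinner.continuous_on continuous_intros)+
    ultimately have "closed V" by auto
    moreover have "subspace V"
      by (rule subspaceI) (auto simp: V_def cinner_add_left cinner_scaleR_left cinner.zero_left)
    ultimately have "\<exists>x. (\<forall>k\<in>{..<n}. cinner x (e k) = 0) \<and> (norm x = 1 \<or> x = 0) \<and>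
       (\<forall>y. (\<forall>k\<in>{..<n}. cinner y (e k) = 0) \<longrightarrow>
        norm (blinfun_apply A y) \<le> norm (blinfun_apply A x) * norm y)"
      using compact_op_attains_norm[OF A, of V] unfolding V_def by blast
    from someI_ex[OF this] show ?thesis
      unfolding e_def schmidt_vec.simps[of A n, symmetric] by simp
  qed
  have orth: "cinner (e n) (e k) = 0" if "k < n" for n k using spec that by blast
  have nrm: "norm (e n) = 1 \<or> e n = 0" for n using spec by blast
  have max: "norm (blinfun_apply A y) \<le> norm (blinfun_apply A (e n)) * norm y"
    if "\<forall>k<n. cinner y (e k) = 0" for n y
    using spec that by blast
  have on: "orthonormal0 e"
    unfolding orthonormal0_def
  proof (intro allI)
    fix i j
    show "cinner (e i) (e j) = (if i = j \<and> e i \<noteq> 0 then 1 else 0)"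
    proof (cases i j rule: linorder_cases)
      case less
      then show ?thesis using orth[of i j] cinner_commute[of "e i" "e j"] by simp
    next
      case equal
      then show ?thesis using nrm[of i] by (auto simp: cinner_self)
    next
      case greater
      then show ?thesis using orth[of j i] by simp
    qed
  qed
  \<comment> \<open>Adding multiples of \<open>h\<close> to \<open>e n\<close> does not leave the
    complement over which \<open>e n\<close> is extremal, so the first variation vanishes.\<close>
  have var: "cinner (blinfun_apply A (e n)) (blinfun_apply A h) = 0" if h: "\<forall>k\<le>n. cinner h (e k) = 0" for n h
  proof (cases "e n = 0")
    case False
    then have 1: "norm (e n) = 1" using nrm[of n] by simp
    have 2: "cinner (e n) h = 0"
      using h cinner_commute[of "e n" h] by simp
    show ?thesis
    proof (rule first_variation[OF compact_op_bounded_ops[OF A] 1 2])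
      fix c
      show "norm (blinfun_apply A (e n + c *\<^sub>C h)) \<le> norm (blinfun_apply A (e n)) * norm (e n + c *\<^sub>C h)"
        by (rule max) (simp add: cinner_add_left cinner_scaleC_left orth h)
    qed
  qed (simp add: blinfun.zero_right cinner.zero_left)
  define s where "s n = norm (blinfun_apply A (e n))" for n
  have dec: "decseq s"
  proof (rule decseq_SucI)
    fix n
    have "s (Suc n) \<le> s n * norm (e (Suc n))"
      unfolding s_def by (rule max) (simp add: orth)
    also have "\<dots> \<le> s n"
      using nrm[of "Suc n"] by (auto simp: s_def)
    finally show "s (Suc n) \<le> s n" .
  qed
  have "s \<longlonglongrightarrow> 0"
  proof (rule LIMSEQ_I)
    fix \<epsilon> :: real assume "0 < \<epsilon>"
    \<comment> \<open>Otherwise the images of the \<open>e n\<close> would be pairwise orthogonal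
      with norms at least \<open>\<epsilon>\<close>, hence at mutual distance at least
      \<open>\<epsilon>\<close>, and no subsequence could be Cauchy.\<close>
    have "\<exists>N. s N < \<epsilon>"
    proof (rule ccontr)
      assume "\<not> (\<exists>N. s N < \<epsilon>)"
      then have ge: "\<epsilon> \<le> s n" for n by (simp add: not_less)
      have le1: "norm (e n) \<le> 1" for n using nrm[of n] by auto
      obtain r :: "nat \<Rightarrow> nat" where r: "strict_mono r" and C: "Cauchy (\<lambda>n. blinfun_apply A (e (r n)))"
        using compact_op_Cauchy[of A e 1, OF A le1] by (elim exE conjE)
      from metric_CauchyD[OF C \<open>0 < \<epsilon>\<close>] obtain N
        where N: "\<And>i j. i \<ge> N \<Longrightarrow> j \<ge> N \<Longrightarrow> dist (blinfun_apply A (e (r i))) (blinfun_apply A (e (r j))) < \<epsilon>"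
        by blast
      define i j where "i = r N" and "j = r (Suc N)"
      have ij: "i < j" using r by (simp add: i_def j_def strict_mono_def)
      have lt: "norm (blinfun_apply A (e i) - blinfun_apply A (e j)) < \<epsilon>"
        using N[of N "Suc N"] by (simp add: dist_norm i_def j_def)
      have "cinner (blinfun_apply A (e i)) (blinfun_apply A (- e j)) = 0"
        by (rule var) (use ij orth in \<open>auto simp: cinner.minus_left\<close>)
      then have "(norm (blinfun_apply A (e i) + blinfun_apply A (- e j)))\<^sup>2 = (s i)\<^sup>2 + (s j)\<^sup>2"
        by (simp only: norm_add_sq) (simp add: s_def blinfun.minus_right)
      also have "\<dots> \<ge> \<epsilon>\<^sup>2"
        using power_mono[OF ge[of i], of 2] \<open>0 < \<epsilon>\<close> by (simp add: add_increasing2)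
      finally have "\<epsilon> \<le> norm (blinfun_apply A (e i) + blinfun_apply A (- e j))"
        by (rule power2_le_imp_le) simp
      with lt show False by (simp add: blinfun.minus_right)
    qed
    then obtain N where "s N < \<epsilon>" ..
    have "norm (s n - 0) < \<epsilon>" if "N \<le> n" for n
      using decseqD[OF dec that] \<open>s N < \<epsilon>\<close> by (simp add: s_def)
    then show "\<exists>N. \<forall>n\<ge>N. norm (s n - 0) < \<epsilon>" by blast
  qed
  then have "schmidt_system A e"
    unfolding schmidt_system_def s_def using on var max by blast
  then show ?thesis by (rule exI[of _ e])
qed

subsection \<open>Singular values\<close>

text \<open>Gives the uniqueness in the description of the singular values. At the first index where
  the sequences differ, the level set of the larger value, taken for the smaller sequence, is
  contained in the one for the larger sequence and misses that index. Convergence to zero makes the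
  level sets finite, so the cardinalities differ.\<close>

lemma decseq_eqI_card_level_sets:
  fixes s t :: "nat \<Rightarrow> real"
  assumes "decseq s" "decseq t" "\<And>n. 0 \<le> s n" "\<And>n. 0 \<le> t n" "s \<longlonglongrightarrow> 0" "t \<longlonglongrightarrow> 0"
    and card: "\<And>\<sigma>. 0 < \<sigma> \<Longrightarrow> card {n. s n = \<sigma>} = card {n. t n = \<sigma>}"
  shows "s = t"
proof (rule ccontr)
  have False
    if dec: "decseq p" "decseq q" and lim: "p \<longlonglongrightarrow> 0" and nn: "0 \<le> q n"
      and card: "\<And>\<sigma>. 0 < \<sigma> \<Longrightarrow> card {n. p n = \<sigma>} = card {n. q n = \<sigma>}"
      and eq: "\<And>k. k < n \<Longrightarrow> p k = q k" and gt: "q n < p n"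
    for p q :: "nat \<Rightarrow> real" and n
  proof -
    define \<sigma> where "\<sigma> = p n"
    have "0 < \<sigma>" using gt nn by (simp add: \<sigma>_def)
    have "eventually (\<lambda>k. p k < \<sigma>) sequentially"
      by (rule order_tendstoD(2)[OF lim \<open>0 < \<sigma>\<close>])
    then obtain N where N: "\<And>k. k \<ge> N \<Longrightarrow> p k < \<sigma>"
      unfolding eventually_sequentially by blast
    have fin: "finite {k. p k = \<sigma>}"
    proof (rule finite_subset)
      show "{k. p k = \<sigma>} \<subseteq> {..<N}"
      proof
        fix k assume "k \<in> {k. p k = \<sigma>}"
        then show "k \<in> {..<N}" using N[of k] by (cases "k < N") auto
      qed
    qed simp
    have "{k. q k = \<sigma>} \<subseteq> {k. p k = \<sigma>} - {n}"
    proof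
      fix k assume k: "k \<in> {k. q k = \<sigma>}"
      have "k < n"
      proof (rule ccontr)
        assume "\<not> k < n"
        then have "q k \<le> q n" using decseqD[OF dec(2), of n k] by simp
        then show False using k gt by (simp add: \<sigma>_def)
      qed
      then show "k \<in> {k. p k = \<sigma>} - {n}" using k eq by simp
    qed
    then have "card {k. q k = \<sigma>} \<le> card ({k. p k = \<sigma>} - {n})"
      using fin by (intro card_mono) auto
    also have "\<dots> < card {k. p k = \<sigma>}"
      using fin by (intro card_Diff1_less) (auto simp: \<sigma>_def)
    finally show False using card[OF \<open>0 < \<sigma>\<close>] by simp
  qed
  note key = this
  assume "s \<noteq> t"
  then have ex: "\<exists>n. s n \<noteq> t n" by auto
  define n where "n = (LEAST n. s n \<noteq> t n)"
  have ne: "s n \<noteq> t n" unfolding n_def using ex by (rule LeastI_ex)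
  have eq: "s k = t k" if "k < n" for k
    using not_less_Least[of k "\<lambda>n. s n \<noteq> t n"] that by (simp add: n_def)
  show False
  proof (cases "t n < s n")
    case True
    show False
      by (rule key[OF assms(1,2,5) assms(4) card eq True])
  next
    case False
    then have "s n < t n" using ne by simp
    show False
      by (rule key[OF assms(2,1,6) assms(3) card[symmetric] eq[symmetric] \<open>s n < t n\<close>])
  qed
qed

lemma schmidt_systemD:
  assumes "schmidt_system A e"
  shows "orthonormal0 e"
    and "(\<And>k. k \<le> n \<Longrightarrow> cinner h (e k) = 0) \<Longrightarrow> cinner (blinfun_apply A (e n)) (blinfun_apply A h) = 0"
    and "(\<And>k. k < n \<Longrightarrow> cinner x (e k) = 0) \<Longrightarrow> norm (blinfun_apply A x) \<le> norm (blinfun_apply A (e n)) * norm x"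
    and "(\<lambda>n. norm (blinfun_apply A (e n))) \<longlonglongrightarrow> 0"
  using assms unfolding schmidt_system_def by blast+

lemma orthonormal0D:
  assumes "orthonormal0 e"
  shows "i \<noteq> j \<Longrightarrow> cinner (e i) (e j) = 0" and "norm (e i) \<le> 1" and "e i \<noteq> 0 \<Longrightarrow> norm (e i) = 1"
proof -
  show "i \<noteq> j \<Longrightarrow> cinner (e i) (e j) = 0"
    using assms by (simp add: orthonormal0_def)
  show 1: "norm (e i) = 1" if "e i \<noteq> 0"
  proof -
    have "cinner (e i) (e i) = 1" using assms that by (simp add: orthonormal0_def)
    then have "complex_of_real ((norm (e i))\<^sup>2) = complex_of_real 1"
      by (simp only: cinner_self of_real_1)
    then have "(norm (e i))\<^sup>2 = 1" by (simp only: of_real_eq_iff)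
    then show ?thesis using norm_ge_zero[of "e i"] unfolding power2_eq_1_iff by linarith
  qed
  then show "norm (e i) \<le> 1" by (cases "e i = 0") auto
qed

section \<open>Singular values and Ky Fan sums read off from a Schmidt system\<close>

context
  fixes A :: "'h::chilbert_space \<Rightarrow>\<^sub>L 'h" and e :: "nat \<Rightarrow> 'h" and s :: "nat \<Rightarrow> real"
  assumes A: "A \<in> bounded_ops" and e: "schmidt_system A e"
  defines "s \<equiv> \<lambda>n. norm (blinfun_apply A (e n))"
begin

private lemmas on = schmidt_systemD(1)[OF e]

private lemma s_nonneg: "0 \<le> s n" by (simp add: s_def)

private lemma s_tendsto: "s \<longlonglongrightarrow> 0"
  unfolding s_def by (rule schmidt_systemD(4)[OF e])

private lemma bound: "(\<And>k. k < n \<Longrightarrow> cinner x (e k) = 0) \<Longrightarrow> norm (blinfun_apply A x) \<le> s n * norm x"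
  unfolding s_def by (rule schmidt_systemD(3)[OF e])

private lemma s_decseq: "decseq s"
proof (rule decseq_SucI)
  fix n
  have "s (Suc n) \<le> s n * norm (e (Suc n))"
    unfolding s_def by (rule bound[unfolded s_def]) (simp add: orthonormal0D[OF on])
  also have "\<dots> \<le> s n * 1"
    by (intro mult_left_mono orthonormal0D[OF on] s_nonneg)
  finally show "s (Suc n) \<le> s n" by simp
qed

private lemma A_orth: "m \<noteq> n \<Longrightarrow> cinner (blinfun_apply A (e m)) (blinfun_apply A (e n)) = 0"
proof (induction m n rule: linorder_wlog)
  case (le m n)
  then show ?case by (intro schmidt_systemD(2)[OF e]) (simp add: orthonormal0D[OF on])
next
  case (sym m n)
  then show ?case using cinner_commute[of "blinfun_apply A (e n)"] by simp
qed

private lemma A_proj: "blinfun_apply A (blinfun_apply (proj e n) x) = (\<Sum>k<n. cinner x (e k) *\<^sub>C blinfun_apply A (e k))"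
  by (simp add: proj_apply blinfun.sum_right bounded_opsD[OF A])

private lemma A_star_A: "cinner (blinfun_apply (cadjoint A o\<^sub>L A) x) y = cinner (blinfun_apply A x) (blinfun_apply A y)"
  using cadjoint(2)[OF A, of y "blinfun_apply A x"]
    cinner_commute[of "blinfun_apply (cadjoint A) (blinfun_apply A x)" y]
    cinner_commute[of "blinfun_apply A x" "blinfun_apply A y"] by simp

text \<open>Splitting \<open>z\<close> along the first \<open>Suc n\<close> vectors, the first order
  condition removes the orthogonal remainder, and orthogonality of the images leaves only the term
  \<open>k = n\<close>.\<close>

private lemma eigen: "blinfun_apply (cadjoint A o\<^sub>L A) (e n) = complex_of_real ((s n)\<^sup>2) *\<^sub>C e n"
proof (rule cinner_eqI)
  fix z
  let ?p = "blinfun_apply (proj e (Suc n)) z"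
  have "cinner (blinfun_apply (cadjoint A o\<^sub>L A) (e n)) z
      = cinner (blinfun_apply A (e n)) (blinfun_apply A (?p + (z - ?p)))"
    unfolding A_star_A by simp
  also have "\<dots> = cinner (blinfun_apply A (e n)) (blinfun_apply A ?p)"
    unfolding blinfun.add_right cinner_add_right
    using schmidt_systemD(2)[OF e, of n "z - ?p"] proj_complement_orthogonal[OF on] by simp
  also have "\<dots> = (\<Sum>k<Suc n. if k = n then cnj (cinner z (e n)) * complex_of_real ((s n)\<^sup>2) else 0)"
    unfolding A_proj cinner.sum_right cinner_scaleC_right
    by (intro sum.cong refl) (use A_orth[of n] in \<open>auto simp: cinner_self s_def\<close>)
  also have "\<dots> = cinner (complex_of_real ((s n)\<^sup>2) *\<^sub>C e n) z"
    using cinner_commute[of "e n" z] by (simp add: cinner_scaleC_left)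
  finally show "cinner (blinfun_apply (cadjoint A o\<^sub>L A) (e n)) z = cinner (complex_of_real ((s n)\<^sup>2) *\<^sub>C e n) z" .
qed

text \<open>An eigenvector for \<open>\<sigma>\<^sup>2\<close> is orthogonal to every
  \<open>e n\<close> with a different value. After subtracting its projection to the first
  \<open>N\<close> vectors, where \<open>s\<close> lies below \<open>\<sigma>\<close> from
  \<open>N\<close> on, the rest \<open>y\<close> is orthogonal to all of them. Extremality and
  \<open>s \<longlonglongrightarrow> 0\<close> force \<open>A y = 0\<close>, and then
  \<open>y = 0\<close> because \<open>\<sigma> > 0\<close>.\<close>

private lemma eigenspace_eq:
  assumes "0 < \<sigma>"
  shows "eigenspace (cadjoint A o\<^sub>L A) (complex_of_real (\<sigma>\<^sup>2)) = cspan (e ` {n. s n = \<sigma>})" (is "?E = ?S")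
proof
  have B: "cadjoint A o\<^sub>L A \<in> bounded_ops"
    using A cadjoint(1)[OF A] by blast
  have sub: "complex_vector.subspace ?E"
    unfolding complex_vector.subspace_def eigenspace_def
    by (auto simp: blinfun.add_right blinfun.zero_right scaleC_add_right bounded_opsD[OF A] bounded_opsD[OF cadjoint(1)[OF A]]
        scaleC_scaleC mult.commute scaleC.zero_right)
  show SE: "?S \<subseteq> ?E"
    by (rule complex_vector.span_minimal[OF _ sub]) (auto simp: eigenspace_def eigen[simplified])
  show "?E \<subseteq> ?S"
  proof
    fix x assume x: "x \<in> ?E"
    have orth: "cinner x (e n) = 0" if "s n \<noteq> \<sigma>" for n
    proof -
      have "complex_of_real (\<sigma>\<^sup>2) * cinner x (e n) = cinner (blinfun_apply A x) (blinfun_apply A (e n))"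
        using x A_star_A[of x "e n"] by (simp add: eigenspace_def cinner_scaleC_left)
      also have "\<dots> = cnj (cinner (blinfun_apply A (e n)) (blinfun_apply A x))"
        by (rule cinner_commute)
      also have "\<dots> = cnj (complex_of_real ((s n)\<^sup>2) * cinner (e n) x)"
        unfolding A_star_A[symmetric] eigen cinner_scaleC_left ..
      also have "\<dots> = complex_of_real ((s n)\<^sup>2) * cinner x (e n)"
        using cinner_commute[of x "e n"] by simp
      finally have "complex_of_real (\<sigma>\<^sup>2) = complex_of_real ((s n)\<^sup>2) \<or> cinner x (e n) = 0"
        by (simp only: mult_cancel_right) blast
      moreover have "\<sigma>\<^sup>2 \<noteq> (s n)\<^sup>2"
        using that assms s_nonneg[of n] by (simp add: power2_eq_iff_nonneg)
      ultimately show ?thesis by (simp only: of_real_eq_iff) simp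
    qed
    have "eventually (\<lambda>n. s n < \<sigma>) sequentially"
      by (rule order_tendstoD(2)[OF s_tendsto assms])
    then obtain N where N: "\<And>n. n \<ge> N \<Longrightarrow> s n < \<sigma>"
      unfolding eventually_sequentially by blast
    define p where "p = blinfun_apply (proj e N) x"
    have p: "p \<in> ?S"
      unfolding p_def proj_apply
    proof (rule complex_vector.span_sum)
      fix k
      show "cinner x (e k) *\<^sub>C e k \<in> ?S"
      proof (cases "s k = \<sigma>")
        case True
        then show ?thesis by (intro complex_vector.span_scale complex_vector.span_base) auto
      next
        case False
        then show ?thesis by (simp add: orth scaleC.zero_left complex_vector.span_zero)
      qed
    qed
    define y where "y = x - p"
    have "y \<in> ?E"
      unfolding y_def by (rule complex_vector.subspace_diff[OF sub x subsetD[OF SE p]])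
    have y: "cinner y (e k) = 0" for k
    proof (cases "k < N")
      case True
      then show ?thesis unfolding y_def p_def by (rule proj_complement_orthogonal[OF on])
    next
      case False
      then have "cinner x (e k) = 0" using N[of k] by (intro orth) auto
      moreover have "cinner p (e k) = 0"
        using False by (simp add: p_def cinner_proj[OF on])
      ultimately show ?thesis by (simp add: y_def cinner.diff_left)
    qed
    have "norm (blinfun_apply A y) \<le> 0 * norm y"
      by (rule LIMSEQ_le_const[OF tendsto_mult[OF s_tendsto tendsto_const]]) (use bound y in blast)
    then have "blinfun_apply (cadjoint A o\<^sub>L A) y = 0"
      by (simp add: blinfun.zero_right)
    then have "complex_of_real (\<sigma>\<^sup>2) *\<^sub>C y = 0"
      using \<open>y \<in> ?E\<close> by (simp add: eigenspace_def)
    then have "y = 0"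
      using norm_scaleC[of "complex_of_real (\<sigma>\<^sup>2)" y] assms by simp
    then show "x \<in> ?S" using p by (simp add: y_def)
  qed
qed

text \<open>A positive value \<open>s n\<close> excludes \<open>e n = 0\<close>, so the vectors of a
  level set are orthonormal, hence distinct and independent, and they span the eigenspace.\<close>

private lemma card_level_set:
  assumes "0 < \<sigma>"
  shows "card {n. s n = \<sigma>} = cdim (eigenspace (cadjoint A o\<^sub>L A) (complex_of_real (\<sigma>\<^sup>2)))"
proof -
  define I where "I = {n. s n = \<sigma>}"
  have nz: "e n \<noteq> 0" if "n \<in> I" for n
    using that assms by (auto simp: I_def s_def blinfun.zero_right)
  have one: "cinner (e i) (e j) = (if i = j then 1 else 0)" if "i \<in> I" for i j
    using on nz[OF that] by (simp add: orthonormal0_def)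
  have inj: "inj_on e I"
  proof (rule inj_onI)
    fix i j assume ij: "i \<in> I" "j \<in> I" and "e i = e j"
    then show "i = j" using one[of i i] one[of i j] by (auto split: if_splits)
  qed
  have "eventually (\<lambda>n. s n < \<sigma>) sequentially"
    by (rule order_tendstoD(2)[OF s_tendsto assms])
  then obtain N where N: "\<And>n. n \<ge> N \<Longrightarrow> s n < \<sigma>"
    unfolding eventually_sequentially by blast
  have "I \<subseteq> {..<N}"
  proof
    fix k assume "k \<in> I"
    then show "k \<in> {..<N}" using N[of k] by (cases "k < N") (auto simp: I_def)
  qed
  then have fin: "finite I" by (rule finite_subset) simp
  have "complex_vector.independent (e ` I)"
  proof (rule complex_vector.independent_if_scalars_zero)
    show "finite (e ` I)" using fin by simp
    fix f x assume 0: "(\<Sum>x\<in>e ` I. f x *\<^sub>C x) = 0" and "x \<in> e ` I"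
    then obtain i where i: "i \<in> I" "x = e i" by blast
    have "0 = cinner (\<Sum>x\<in>e ` I. f x *\<^sub>C x) (e i)" by (simp add: 0 cinner.zero_left)
    also have "\<dots> = (\<Sum>k\<in>I. f (e k) * cinner (e k) (e i))"
      by (simp add: sum.reindex[OF inj] cinner.sum_left cinner_scaleC_left)
    also have "\<dots> = (\<Sum>k\<in>I. if k = i then f (e i) else 0)"
      by (intro sum.cong refl) (simp add: one)
    also have "\<dots> = f x" using fin i by simp
    finally show "f x = 0" by simp
  qed
  then have "cdim (cspan (e ` I)) = card (e ` I)"
    by (rule complex_vector.dim_span_eq_card_independent)
  then show ?thesis
    using eigenspace_eq[OF assms] card_image[OF inj] by (simp add: I_def)
qed

lemma singular_values_eq_norm: "singular_values A = (\<lambda>n. norm (blinfun_apply A (e n)))"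
proof -
  have "singular_values A = s"
    unfolding singular_values_def
  proof (rule the_equality)
    show "decseq s \<and> (\<forall>n. 0 \<le> s n) \<and> s \<longlonglongrightarrow> 0 \<and>
       (\<forall>\<sigma>>0. card {n. s n = \<sigma>} = cdim (eigenspace (cadjoint A o\<^sub>L A) (complex_of_real (\<sigma>\<^sup>2))))"
      using s_decseq s_nonneg s_tendsto card_level_set by blast
    fix t :: "nat \<Rightarrow> real"
    assume t: "decseq t \<and> (\<forall>n. 0 \<le> t n) \<and> t \<longlonglongrightarrow> 0 \<and>
       (\<forall>\<sigma>>0. card {n. t n = \<sigma>} = cdim (eigenspace (cadjoint A o\<^sub>L A) (complex_of_real (\<sigma>\<^sup>2))))"
    show "t = s"
    proof (rule decseq_eqI_card_level_sets)
      fix \<sigma> :: real assume "0 < \<sigma>"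
      then show "card {n. t n = \<sigma>} = card {n. s n = \<sigma>}"
        using t card_level_set[of \<sigma>] by simp
    qed (use t s_decseq s_nonneg s_tendsto in blast)+
  qed
  then show ?thesis by (simp add: s_def)
qed

private lemma sv_s: "singular_values A = s"
  unfolding s_def by (rule singular_values_eq_norm)

lemma schmidt_singular_values_decseq: "decseq (singular_values A)"
  unfolding sv_s by (rule s_decseq)

lemma schmidt_singular_values_tendsto: "singular_values A \<longlonglongrightarrow> 0"
  unfolding sv_s by (rule s_tendsto)

text \<open>The sum is attained at the Schmidt vectors and their normalised images \<open>f\<close>.
  For the upper bound, the excess \<open>s j - s n\<close> is multiplied by a total weight of at
  most 1 and the remainder contributes at most \<open>s n\<close> for each of the \<open>n\<close>
  pairs; together this is the sum of the first \<open>n\<close> values.\<close>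

lemma schmidt_ky_fan:
  shows "\<exists>u v. bessel n u \<and> bessel n v \<and>
      (\<Sum>k<n. cmod (cinner (blinfun_apply A (u k)) (v k))) = (\<Sum>k<n. singular_values A k)" (is ?attained)
    and "bessel n u \<Longrightarrow> bessel n v \<Longrightarrow>
      (\<Sum>k<n. cmod (cinner (blinfun_apply A (u k)) (v k))) \<le> (\<Sum>k<n. singular_values A k)"
proof -
  \<comment> \<open>Division by zero yields zero, so \<open>f j = 0\<close> when
    \<open>s j = 0\<close>, in accordance with \<open>orthonormal0\<close>.\<close>
  define f where "f j = (1 / s j) *\<^sub>R blinfun_apply A (e j)" for j
  have Af: "blinfun_apply A (e j) = s j *\<^sub>R f j" for j
    by (simp add: f_def s_def)
  have f: "orthonormal0 f"
    unfolding orthonormal0_def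
  proof (intro allI)
    fix i j
    show "cinner (f i) (f j) = (if i = j \<and> f i \<noteq> 0 then 1 else 0)"
    proof (cases "i = j")
      case True
      then show ?thesis by (auto simp: cinner_self f_def s_def)
    next
      case False
      then show ?thesis using A_orth by (simp add: f_def cinner_scaleR_left cinner_scaleR_right)
    qed
  qed
  have "cmod (cinner (blinfun_apply A (e k)) (f k)) = s k" for k
  proof (cases "s k = 0")
    case False
    then have "f k \<noteq> 0" by (auto simp: f_def s_def)
    then show ?thesis
      using f s_nonneg[of k] by (simp add: Af cinner_scaleR_left orthonormal0_def)
  qed (simp add: f_def cinner.zero_right)
  then show ?attained
    using bessel_orthonormal0[OF on] bessel_orthonormal0[OF f] unfolding sv_s by (intro exI[of _ e] exI[of _ f]) simp
  assume u: "bessel n u" and v: "bessel n v"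
  \<comment> \<open>Only the excesses \<open>s j - s n\<close> are split off; the remainder \<open>C\<close> still has norm at most
    \<open>s n\<close>, so no infinite series is needed.\<close>
  define C where "C x = blinfun_apply A x - (\<Sum>j<n. (s j - s n) *\<^sub>R cinner x (e j) *\<^sub>C f j)" for x
  have C: "norm (C x) \<le> s n * norm x" for x
  proof -
    define p where "p = blinfun_apply (proj e n) x"
    define w where "w = (\<Sum>j<n. cinner x (e j) *\<^sub>C f j)"
    have orth: "cinner (x - p) (e k) = 0" if "k < n" for k
      unfolding p_def by (rule proj_complement_orthogonal[OF on that])
    have "blinfun_apply A x = blinfun_apply A p + blinfun_apply A (x - p)"
      by (simp add: blinfun.diff_right)
    also have "blinfun_apply A p = (\<Sum>j<n. s j *\<^sub>R cinner x (e j) *\<^sub>C f j)"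
      unfolding p_def A_proj Af scaleC_scaleR ..
    \<comment> \<open>The two summands are orthogonal, and their norms are at most
      \<open>s n * norm p\<close> and \<open>s n * norm (x - p)\<close>; Pythagoras combines these
      into \<open>s n * norm x\<close>.\<close>
    finally have C_eq: "C x = s n *\<^sub>R w + blinfun_apply A (x - p)"
      by (simp add: C_def w_def scaleR_left_diff_distrib sum_subtractf scaleR_sum_right)
    have wf: "cinner w (f k) = (if k < n \<and> f k \<noteq> 0 then cinner x (e k) else 0)" for k
    proof -
      have "cinner w (f k) = (\<Sum>j<n. if j = k then (if f k \<noteq> 0 then cinner x (e k) else 0) else 0)"
        unfolding w_def cinner.sum_left cinner_scaleC_left
        by (intro sum.cong refl) (use f in \<open>simp add: orthonormal0_def\<close>)
      then show ?thesis by simp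
    qed
    have "(norm w)\<^sup>2 = Re (cinner w w)" by (rule Re_cinner_self[symmetric])
    also have "cinner w w = (\<Sum>j<n. cnj (cinner x (e j)) * cinner w (f j))"
      unfolding w_def[of] cinner.sum_right cinner_scaleC_right ..
    also have "Re \<dots> \<le> (\<Sum>j<n. (cmod (cinner x (e j)))\<^sup>2)"
      unfolding Re_sum
    proof (rule sum_mono)
      fix j assume "j \<in> {..<n}"
      then show "Re (cnj (cinner x (e j)) * cinner w (f j)) \<le> (cmod (cinner x (e j)))\<^sup>2"
        unfolding cmod_power2 by (simp add: wf power2_eq_square)
    qed
    also have "\<dots> = (norm p)\<^sup>2"
      unfolding p_def by (rule norm_proj_sq[OF on, symmetric])
    finally have w_le: "(norm w)\<^sup>2 \<le> (norm p)\<^sup>2" .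
    have fA: "cinner (f j) (blinfun_apply A (x - p)) = 0" if "j < n" for j
      using schmidt_systemD(2)[OF e, of j "x - p"] orth that by (simp add: f_def cinner_scaleR_left)
    have "cinner w (blinfun_apply A (x - p)) = 0"
      by (simp add: w_def cinner.sum_left cinner_scaleC_left fA)
    then have "(norm (C x))\<^sup>2 = (s n)\<^sup>2 * (norm w)\<^sup>2 + (norm (blinfun_apply A (x - p)))\<^sup>2"
      unfolding C_eq norm_add_sq by (simp add: cinner_scaleR_left power_mult_distrib)
    also have "\<dots> \<le> (s n)\<^sup>2 * (norm p)\<^sup>2 + (s n * norm (x - p))\<^sup>2"
      using w_le bound[of n "x - p"] orth by (intro add_mono mult_left_mono power_mono) auto
    also have "\<dots> = (s n * norm x)\<^sup>2"
      using norm_proj_pythagoras[OF on, of x n] by (simp add: p_def power_mult_distrib algebra_simps)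
    finally show ?thesis
      by (rule power2_le_imp_le) (simp add: s_nonneg)
  qed
  define W where "W j k = cmod (cinner (u k) (e j)) * cmod (cinner (f j) (v k))" for j k
  \<comment> \<open>Here the Bessel inequalities for \<open>u\<close> and \<open>v\<close> are
    tested at the vectors \<open>e j\<close> and \<open>f j\<close>, after the product has been
    bounded by the mean of squares.\<close>
  have W: "(\<Sum>k<n. W j k) \<le> 1" for j
  proof -
    have "(\<Sum>k<n. W j k) \<le> (\<Sum>k<n. ((cmod (cinner (e j) (u k)))\<^sup>2 + (cmod (cinner (f j) (v k)))\<^sup>2) / 2)"
    proof (rule sum_mono)
      fix k
      have "cmod (cinner (u k) (e j)) = cmod (cinner (e j) (u k))"
        using cinner_commute[of "u k" "e j"] by simp
      then show "W j k \<le> ((cmod (cinner (e j) (u k)))\<^sup>2 + (cmod (cinner (f j) (v k)))\<^sup>2) / 2"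
        using sum_squares_bound[of "cmod (cinner (e j) (u k))" "cmod (cinner (f j) (v k))"]
        by (simp add: W_def)
    qed
    also have "\<dots> = ((\<Sum>k<n. (cmod (cinner (e j) (u k)))\<^sup>2) + (\<Sum>k<n. (cmod (cinner (f j) (v k)))\<^sup>2)) / 2"
      by (simp only: sum_divide_distrib[symmetric] sum.distrib)
    also have "\<dots> \<le> ((norm (e j))\<^sup>2 + (norm (f j))\<^sup>2) / 2"
      using u v unfolding bessel_def by (intro divide_right_mono add_mono) auto
    also have "\<dots> \<le> 1"
      using power_le_one[OF norm_ge_zero orthonormal0D(2)[OF on], of j 2]
        power_le_one[OF norm_ge_zero orthonormal0D(2)[OF f], of j 2] by simp
    finally show ?thesis .
  qed
  have "cmod (cinner (blinfun_apply A (u k)) (v k)) \<le> (\<Sum>j<n. (s j - s n) * W j k) + s n" if k: "k < n" for k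
  proof -
    have "blinfun_apply A (u k) = (\<Sum>j<n. (s j - s n) *\<^sub>R cinner (u k) (e j) *\<^sub>C f j) + C (u k)"
      by (simp add: C_def)
    then have "cinner (blinfun_apply A (u k)) (v k)
        = (\<Sum>j<n. (s j - s n) *\<^sub>R (cinner (u k) (e j) * cinner (f j) (v k))) + cinner (C (u k)) (v k)"
      by (simp only: cinner_add_left cinner.sum_left cinner_scaleR_left cinner_scaleC_left)
    also have "cmod \<dots> \<le> (\<Sum>j<n. cmod ((s j - s n) *\<^sub>R (cinner (u k) (e j) * cinner (f j) (v k)))) + cmod (cinner (C (u k)) (v k))"
      by (intro norm_triangle_le add_mono norm_sum order_refl)
    also have "\<dots> \<le> (\<Sum>j<n. (s j - s n) * W j k) + s n"
    proof (rule add_mono)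
      show "(\<Sum>j<n. cmod ((s j - s n) *\<^sub>R (cinner (u k) (e j) * cinner (f j) (v k)))) \<le> (\<Sum>j<n. (s j - s n) * W j k)"
      proof (rule sum_mono)
        fix j assume "j \<in> {..<n}"
        then have "s n \<le> s j" using decseqD[OF s_decseq, of j n] by simp
        then show "cmod ((s j - s n) *\<^sub>R (cinner (u k) (e j) * cinner (f j) (v k))) \<le> (s j - s n) * W j k"
          by (simp add: W_def norm_mult)
      qed
      have "cmod (cinner (C (u k)) (v k)) \<le> norm (C (u k)) * norm (v k)"
        by (rule norm_cinner_le)
      also have "\<dots> \<le> (s n * norm (u k)) * norm (v k)"
        by (intro mult_right_mono C) simp
      also have "\<dots> \<le> (s n * 1) * 1"
        using s_nonneg[of n] bessel_norm_le_1[OF u k] bessel_norm_le_1[OF v k]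
        by (intro mult_mono) auto
      finally show "cmod (cinner (C (u k)) (v k)) \<le> s n" by simp
    qed
    finally show ?thesis .
  qed
  then have "(\<Sum>k<n. cmod (cinner (blinfun_apply A (u k)) (v k))) \<le> (\<Sum>k<n. (\<Sum>j<n. (s j - s n) * W j k) + s n)"
    by (intro sum_mono) auto
  also have "\<dots> = (\<Sum>j<n. (s j - s n) * (\<Sum>k<n. W j k)) + n * s n"
    unfolding sum.distrib sum_distrib_left by (subst sum.swap) simp
  also have "\<dots> \<le> (\<Sum>j<n. (s j - s n) * 1) + n * s n"
    using W decseqD[OF s_decseq] by (intro add_mono order_refl sum_mono mult_left_mono) auto
  also have "\<dots> = (\<Sum>k<n. s k)"
    by (simp add: sum_subtractf)
  finally show "(\<Sum>k<n. cmod (cinner (blinfun_apply A (u k)) (v k))) \<le> (\<Sum>k<n. singular_values A k)"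
    unfolding sv_s .
qed

end

lemma compact_op_singular_values:
  fixes A :: "'h::chilbert_space \<Rightarrow>\<^sub>L 'h"
  assumes "compact_op A"
  shows "decseq (singular_values A)" and "singular_values A \<longlonglongrightarrow> 0" and "0 \<le> singular_values A n"
proof -
  obtain e where e: "schmidt_system A e" using ex_schmidt_system[OF assms] ..
  note * = compact_op_bounded_ops[OF assms] e
  show "decseq (singular_values A)" "singular_values A \<longlonglongrightarrow> 0" "0 \<le> singular_values A n"
    using schmidt_singular_values_decseq[OF *] schmidt_singular_values_tendsto[OF *] by (simp_all add: singular_values_eq_norm[OF *])
qed

lemma ky_fan_attained:
  fixes A :: "'h::chilbert_space \<Rightarrow>\<^sub>L 'h"
  assumes "compact_op A"
  obtains u v where "bessel n u" "bessel n v"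
    "(\<Sum>k<n. cmod (cinner (blinfun_apply A (u k)) (v k))) = (\<Sum>k<n. singular_values A k)"
proof -
  obtain e where e: "schmidt_system A e" using ex_schmidt_system[OF assms] ..
  from schmidt_ky_fan(1)[OF compact_op_bounded_ops[OF assms] e, of n] that show thesis by blast
qed

lemma ky_fan_upper:
  fixes A :: "'h::chilbert_space \<Rightarrow>\<^sub>L 'h"
  assumes "compact_op A" "bessel n u" "bessel n v"
  shows "(\<Sum>k<n. cmod (cinner (blinfun_apply A (u k)) (v k))) \<le> (\<Sum>k<n. singular_values A k)"
proof -
  obtain e where e: "schmidt_system A e" using ex_schmidt_system[OF assms(1)] ..
  from schmidt_ky_fan(2)[OF compact_op_bounded_ops[OF assms(1)] e assms(2,3)] show ?thesis .
qed

subsection \<open>Domination principles for symmetrically normed ideals\<close>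

lemma sn_trunc_nonneg: "sn_function \<Phi> \<Longrightarrow> 0 \<le> \<Phi> (\<lambda>k. if k < n then f k else 0)"
  by (rule sn_nonneg[OF _ fin_supp_trunc])

lemma sn_ideal_iff:
  fixes A :: "'h::chilbert_space \<Rightarrow>\<^sub>L 'h"
  assumes \<Phi>: "sn_function \<Phi>"
  shows "A \<in> sn_ideal \<Phi> \<longleftrightarrow> compact_op A \<and> (\<exists>K. \<forall>n. \<Phi> (trunc n (singular_values A)) \<le> K)"
proof (cases "compact_op A")
  case True
  have lim: "(\<lambda>n. complex_of_real (singular_values A n)) \<longlonglongrightarrow> 0"
    using tendsto_of_real[OF compact_op_singular_values(2)[OF True], where ?'a = complex] by simp
  define S where "S = (SUP n. ereal (\<Phi> (trunc n (singular_values A))))"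
  have "A \<in> sn_ideal \<Phi> \<longleftrightarrow> S < \<infinity>"
    using True lim by (simp add: sn_ideal_def sn_sequences_def sn_extend_eq_SUP[OF \<Phi>] S_def)
  also have "\<dots> \<longleftrightarrow> (\<exists>K. \<forall>n. \<Phi> (trunc n (singular_values A)) \<le> K)"
  proof
    assume "S < \<infinity>"
    then obtain K where "S < ereal K"
      using less_PInf_Ex_of_nat by auto
    moreover have "ereal (\<Phi> (trunc n (singular_values A))) \<le> S" for n
      unfolding S_def by (rule SUP_upper) simp
    ultimately have "ereal (\<Phi> (trunc n (singular_values A))) \<le> ereal K" for n
      by (meson le_less_trans less_imp_le)
    then show "\<exists>K. \<forall>n. \<Phi> (trunc n (singular_values A)) \<le> K" by auto
  next
    assume "\<exists>K. \<forall>n. \<Phi> (trunc n (singular_values A)) \<le> K"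
    then obtain K where "\<And>n. \<Phi> (trunc n (singular_values A)) \<le> K" by blast
    then have "S \<le> ereal K" unfolding S_def by (intro SUP_least) simp
    then show "S < \<infinity>" by (rule le_less_trans) simp
  qed
  finally show ?thesis using True by simp
qed (simp add: sn_ideal_def)

lemma sn_norm_le:
  fixes A :: "'h::chilbert_space \<Rightarrow>\<^sub>L 'h"
  assumes \<Phi>: "sn_function \<Phi>" and le: "\<And>n. \<Phi> (trunc n (singular_values A)) \<le> K"
  shows "sn_norm \<Phi> A \<le> K"
proof -
  define S where "S = (SUP n. ereal (\<Phi> (trunc n (singular_values A))))"
  have 1: "S \<le> ereal K" unfolding S_def by (intro SUP_least) (simp add: le)
  have "ereal (\<Phi> (trunc 0 (singular_values A))) \<le> S"
    unfolding S_def by (rule SUP_upper) simp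
  then have 2: "0 \<le> S"
    using sn_trunc_nonneg[OF \<Phi>, of 0] by (meson ereal_less_eq(5) order_trans)
  have "sn_norm \<Phi> A = real_of_ereal S"
    by (simp add: sn_norm_def sn_extend_eq_SUP[OF \<Phi>] S_def)
  also have "\<dots> \<le> K" using 1 2 by (cases S) auto
  finally show ?thesis .
qed

lemma sn_norm_upper:
  fixes A :: "'h::chilbert_space \<Rightarrow>\<^sub>L 'h"
  assumes \<Phi>: "sn_function \<Phi>" and A: "A \<in> sn_ideal \<Phi>"
  shows "\<Phi> (trunc n (singular_values A)) \<le> sn_norm \<Phi> A"
proof -
  define S where "S = (SUP n. ereal (\<Phi> (trunc n (singular_values A))))"
  have "S < \<infinity>"
    using A by (simp add: sn_ideal_def sn_sequences_def sn_extend_eq_SUP[OF \<Phi>] S_def)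
  moreover have "ereal (\<Phi> (trunc n (singular_values A))) \<le> S"
    unfolding S_def by (rule SUP_upper) simp
  ultimately have "\<Phi> (trunc n (singular_values A)) \<le> real_of_ereal S"
    by (cases S) auto
  then show ?thesis
    by (simp add: sn_norm_def sn_extend_eq_SUP[OF \<Phi>] S_def)
qed

lemma sn_ideal_compact: "A \<in> sn_ideal \<Phi> \<Longrightarrow> compact_op A"
  by (simp add: sn_ideal_def)

lemma sn_norm_nonneg:
  fixes A :: "'h::chilbert_space \<Rightarrow>\<^sub>L 'h"
  assumes "sn_function \<Phi>" "A \<in> sn_ideal \<Phi>"
  shows "0 \<le> sn_norm \<Phi> A"
  using sn_norm_upper[OF assms, of 0] sn_trunc_nonneg[OF assms(1), of 0] by (rule order_trans[rotated])

text \<open>Since the partial sums of the singular values are attained by some pair of Bessel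
  families, a bound for all such pairs is a weak majorization by \<open>b\<close>. This avoids any
  manipulation of singular values of sums and products.\<close>

lemma sn_dominance_seq:
  fixes C :: "'h::chilbert_space \<Rightarrow>\<^sub>L 'h"
  assumes \<Phi>: "sn_function \<Phi>" and C: "compact_op C" and b: "\<And>n. 0 \<le> b n" "\<And>n. \<Phi> (trunc n b) \<le> K"
    and KF: "\<And>n u v. bessel n u \<Longrightarrow> bessel n v \<Longrightarrow>
      (\<Sum>k<n. cmod (cinner (blinfun_apply C (u k)) (v k))) \<le> (\<Sum>k<n. b k)"
  shows "C \<in> sn_ideal \<Phi>" and "sn_norm \<Phi> C \<le> K"
proof -
  have "(\<Sum>k<n. singular_values C k) \<le> (\<Sum>k<n. b k)" for n
    by (rule ky_fan_attained[OF C, of n]) (metis KF)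
  then have "\<Phi> (trunc n (singular_values C)) \<le> \<Phi> (trunc n b)" for n
    by (intro sn_weak_majorization_trunc[OF \<Phi>] compact_op_singular_values[OF C] b(1))
  then have le: "\<Phi> (trunc n (singular_values C)) \<le> K" for n
    using b(2) order_trans by blast
  then show "C \<in> sn_ideal \<Phi>"
    unfolding sn_ideal_iff[OF \<Phi>] using C by blast
  show "sn_norm \<Phi> C \<le> K"
    by (rule sn_norm_le[OF \<Phi> le])
qed

text \<open>Two comparison operators are allowed because the error of a compression is controlled by
  the tail of \<open>B\<close> and by \<open>B\<close> itself, with different factors.\<close>

lemma sn_dominance:
  fixes A B C :: "'h::chilbert_space \<Rightarrow>\<^sub>L 'h"
  assumes \<Phi>: "sn_function \<Phi>" and C: "compact_op C" and A: "A \<in> sn_ideal \<Phi>" and B: "B \<in> sn_ideal \<Phi>"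
    and "0 \<le> \<alpha>" "0 \<le> \<beta>"
    and KF: "\<And>n u v. bessel n u \<Longrightarrow> bessel n v \<Longrightarrow>
      (\<Sum>k<n. cmod (cinner (blinfun_apply C (u k)) (v k)))
        \<le> \<alpha> * (\<Sum>k<n. singular_values A k) + \<beta> * (\<Sum>k<n. singular_values B k)"
  shows "C \<in> sn_ideal \<Phi>" and "sn_norm \<Phi> C \<le> \<alpha> * sn_norm \<Phi> A + \<beta> * sn_norm \<Phi> B"
proof -
  define b where "b k = \<alpha> * singular_values A k + \<beta> * singular_values B k" for k
  have b0: "0 \<le> b n" for n
    unfolding b_def using assms(5,6) compact_op_singular_values(3)[OF sn_ideal_compact[OF A]]
      compact_op_singular_values(3)[OF sn_ideal_compact[OF B]]
    by (intro add_nonneg_nonneg mult_nonneg_nonneg)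
  have "\<Phi> (trunc n b) \<le> \<alpha> * sn_norm \<Phi> A + \<beta> * sn_norm \<Phi> B" for n
  proof -
    have "\<Phi> (trunc n b) = \<Phi> (\<lambda>k. complex_of_real \<alpha> * trunc n (singular_values A) k + complex_of_real \<beta> * trunc n (singular_values B) k)"
      by (rule arg_cong[of _ _ \<Phi>]) (auto simp: b_def)
    also have "\<dots> \<le> \<Phi> (\<lambda>k. complex_of_real \<alpha> * trunc n (singular_values A) k)
        + \<Phi> (\<lambda>k. complex_of_real \<beta> * trunc n (singular_values B) k)"
      by (intro sn_triangle[OF \<Phi>] fin_supp_scale fin_supp_trunc)
    also have "\<dots> = \<alpha> * \<Phi> (trunc n (singular_values A)) + \<beta> * \<Phi> (trunc n (singular_values B))"
      using assms(5,6) by (simp only: sn_scale[OF \<Phi> fin_supp_trunc] norm_of_real abs_of_nonneg)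
    also have "\<dots> \<le> \<alpha> * sn_norm \<Phi> A + \<beta> * sn_norm \<Phi> B"
      using assms(5,6) by (intro add_mono mult_left_mono sn_norm_upper[OF \<Phi>] A B)
    finally show ?thesis .
  qed
  note * = sn_dominance_seq[OF \<Phi> C b0 this]
  have KF': "(\<Sum>k<n. cmod (cinner (blinfun_apply C (u k)) (v k))) \<le> (\<Sum>k<n. b k)"
    if "bessel n u" "bessel n v" for n u v
    using KF[OF that] by (simp only: b_def sum.distrib sum_distrib_left)
  show "C \<in> sn_ideal \<Phi>" by (rule *(1)[OF KF'])
  show "sn_norm \<Phi> C \<le> \<alpha> * sn_norm \<Phi> A + \<beta> * sn_norm \<Phi> B" by (rule *(2)[OF KF'])
qed

lemma sn_ideal_add:
  fixes A B :: "'h::chilbert_space \<Rightarrow>\<^sub>L 'h"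
  assumes \<Phi>: "sn_function \<Phi>" and A: "A \<in> sn_ideal \<Phi>" and B: "B \<in> sn_ideal \<Phi>"
  shows "A + B \<in> sn_ideal \<Phi>" and "sn_norm \<Phi> (A + B) \<le> sn_norm \<Phi> A + sn_norm \<Phi> B"
proof -
  note c = sn_ideal_compact[OF A] sn_ideal_compact[OF B]
  have KF: "(\<Sum>k<n. cmod (cinner (blinfun_apply (A + B) (u k)) (v k)))
      \<le> 1 * (\<Sum>k<n. singular_values A k) + 1 * (\<Sum>k<n. singular_values B k)"
    if "bessel n u" "bessel n v" for n u v
  proof -
    have "(\<Sum>k<n. cmod (cinner (blinfun_apply (A + B) (u k)) (v k)))
        \<le> (\<Sum>k<n. cmod (cinner (blinfun_apply A (u k)) (v k)) + cmod (cinner (blinfun_apply B (u k)) (v k)))"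
      by (intro sum_mono) (simp add: blinfun.add_left cinner_add_left norm_triangle_ineq)
    also have "\<dots> \<le> (\<Sum>k<n. singular_values A k) + (\<Sum>k<n. singular_values B k)"
      unfolding sum.distrib by (intro add_mono ky_fan_upper c that)
    finally show ?thesis by simp
  qed
  show "A + B \<in> sn_ideal \<Phi>"
    by (rule sn_dominance(1)[OF \<Phi> compact_op_add[OF c] A B zero_le_one zero_le_one KF])
  show "sn_norm \<Phi> (A + B) \<le> sn_norm \<Phi> A + sn_norm \<Phi> B"
    using sn_dominance(2)[OF \<Phi> compact_op_add[OF c] A B zero_le_one zero_le_one KF]
    unfolding mult_1 .
qed

text \<open>Covers scalar multiples, compressions and tails uniformly: each of these moves the
  vectors by maps that preserve Bessel families.\<close>

lemma sn_dominance_image: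
  fixes A C :: "'h::chilbert_space \<Rightarrow>\<^sub>L 'h"
  assumes \<Phi>: "sn_function \<Phi>" and A: "A \<in> sn_ideal \<Phi>" and C: "compact_op C" and "0 \<le> \<alpha>"
    and le: "\<And>x y. cmod (cinner (blinfun_apply C x) y) \<le> \<alpha> * cmod (cinner (blinfun_apply A (T x)) (S y))"
    and T: "\<And>n u. bessel n u \<Longrightarrow> bessel n (\<lambda>k. T (u k))"
    and S: "\<And>n u. bessel n u \<Longrightarrow> bessel n (\<lambda>k. S (u k))"
  shows "C \<in> sn_ideal \<Phi>" and "sn_norm \<Phi> C \<le> \<alpha> * sn_norm \<Phi> A"
proof -
  have KF: "(\<Sum>k<n. cmod (cinner (blinfun_apply C (u k)) (v k)))
      \<le> \<alpha> * (\<Sum>k<n. singular_values A k) + 0 * (\<Sum>k<n. singular_values A k)"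
    if "bessel n u" "bessel n v" for n u v
  proof -
    have "(\<Sum>k<n. cmod (cinner (blinfun_apply C (u k)) (v k)))
        \<le> (\<Sum>k<n. \<alpha> * cmod (cinner (blinfun_apply A (T (u k))) (S (v k))))"
      by (intro sum_mono le)
    also have "\<dots> \<le> \<alpha> * (\<Sum>k<n. singular_values A k)"
      unfolding sum_distrib_left[symmetric] using \<open>0 \<le> \<alpha>\<close>
      by (intro mult_left_mono ky_fan_upper[OF sn_ideal_compact[OF A]] T S that)
    finally show ?thesis by simp
  qed
  show "C \<in> sn_ideal \<Phi>"
    by (rule sn_dominance(1)[OF \<Phi> C A A \<open>0 \<le> \<alpha>\<close> order_refl KF])
  show "sn_norm \<Phi> C \<le> \<alpha> * sn_norm \<Phi> A"
    using sn_dominance(2)[OF \<Phi> C A A \<open>0 \<le> \<alpha>\<close> order_refl KF]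
    unfolding mult_zero_left add_0_right .
qed

text \<open>Domination yields only the upper bound; for \<open>c \<noteq> 0\<close> the same bound
  for \<open>inverse c\<close> gives the reverse one.\<close>

lemma sn_ideal_scaleC:
  fixes A :: "'h::chilbert_space \<Rightarrow>\<^sub>L 'h"
  assumes \<Phi>: "sn_function \<Phi>" and A: "A \<in> sn_ideal \<Phi>"
  shows "c *\<^sub>C A \<in> sn_ideal \<Phi>" and "sn_norm \<Phi> (c *\<^sub>C A) = cmod c * sn_norm \<Phi> A"
proof -
  have *: "c *\<^sub>C A \<in> sn_ideal \<Phi> \<and> sn_norm \<Phi> (c *\<^sub>C A) \<le> cmod c * sn_norm \<Phi> A"
    if A: "A \<in> sn_ideal \<Phi>" for c and A :: "'h \<Rightarrow>\<^sub>L 'h"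
  proof -
    note dom = sn_dominance_image[where T = "\<lambda>x. x" and S = "\<lambda>x. x",
      OF \<Phi> A compact_op_scaleC[OF sn_ideal_compact[OF A], of c] norm_ge_zero[of c]]
    have le: "cmod (cinner (blinfun_apply (c *\<^sub>C A) x) y) \<le> cmod c * cmod (cinner (blinfun_apply A x) y)" for x y
      by (simp add: cinner_scaleC_left norm_mult)
    show ?thesis using dom(1)[OF le] dom(2)[OF le] by (intro conjI)
  qed
  then show "c *\<^sub>C A \<in> sn_ideal \<Phi>" using A by blast
  show "sn_norm \<Phi> (c *\<^sub>C A) = cmod c * sn_norm \<Phi> A"
  proof (rule antisym)
    show "sn_norm \<Phi> (c *\<^sub>C A) \<le> cmod c * sn_norm \<Phi> A" using * A by blast
    show "cmod c * sn_norm \<Phi> A \<le> sn_norm \<Phi> (c *\<^sub>C A)"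
    proof (cases "c = 0")
      case True
      then show ?thesis using sn_norm_nonneg[OF \<Phi> conjunct1[OF *[OF A, of c]]] by simp
    next
      case False
      have eq: "inverse c *\<^sub>C c *\<^sub>C A = A" using False by (simp add: scaleC_scaleC)
      have "sn_norm \<Phi> A \<le> cmod (inverse c) * sn_norm \<Phi> (c *\<^sub>C A)"
        using conjunct2[OF *[OF conjunct1[OF *[OF A]], of "inverse c" c]] unfolding eq .
      then show ?thesis using False unfolding norm_inverse by (simp add: field_simps)
    qed
  qed
qed

lemma diff_eq_scaleC: "A - B = A + (-1) *\<^sub>C B"
  for A B :: "'a::complex_inner \<Rightarrow>\<^sub>L 'a"
  by (rule blinfun_eqI) (simp add: blinfun.add_left blinfun.diff_left scaleC.minus_left)

lemma sn_ideal_diff: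
  fixes A B :: "'h::chilbert_space \<Rightarrow>\<^sub>L 'h"
  assumes \<Phi>: "sn_function \<Phi>" and A: "A \<in> sn_ideal \<Phi>" and B: "B \<in> sn_ideal \<Phi>"
  shows "A - B \<in> sn_ideal \<Phi>" and "sn_norm \<Phi> (A - B) \<le> sn_norm \<Phi> A + sn_norm \<Phi> B"
proof -
  note * = sn_ideal_add[OF \<Phi> A sn_ideal_scaleC(1)[OF \<Phi> B, of "-1"], folded diff_eq_scaleC]
  show "A - B \<in> sn_ideal \<Phi>" by (rule *(1))
  have "sn_norm \<Phi> ((-1) *\<^sub>C B) = sn_norm \<Phi> B"
    unfolding sn_ideal_scaleC(2)[OF \<Phi> B] by simp
  then show "sn_norm \<Phi> (A - B) \<le> sn_norm \<Phi> A + sn_norm \<Phi> B"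
    using *(2) by simp
qed

text \<open>The comparison sequence has the single entry \<open>norm x * norm y\<close>: by
  Cauchy-Schwarz for sums and the two Bessel inequalities, every Ky Fan sum is at most this
  number.\<close>

lemma sn_ideal_rank_one:
  fixes x y :: "'h::chilbert_space"
  assumes \<Phi>: "sn_function \<Phi>"
  shows "rank_one x y \<in> sn_ideal \<Phi>" and "sn_norm \<Phi> (rank_one x y) \<le> norm x * norm y"
proof -
  define b where "b k = (if k = 0 then norm x * norm y else 0)" for k :: nat
  have b: "0 \<le> b k" for k by (simp add: b_def)
  have b': "\<Phi> (trunc n b) \<le> norm x * norm y" for n
  proof -
    have fs: "fin_supp (\<lambda>n::nat. if n = 0 then 1 else 0 :: complex)"
      by (simp add: fin_supp_def)
    have "\<Phi> (trunc n b) \<le> \<Phi> (\<lambda>k. complex_of_real (norm x * norm y) * (if k = 0 then 1 else 0))"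
      by (rule sn_mono[OF \<Phi> fin_supp_scale[OF fs]]) (auto simp: b_def norm_mult)
    also have "\<dots> = norm x * norm y"
      by (simp only: sn_scale[OF \<Phi> fs] sn_unit[OF \<Phi>] norm_of_real) simp
    finally show ?thesis .
  qed
  have KF: "(\<Sum>k<n. cmod (cinner (blinfun_apply (rank_one x y) (u k)) (v k))) \<le> (\<Sum>k<n. b k)"
    if u: "bessel n u" and v: "bessel n v" for n u v
  proof (cases n)
    case (Suc m)
    have "(\<Sum>k<n. cmod (cinner (blinfun_apply (rank_one x y) (u k)) (v k)))
        = (\<Sum>k<n. cmod (cinner x (u k)) * cmod (cinner y (v k)))"
    proof (intro sum.cong refl)
      fix k
      have "cmod (cinner (u k) x) = cmod (cinner x (u k))"
        using cinner_commute[of "u k" x] by simp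
      then show "cmod (cinner (blinfun_apply (rank_one x y) (u k)) (v k)) = cmod (cinner x (u k)) * cmod (cinner y (v k))"
        by (simp add: cinner_scaleC_left norm_mult)
    qed
    also have "\<dots> \<le> sqrt (\<Sum>k<n. (cmod (cinner x (u k)))\<^sup>2) * sqrt (\<Sum>k<n. (cmod (cinner y (v k)))\<^sup>2)"
      using L2_set_mult_ineq[of "\<lambda>k. cmod (cinner x (u k))" "\<lambda>k. cmod (cinner y (v k))" "{..<n}"]
      by (simp add: L2_set_def)
    also have "\<dots> \<le> sqrt ((norm x)\<^sup>2) * sqrt ((norm y)\<^sup>2)"
      using u v unfolding bessel_def by (intro mult_mono real_sqrt_le_mono) (auto intro: sum_nonneg)
    also have "\<dots> = (\<Sum>k<n. b k)"
      by (simp add: Suc b_def)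
    finally show ?thesis .
  qed simp
  note * = sn_dominance_seq[OF \<Phi> compact_op_rank_one b b' KF]
  show "rank_one x y \<in> sn_ideal \<Phi>" by (rule *(1))
  show "sn_norm \<Phi> (rank_one x y) \<le> norm x * norm y" by (rule *(2))
qed

lemma sn_ideal_zero:
  assumes \<Phi>: "sn_function \<Phi>"
  shows "(0 :: 'h::chilbert_space \<Rightarrow>\<^sub>L 'h) \<in> sn_ideal \<Phi>" and "sn_norm \<Phi> (0 :: 'h \<Rightarrow>\<^sub>L 'h) = 0"
proof -
  have "rank_one 0 0 = (0 :: 'h \<Rightarrow>\<^sub>L 'h)"
    by (rule blinfun_eqI) (simp add: cinner.zero_right scaleC.zero_left)
  then show "(0 :: 'h \<Rightarrow>\<^sub>L 'h) \<in> sn_ideal \<Phi>" "sn_norm \<Phi> (0 :: 'h \<Rightarrow>\<^sub>L 'h) = 0"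
    using sn_ideal_rank_one[OF \<Phi>, of 0 "0::'h"] sn_norm_nonneg[OF \<Phi>, of "0 :: 'h \<Rightarrow>\<^sub>L 'h"] by auto
qed

lemma sn_ideal_sum:
  fixes A :: "'i \<Rightarrow> ('h::chilbert_space \<Rightarrow>\<^sub>L 'h)"
  assumes \<Phi>: "sn_function \<Phi>" and A: "\<And>i. i \<in> I \<Longrightarrow> A i \<in> sn_ideal \<Phi>"
  shows "(\<Sum>i\<in>I. A i) \<in> sn_ideal \<Phi>" and "sn_norm \<Phi> (\<Sum>i\<in>I. A i) \<le> (\<Sum>i\<in>I. sn_norm \<Phi> (A i))"
proof -
  have "(\<Sum>i\<in>I. A i) \<in> sn_ideal \<Phi> \<and> sn_norm \<Phi> (\<Sum>i\<in>I. A i) \<le> (\<Sum>i\<in>I. sn_norm \<Phi> (A i))"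
    using A
  proof (induction I rule: infinite_finite_induct)
    case (insert i I)
    then have 1: "(\<Sum>i\<in>I. A i) \<in> sn_ideal \<Phi>" "sn_norm \<Phi> (\<Sum>i\<in>I. A i) \<le> (\<Sum>i\<in>I. sn_norm \<Phi> (A i))"
      and 2: "A i \<in> sn_ideal \<Phi>" by simp_all
    show ?case
      using sn_ideal_add[OF \<Phi> 2 1(1)] 1(2) insert(1,2) by simp
  qed (simp_all add: sn_ideal_zero[OF \<Phi>])
  then show "(\<Sum>i\<in>I. A i) \<in> sn_ideal \<Phi>" "sn_norm \<Phi> (\<Sum>i\<in>I. A i) \<le> (\<Sum>i\<in>I. sn_norm \<Phi> (A i))"
    by blast+
qed

text \<open>The first singular value equals the norm of the sequence truncated after one entry, and
  Ky Fan's inequality with one pair of normalised vectors bounds the coefficient by it. Hence matrix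
  coefficients are bounded functionals on the ideal.\<close>

lemma cinner_le_sn_norm:
  fixes A :: "'h::chilbert_space \<Rightarrow>\<^sub>L 'h"
  assumes \<Phi>: "sn_function \<Phi>" and A: "A \<in> sn_ideal \<Phi>"
  shows "cmod (cinner (blinfun_apply A x) y) \<le> sn_norm \<Phi> A * (norm x * norm y)"
proof -
  have b: "bessel (Suc 0) (\<lambda>_. sgn z)" for z :: 'h
    unfolding bessel_def
  proof
    fix x :: 'h
    have "cmod (cinner x (sgn z)) \<le> norm x * norm (sgn z)" by (rule norm_cinner_le)
    also have "\<dots> \<le> norm x * 1" by (intro mult_left_mono) (auto simp: norm_sgn)
    finally show "(\<Sum>k<Suc 0. (cmod (cinner x (sgn z)))\<^sup>2) \<le> (norm x)\<^sup>2" by (simp add: power_mono)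
  qed
  let ?s = "singular_values A 0"
  have "?s = \<Phi> (trunc (Suc 0) (singular_values A))"
  proof -
    have fs: "fin_supp (\<lambda>n::nat. if n = 0 then 1 else 0 :: complex)"
      by (simp add: fin_supp_def)
    have "trunc (Suc 0) (singular_values A) = (\<lambda>k. complex_of_real ?s * (if k = 0 then 1 else 0))"
      by (auto simp: fun_eq_iff)
    then show ?thesis
      using compact_op_singular_values(3)[OF sn_ideal_compact[OF A], of 0]
      by (simp only: sn_scale[OF \<Phi> fs] sn_unit[OF \<Phi>] norm_of_real)
  qed
  also have "\<dots> \<le> sn_norm \<Phi> A" by (rule sn_norm_upper[OF \<Phi> A])
  finally have s: "?s \<le> sn_norm \<Phi> A" .
  have "cmod (cinner (blinfun_apply A (sgn x)) (sgn y)) \<le> ?s"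
    using ky_fan_upper[OF sn_ideal_compact[OF A] b[of x] b[of y]] by simp
  with s have le: "cmod (cinner (blinfun_apply A (sgn x)) (sgn y)) \<le> sn_norm \<Phi> A" by simp
  have sgn: "norm z *\<^sub>R sgn z = z" for z :: 'h
    by (cases "z = 0") (simp_all add: sgn_div_norm)
  have "cinner (blinfun_apply A x) y = (norm x * norm y) *\<^sub>R cinner (blinfun_apply A (sgn x)) (sgn y)"
  proof -
    have "cinner (blinfun_apply A (norm x *\<^sub>R sgn x)) (norm y *\<^sub>R sgn y)
        = (norm x * norm y) *\<^sub>R cinner (blinfun_apply A (sgn x)) (sgn y)"
      by (simp only: blinfun.scaleR_right cinner_scaleR_left cinner_scaleR_right scaleR_scaleR
          mult.commute[of "norm x"])
    then show ?thesis
      by (simp only: sgn)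
  qed
  then have "cmod (cinner (blinfun_apply A x) y) = norm x * norm y * cmod (cinner (blinfun_apply A (sgn x)) (sgn y))"
    by (simp add: norm_mult)
  also have "\<dots> \<le> norm x * norm y * sn_norm \<Phi> A"
    using le by (intro mult_left_mono) auto
  finally show ?thesis by (simp add: mult.commute)
qed

subsection \<open>The closure of the finite rank operators\<close>

lemma finite_rank_op_add: "finite_rank_op A \<Longrightarrow> finite_rank_op B \<Longrightarrow> finite_rank_op (A + B)"
  unfolding finite_rank_op_def
proof (elim conjE exE, intro conjI exI)
  fix S T
  assume A: "range (blinfun_apply A) \<subseteq> cspan S" and B: "range (blinfun_apply B) \<subseteq> cspan T"
    and "finite S" "finite T" "A \<in> bounded_ops" "B \<in> bounded_ops"
  then show "A + B \<in> bounded_ops" "finite (S \<union> T)" by auto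
  show "range (blinfun_apply (A + B)) \<subseteq> cspan (S \<union> T)"
  proof
    fix y assume "y \<in> range (blinfun_apply (A + B))"
    then obtain x where y: "y = blinfun_apply A x + blinfun_apply B x"
      by (auto simp: blinfun.add_left)
    have "blinfun_apply A x \<in> cspan (S \<union> T)" "blinfun_apply B x \<in> cspan (S \<union> T)"
      using A B complex_vector.span_mono[of S "S \<union> T"] complex_vector.span_mono[of T "S \<union> T"] by blast+
    then show "y \<in> cspan (S \<union> T)"
      unfolding y by (rule complex_vector.span_add)
  qed
qed

lemma finite_rank_op_scaleC: "finite_rank_op A \<Longrightarrow> finite_rank_op (c *\<^sub>C A)"
  unfolding finite_rank_op_def
proof (elim conjE exE, intro conjI exI)
  fix S assume A: "range (blinfun_apply A) \<subseteq> cspan S" and "finite S" "A \<in> bounded_ops"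
  then show "c *\<^sub>C A \<in> bounded_ops" "finite S" by auto
  show "range (blinfun_apply (c *\<^sub>C A)) \<subseteq> cspan S"
    using A complex_vector.span_scale[of _ S c] by auto
qed

lemma finite_rank_op_rank_one: "finite_rank_op (rank_one x y)"
  unfolding finite_rank_op_def
proof (intro conjI exI[of _ "{y}"] image_subsetI)
  fix z
  show "blinfun_apply (rank_one x y) z \<in> cspan {y}"
    unfolding rank_one_apply by (intro complex_vector.span_scale complex_vector.span_base) simp
qed simp_all

lemma finite_rank_op_zero: "finite_rank_op 0"
  unfolding finite_rank_op_def
  by (intro conjI bounded_ops_zero exI[of _ "{}"]) auto

lemma finite_rank_op_sum: "(\<And>i. i \<in> I \<Longrightarrow> finite_rank_op (A i)) \<Longrightarrow> finite_rank_op (\<Sum>i\<in>I. A i)"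
  by (induction I rule: infinite_finite_induct) (auto intro: finite_rank_op_add finite_rank_op_zero)

context
  fixes \<Phi> :: "(nat \<Rightarrow> complex) \<Rightarrow> real"
  assumes \<Phi>: "sn_function \<Phi>"
begin

lemma sn_ideal_closure_subset: "A \<in> sn_ideal_closure \<Phi> \<Longrightarrow> A \<in> sn_ideal \<Phi>"
  by (simp add: sn_ideal_closure_def)

lemma sn_ideal_closureE:
  assumes "A \<in> sn_ideal_closure \<Phi>" "0 < \<epsilon>"
  obtains F where "F \<in> sn_ideal \<Phi>" "finite_rank_op F" "sn_norm \<Phi> (A - F) < \<epsilon>"
  using assms unfolding sn_ideal_closure_def by blast

lemma sn_ideal_closure_add:
  fixes A B :: "'h::chilbert_space \<Rightarrow>\<^sub>L 'h"
  assumes A: "A \<in> sn_ideal_closure \<Phi>" and B: "B \<in> sn_ideal_closure \<Phi>"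
  shows "A + B \<in> sn_ideal_closure \<Phi>"
  unfolding sn_ideal_closure_def
proof (intro CollectI conjI allI impI)
  note AB = sn_ideal_closure_subset[OF A] sn_ideal_closure_subset[OF B]
  show "A + B \<in> sn_ideal \<Phi>" by (rule sn_ideal_add(1)[OF \<Phi> AB])
  fix \<epsilon> :: real assume "0 < \<epsilon>"
  then have "0 < \<epsilon> / 2" by simp
  obtain F where F: "F \<in> sn_ideal \<Phi>" "finite_rank_op F" "sn_norm \<Phi> (A - F) < \<epsilon> / 2"
    using sn_ideal_closureE[OF A \<open>0 < \<epsilon> / 2\<close>] .
  obtain G where G: "G \<in> sn_ideal \<Phi>" "finite_rank_op G" "sn_norm \<Phi> (B - G) < \<epsilon> / 2"
    using sn_ideal_closureE[OF B \<open>0 < \<epsilon> / 2\<close>] .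
  have "sn_norm \<Phi> (A + B - (F + G)) = sn_norm \<Phi> ((A - F) + (B - G))"
    by (simp add: algebra_simps)
  also have "\<dots> \<le> sn_norm \<Phi> (A - F) + sn_norm \<Phi> (B - G)"
    by (intro sn_ideal_add(2)[OF \<Phi>] sn_ideal_diff(1)[OF \<Phi>] AB F G)
  also have "\<dots> < \<epsilon>" using F(3) G(3) by simp
  finally show "\<exists>F\<in>sn_ideal \<Phi>. finite_rank_op F \<and> sn_norm \<Phi> (A + B - F) < \<epsilon>"
    using sn_ideal_add(1)[OF \<Phi> F(1) G(1)] finite_rank_op_add[OF F(2) G(2)] by blast
qed

lemma sn_ideal_closure_scaleC:
  fixes A :: "'h::chilbert_space \<Rightarrow>\<^sub>L 'h"
  assumes A: "A \<in> sn_ideal_closure \<Phi>"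
  shows "c *\<^sub>C A \<in> sn_ideal_closure \<Phi>"
  unfolding sn_ideal_closure_def
proof (intro CollectI conjI allI impI)
  note A' = sn_ideal_closure_subset[OF A]
  show "c *\<^sub>C A \<in> sn_ideal \<Phi>" by (rule sn_ideal_scaleC(1)[OF \<Phi> A'])
  fix \<epsilon> :: real assume "0 < \<epsilon>"
  have "0 < cmod c + 1" by (simp add: add_nonneg_pos)
  then have "0 < \<epsilon> / (cmod c + 1)" using \<open>0 < \<epsilon>\<close> by simp
  then obtain F where F: "F \<in> sn_ideal \<Phi>" "finite_rank_op F" "sn_norm \<Phi> (A - F) < \<epsilon> / (cmod c + 1)"
    using sn_ideal_closureE[OF A] by blast
  note AF = sn_ideal_diff(1)[OF \<Phi> A' F(1)]
  have "sn_norm \<Phi> (c *\<^sub>C A - c *\<^sub>C F) = sn_norm \<Phi> (c *\<^sub>C (A - F))"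
    by (rule arg_cong[of _ _ "sn_norm \<Phi>"], rule blinfun_eqI) (simp add: blinfun.diff_left scaleC.diff_right)
  also have "\<dots> \<le> (cmod c + 1) * sn_norm \<Phi> (A - F)"
    unfolding sn_ideal_scaleC(2)[OF \<Phi> AF]
    by (intro mult_right_mono sn_norm_nonneg[OF \<Phi> AF]) simp
  also have "\<dots> < \<epsilon>" using F(3) \<open>0 < cmod c + 1\<close> by (simp add: field_simps)
  finally show "\<exists>F\<in>sn_ideal \<Phi>. finite_rank_op F \<and> sn_norm \<Phi> (c *\<^sub>C A - F) < \<epsilon>"
    using sn_ideal_scaleC(1)[OF \<Phi> F(1)] finite_rank_op_scaleC[OF F(2)] by blast
qed

lemma sn_ideal_closure_finite_rank:
  fixes F :: "'h::chilbert_space \<Rightarrow>\<^sub>L 'h"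
  assumes "F \<in> sn_ideal \<Phi>" "finite_rank_op F"
  shows "F \<in> sn_ideal_closure \<Phi>"
  using assms sn_ideal_zero(2)[OF \<Phi>, where 'h = 'h] unfolding sn_ideal_closure_def
  by (auto intro!: bexI[of _ F])

lemma sn_ideal_closure_diff:
  fixes A B :: "'h::chilbert_space \<Rightarrow>\<^sub>L 'h"
  assumes "A \<in> sn_ideal_closure \<Phi>" "B \<in> sn_ideal_closure \<Phi>"
  shows "A - B \<in> sn_ideal_closure \<Phi>"
  unfolding diff_eq_scaleC[of A B] by (intro sn_ideal_closure_add sn_ideal_closure_scaleC assms)

lemma sn_ideal_closureI:
  fixes A :: "'h::chilbert_space \<Rightarrow>\<^sub>L 'h"
  assumes "A \<in> sn_ideal \<Phi>"
    and "\<And>\<epsilon>. 0 < \<epsilon> \<Longrightarrow> \<exists>F. F \<in> sn_ideal \<Phi> \<and> finite_rank_op F \<and> sn_norm \<Phi> (A - F) < \<epsilon>"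
  shows "A \<in> sn_ideal_closure \<Phi>"
  using assms unfolding sn_ideal_closure_def by blast

end

subsection \<open>Gram-Schmidt orthonormalisation\<close>

text \<open>Because \<open>sgn 0 = 0\<close>, a vector that depends on its predecessors produces a
  zero entry; no thinning of the input sequence is required.\<close>

fun gram_schmidt :: "(nat \<Rightarrow> 'h::complex_inner) \<Rightarrow> nat \<Rightarrow> 'h" where
  "gram_schmidt d n = sgn (d n - (\<Sum>k<n. cinner (d n) (gram_schmidt d k) *\<^sub>C gram_schmidt d k))"

declare gram_schmidt.simps [simp del]

lemma scaleR_norm_sgn: "norm z *\<^sub>R sgn z = z"
  for z :: "'a::real_normed_vector"
  by (cases "z = 0") (simp_all add: sgn_div_norm)

lemma orthonormal0_gram_schmidt: "orthonormal0 (gram_schmidt d)"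
proof -
  define e where "e = gram_schmidt d"
  have e: "e n = sgn (d n - (\<Sum>k<n. cinner (d n) (e k) *\<^sub>C e k))" for n
    unfolding e_def by (rule gram_schmidt.simps)
  have self: "cinner (e n) (e n) = (if e n \<noteq> 0 then 1 else 0)" for n
  proof (cases "e n = 0")
    case False
    then have "norm (e n) = 1"
      using e[of n] by (metis norm_sgn sgn_zero_iff)
    with False show ?thesis by (simp add: cinner_self)
  qed (simp add: cinner.zero_left)
  have lt: "cinner (e n) (e j) = 0" if "j < n" for n j
    using that
  proof (induction n arbitrary: j rule: less_induct)
    case (less n)
    have orth: "cinner (e k) (e j) = (if k = j then (if e j \<noteq> 0 then 1 else 0) else 0)" if "k < n" for k
    proof (cases k j rule: linorder_cases)
      case less
      then have "cinner (e j) (e k) = 0" by (rule less.IH[OF \<open>j < n\<close>])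
      then show ?thesis using less cinner_commute[of "e k" "e j"] by simp
    next
      case equal
      then show ?thesis by (simp add: self)
    next
      case greater
      then show ?thesis using less.IH[OF that greater] by simp
    qed
    have "(\<Sum>k<n. cinner (d n) (e k) * cinner (e k) (e j))
        = (\<Sum>k<n. if k = j then cinner (d n) (e j) else 0)"
      by (intro sum.cong refl) (auto simp: orth cinner.zero_right)
    also have "\<dots> = cinner (d n) (e j)" using less.prems by simp
    finally have "cinner (d n - (\<Sum>k<n. cinner (d n) (e k) *\<^sub>C e k)) (e j) = 0"
      by (simp add: cinner.diff_left cinner.sum_left cinner_scaleC_left)
    then show ?case
      unfolding e[of n] sgn_div_norm cinner_scaleR_left by simp
  qed
  have "cinner (e i) (e j) = (if i = j \<and> e i \<noteq> 0 then 1 else 0)" for i j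
  proof (cases i j rule: linorder_cases)
    case less
    then show ?thesis using lt[OF less] cinner_commute[of "e i" "e j"] by simp
  next
    case equal
    then show ?thesis by (simp add: self)
  next
    case greater
    then show ?thesis using lt[OF greater] by simp
  qed
  then show ?thesis unfolding orthonormal0_def e_def by blast
qed

lemma proj_gram_schmidt:
  assumes "n < m"
  shows "blinfun_apply (proj (gram_schmidt d) m) (d n) = d n"
proof -
  define e where "e = gram_schmidt d"
  note on = orthonormal0_gram_schmidt[of d, folded e_def]
  define w where "w = d n - blinfun_apply (proj e n) (d n)"
  have "e n = sgn w"
    unfolding w_def proj_apply e_def by (rule gram_schmidt.simps)
  then have d: "d n = blinfun_apply (proj e n) (d n) + norm w *\<^sub>R e n"
    by (simp add: scaleR_norm_sgn) (simp add: w_def)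
  have "blinfun_apply (proj e m) (e n) = (\<Sum>k<m. if k = n then e n else 0)"
    unfolding proj_apply using on
    by (intro sum.cong refl) (auto simp: orthonormal0_def scaleC.zero_left)
  also have "\<dots> = e n" using assms by simp
  finally have "blinfun_apply (proj e m) (e n) = e n" .
  moreover have "blinfun_apply (proj e m) (blinfun_apply (proj e n) (d n)) = blinfun_apply (proj e n) (d n)"
    by (rule proj_absorb[OF on]) (use assms in simp)
  ultimately have "blinfun_apply (proj e m) (blinfun_apply (proj e n) (d n) + norm w *\<^sub>R e n)
      = blinfun_apply (proj e n) (d n) + norm w *\<^sub>R e n"
    by (simp only: blinfun.add_right blinfun.scaleR_right)
  then show ?thesis
    unfolding e_def[symmetric] using d by simp
qed

text \<open>A dense sequence is orthonormalised. Once \<open>m\<close> exceeds \<open>n\<close>, the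
  complement of the projection kills \<open>d n\<close> and is a contraction, so the error at
  \<open>x\<close> is at most \<open>norm (x - d n)\<close>.\<close>

lemma ex_total_orthonormal0:
  assumes "separable_space (euclidean :: 'h::complex_inner topology)"
  shows "\<exists>e :: nat \<Rightarrow> 'h. orthonormal0 e \<and> (\<forall>x. (\<lambda>m. blinfun_apply (proj e m) x) \<longlonglongrightarrow> x)"
proof -
  obtain D :: "'h set" where D: "countable D" "closure D = UNIV"
    using assms by (auto simp: separable_space_def)
  then have "D \<noteq> {}" by auto
  define d where "d = from_nat_into D"
  have d: "range d = D"
    unfolding d_def by (rule range_from_nat_into[OF \<open>D \<noteq> {}\<close> D(1)])
  define e where "e = gram_schmidt d"
  note on = orthonormal0_gram_schmidt[of d, folded e_def]
  have "(\<lambda>m. blinfun_apply (proj e m) x) \<longlonglongrightarrow> x" for x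
  proof (rule LIMSEQ_I)
    fix r :: real assume "0 < r"
    have "x \<in> closure D" using D by simp
    then have "\<exists>z\<in>D. dist z x < r"
      using \<open>0 < r\<close> unfolding closure_approachable by simp
    then obtain n where n: "norm (x - d n) < r"
      unfolding d[symmetric] by (auto simp: dist_norm norm_minus_commute)
    have "norm (blinfun_apply (proj e m) x - x) < r" if "Suc n \<le> m" for m
    proof -
      have "blinfun_apply (proj e m) (d n) = d n"
        unfolding e_def using that by (intro proj_gram_schmidt) simp
      then have "norm (blinfun_apply (proj e m) x - x) = norm ((x - d n) - blinfun_apply (proj e m) (x - d n))"
        by (simp add: blinfun.diff_right norm_minus_commute)
      also have "\<dots> \<le> norm (x - d n)" by (rule norm_proj_le(2)[OF on])
      finally show ?thesis using n by simp
    qed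
    then show "\<exists>N. \<forall>m\<ge>N. norm (blinfun_apply (proj e m) x - x) < r" by blast
  qed
  then show ?thesis using on by blast
qed

text \<open>With an orthonormalised spanning list of the range, \<open>F\<close> equals its
  composition with the projection, and moving the coefficients to the adjoint gives the rank one
  terms.\<close>

lemma finite_rank_op_expansion:
  fixes F :: "'h::chilbert_space \<Rightarrow>\<^sub>L 'h"
  assumes "finite_rank_op F"
  obtains r w v where "F = (\<Sum>i<r. rank_one (w i) (v i))" "\<And>i :: nat. norm (v i) \<le> 1"
proof -
  obtain S where S: "finite S" "range (blinfun_apply F) \<subseteq> cspan S" and F: "F \<in> bounded_ops"
    using assms by (auto simp: finite_rank_op_def)
  obtain xs where xs: "set xs = S" using finite_list[OF S(1)] ..
  define r where "r = length xs"
  \<comment> \<open>Indices beyond the end of the list give unspecified vectors; the projection uses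
    only the first \<open>r\<close>.\<close>
  define v where "v = gram_schmidt (\<lambda>i. xs ! i)"
  note on = orthonormal0_gram_schmidt[of "\<lambda>i. xs ! i", folded v_def]
  have sub: "complex_vector.subspace {y. blinfun_apply (proj v r) y = y}"
    unfolding complex_vector.subspace_def
    by (auto simp: blinfun.zero_right blinfun.add_right bounded_opsD)
  have "cspan S \<subseteq> {y. blinfun_apply (proj v r) y = y}"
  proof (rule complex_vector.span_minimal[OF _ sub])
    show "S \<subseteq> {y. blinfun_apply (proj v r) y = y}"
    proof
      fix y assume "y \<in> S"
      then obtain i where "i < r" "y = xs ! i"
        unfolding xs[symmetric] r_def by (auto simp: in_set_conv_nth)
      then show "y \<in> {y. blinfun_apply (proj v r) y = y}"
        using proj_gram_schmidt[of i r "\<lambda>i. xs ! i"] by (simp add: v_def)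
    qed
  qed
  then have fix_: "blinfun_apply (proj v r) (blinfun_apply F x) = blinfun_apply F x" for x
    using S(2) by blast
  have "F = (\<Sum>i<r. rank_one (blinfun_apply (cadjoint F) (v i)) (v i))"
  proof (rule blinfun_eqI)
    fix x
    have "blinfun_apply F x = (\<Sum>i<r. cinner (blinfun_apply F x) (v i) *\<^sub>C v i)"
      unfolding proj_apply[symmetric] by (rule fix_[symmetric])
    then show "blinfun_apply F x = blinfun_apply (\<Sum>i<r. rank_one (blinfun_apply (cadjoint F) (v i)) (v i)) x"
      by (simp add: blinfun.sum_left cadjoint(2)[OF F])
  qed
  then show thesis by (rule that) (rule orthonormal0D(2)[OF on])
qed

subsection \<open>Operators dominated by a positive operator\<close>

text \<open>By scaling this is the same as \<open>(cmod (cinner (D x) y))\<^sup>2 \<le> Re (cinner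
  (B x) x) * Re (cinner (B y) y)\<close>; the arithmetic mean is linear in \<open>B\<close>.\<close>

definition dominated :: "('h::complex_inner \<Rightarrow>\<^sub>L 'h) \<Rightarrow> ('h \<Rightarrow>\<^sub>L 'h) \<Rightarrow> bool" where
  "dominated D B \<longleftrightarrow> D \<in> bounded_ops \<and>
     (\<forall>x y. 2 * cmod (cinner (blinfun_apply D x) y) \<le> Re (cinner (blinfun_apply B x) x) + Re (cinner (blinfun_apply B y) y))"

lemma dominatedD:
  assumes "dominated D B"
  shows "D \<in> bounded_ops"
    and "2 * cmod (cinner (blinfun_apply D x) y) \<le> Re (cinner (blinfun_apply B x) x) + Re (cinner (blinfun_apply B y) y)"
  using assms unfolding dominated_def by blast+

text \<open>Multiplying \<open>x\<close> by \<open>sqrt r\<close> and dividing \<open>y\<close> by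
  it leaves the left side unchanged. The free parameter decides which of the two terms has to be
  small.\<close>

lemma dominated_scaled:
  assumes "dominated D B" "0 < r"
  shows "2 * cmod (cinner (blinfun_apply D x) y)
    \<le> r * Re (cinner (blinfun_apply B x) x) + Re (cinner (blinfun_apply B y) y) / r"
proof -
  have "2 * cmod (cinner (blinfun_apply D (sqrt r *\<^sub>R x)) ((1 / sqrt r) *\<^sub>R y))
      \<le> Re (cinner (blinfun_apply B (sqrt r *\<^sub>R x)) (sqrt r *\<^sub>R x))
        + Re (cinner (blinfun_apply B ((1 / sqrt r) *\<^sub>R y)) ((1 / sqrt r) *\<^sub>R y))"
    by (rule dominatedD(2)[OF assms(1)])
  then show ?thesis
    using \<open>0 < r\<close>
    by (simp add: blinfun.scaleR_right cinner_scaleR_left cinner_scaleR_right mult.assoc[symmetric] real_divide_square_eq)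
qed

text \<open>Expanding the form at \<open>x + y\<close> compares the imaginary parts, expanding it at
  \<open>x + \<i> *\<^sub>C y\<close> the real parts.\<close>

lemma cnj_symmetric_if_real_form:
  fixes A :: "'h::complex_inner \<Rightarrow>\<^sub>L 'h"
  assumes A: "A \<in> bounded_ops" and real: "\<And>x. Im (cinner (blinfun_apply A x) x) = 0"
  shows "cinner (blinfun_apply A y) x = cnj (cinner (blinfun_apply A x) y)"
proof -
  let ?a = "cinner (blinfun_apply A x) y" and ?b = "cinner (blinfun_apply A y) x"
  have "cinner (blinfun_apply A (x + y)) (x + y)
      = cinner (blinfun_apply A x) x + ?a + ?b + cinner (blinfun_apply A y) y"
    by (simp add: blinfun.add_right cinner_add_left cinner_add_right)
  from arg_cong[OF this, of Im] have 1: "Im ?a + Im ?b = 0"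
    by (simp add: real)
  have "cinner (blinfun_apply A (x + \<i> *\<^sub>C y)) (x + \<i> *\<^sub>C y)
      = cinner (blinfun_apply A x) x - \<i> * ?a + \<i> * ?b + cinner (blinfun_apply A y) y"
    by (simp add: blinfun.add_right cinner_add_left cinner_add_right bounded_opsD[OF A]
        cinner_scaleC_left cinner_scaleC_right algebra_simps)
  from arg_cong[OF this, of Im] have 2: "Re ?b - Re ?a = 0"
    by (simp add: real)
  show ?thesis
    by (rule complex_eqI) (use 1 2 in simp_all)
qed

lemma positive_opD:
  assumes "positive_op A"
  shows "A \<in> bounded_ops" "0 \<le> Re (cinner (blinfun_apply A x) x)" "Im (cinner (blinfun_apply A x) x) = 0"
    "cinner (blinfun_apply A x) x = complex_of_real (Re (cinner (blinfun_apply A x) x))"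
proof -
  show "A \<in> bounded_ops" using assms by (simp add: positive_op_def)
  have "cinner (blinfun_apply A x) x \<in> \<real>\<^sub>\<ge>\<^sub>0" using assms by (simp add: positive_op_def)
  then show 1: "0 \<le> Re (cinner (blinfun_apply A x) x)" and 2: "Im (cinner (blinfun_apply A x) x) = 0"
    by (auto simp: complex_nonneg_Reals_iff)
  show "cinner (blinfun_apply A x) x = complex_of_real (Re (cinner (blinfun_apply A x) x))"
    by (rule complex_eqI) (simp_all add: 2)
qed

text \<open>This is positivity at \<open>c *\<^sub>C x - y\<close>, where the phase \<open>c\<close>
  turns the mixed term into its modulus.\<close>

lemma positive_op_dominated:
  assumes "positive_op A"
  shows "dominated A A"
  unfolding dominated_def
proof (intro conjI allI)
  note A = positive_opD[OF assms]
  show "A \<in> bounded_ops" by (rule A)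
  fix x y
  let ?a = "cinner (blinfun_apply A x) y"
  obtain c where c: "cmod c = 1" "c * ?a = complex_of_real (cmod ?a)"
    using ex_phase by blast
  have sym: "cinner (blinfun_apply A y) x = cnj ?a"
    by (rule cnj_symmetric_if_real_form[OF A(1,3)])
  have cc: "c * cnj c = 1"
    using c(1) by (simp add: complex_norm_square[symmetric])
  have "cinner (blinfun_apply A (c *\<^sub>C x - y)) (c *\<^sub>C x - y)
      = c * cnj c * cinner (blinfun_apply A x) x + cinner (blinfun_apply A y) y - c * ?a - cnj (c * ?a)"
    by (simp add: blinfun.diff_right cinner.diff_left cinner.diff_right bounded_opsD[OF A(1)]
        cinner_scaleC_left cinner_scaleC_right sym algebra_simps)
  also have "\<dots> = cinner (blinfun_apply A x) x + cinner (blinfun_apply A y) y - complex_of_real (2 * cmod ?a)"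
    unfolding c(2) cc by simp
  finally have "Re (cinner (blinfun_apply A (c *\<^sub>C x - y)) (c *\<^sub>C x - y))
      = Re (cinner (blinfun_apply A x) x) + Re (cinner (blinfun_apply A y) y) - 2 * cmod ?a"
    by simp
  then show "2 * cmod ?a \<le> Re (cinner (blinfun_apply A x) x) + Re (cinner (blinfun_apply A y) y)"
    using A(2)[of "c *\<^sub>C x - y"] by linarith
qed

lemma Re_cinner_le: "Re (cinner (blinfun_apply B x) x) \<le> norm (blinfun_apply B x) * norm x"
  using complex_Re_le_cmod norm_cinner_le by (rule order_trans)

text \<open>For \<open>y = D z\<close> and \<open>r = norm B + 1\<close>, the term
  \<open>Re (cinner (B y) y) / r\<close> is at most \<open>(norm y)\<^sup>2\<close> and is absorbed
  by the left side, which leaves a bound by \<open>Re (cinner (B z) z)\<close>.\<close>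

lemma dominated_compact:
  fixes B D :: "'h::chilbert_space \<Rightarrow>\<^sub>L 'h"
  assumes dom: "dominated D B" and B: "compact_op B"
  shows "compact_op D"
proof (rule compact_op_dominated[OF B])
  show "D \<in> bounded_ops" using dom by (simp add: dominated_def)
  fix z
  define r where "r = norm B + 1"
  have "0 < r" by (simp add: r_def add_nonneg_pos)
  let ?y = "blinfun_apply D z"
  have "Re (cinner (blinfun_apply B ?y) ?y) \<le> (norm B * norm ?y) * norm ?y"
    using Re_cinner_le by (rule order_trans) (intro mult_right_mono norm_blinfun norm_ge_zero)
  also have "\<dots> \<le> r * (norm ?y)\<^sup>2"
    by (simp add: r_def power2_eq_square algebra_simps)
  finally have 1: "Re (cinner (blinfun_apply B ?y) ?y) / r \<le> (norm ?y)\<^sup>2"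
    using \<open>0 < r\<close> by (simp add: divide_le_eq mult.commute)
  have "2 * (norm ?y)\<^sup>2 = 2 * cmod (cinner ?y ?y)"
    by (simp only: cinner_self norm_of_real abs_power2)
  also have "\<dots> \<le> r * Re (cinner (blinfun_apply B z) z) + Re (cinner (blinfun_apply B ?y) ?y) / r"
    by (rule dominated_scaled[OF dom \<open>0 < r\<close>])
  finally have "(norm ?y)\<^sup>2 \<le> r * Re (cinner (blinfun_apply B z) z)"
    using 1 by linarith
  also have "\<dots> \<le> r * (norm z * norm (blinfun_apply B z))"
    using \<open>0 < r\<close> Re_cinner_le[of B z] by (intro mult_left_mono) (simp_all add: mult.commute)
  finally show "(norm ?y)\<^sup>2 \<le> r * (norm z * norm (blinfun_apply B z))" .
qed

text \<open>Summed over a pair of Bessel families, domination leaves two diagonal Ky Fan sums of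
  \<open>B\<close>, each at most the sum of its singular values; their mean has constant 1.\<close>

lemma dominated_sn_ideal:
  fixes B D :: "'h::chilbert_space \<Rightarrow>\<^sub>L 'h"
  assumes \<Phi>: "sn_function \<Phi>" and dom: "dominated D B" and B: "B \<in> sn_ideal \<Phi>"
  shows "D \<in> sn_ideal \<Phi>" and "sn_norm \<Phi> D \<le> sn_norm \<Phi> B"
proof -
  have KF: "(\<Sum>k<n. cmod (cinner (blinfun_apply D (u k)) (v k)))
      \<le> 1 * (\<Sum>k<n. singular_values B k) + 0 * (\<Sum>k<n. singular_values B k)"
    if u: "bessel n u" and v: "bessel n v" for n u v
  proof -
    have diag: "(\<Sum>k<n. Re (cinner (blinfun_apply B (u k)) (u k))) \<le> (\<Sum>k<n. singular_values B k)"
      if u: "bessel n u" for u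
      by (rule order_trans[OF sum_mono[OF complex_Re_le_cmod] ky_fan_upper[OF sn_ideal_compact[OF B] u u]])
    have "2 * (\<Sum>k<n. cmod (cinner (blinfun_apply D (u k)) (v k)))
        \<le> (\<Sum>k<n. Re (cinner (blinfun_apply B (u k)) (u k)) + Re (cinner (blinfun_apply B (v k)) (v k)))"
      unfolding sum_distrib_left by (intro sum_mono dominatedD(2)[OF dom])
    then show ?thesis
      using diag[OF u] diag[OF v] unfolding sum.distrib by linarith
  qed
  note * = sn_dominance[OF \<Phi> dominated_compact[OF dom sn_ideal_compact[OF B]] B B zero_le_one order_refl KF]
  show "D \<in> sn_ideal \<Phi>" by (rule *(1))
  show "sn_norm \<Phi> D \<le> sn_norm \<Phi> B"
    using *(2) unfolding mult_1 mult_zero_left add_0_right .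
qed

section \<open>Compressions to finite rank projections and the complementary tails\<close>

definition compress :: "(nat \<Rightarrow> 'h::complex_inner) \<Rightarrow> nat \<Rightarrow> ('h \<Rightarrow>\<^sub>L 'h) \<Rightarrow> ('h \<Rightarrow>\<^sub>L 'h)" where
  "compress e m A = proj e m o\<^sub>L A o\<^sub>L proj e m"

definition tail :: "(nat \<Rightarrow> 'h::complex_inner) \<Rightarrow> nat \<Rightarrow> ('h \<Rightarrow>\<^sub>L 'h) \<Rightarrow> ('h \<Rightarrow>\<^sub>L 'h)" where
  "tail e m A = (id_blinfun - proj e m) o\<^sub>L A o\<^sub>L (id_blinfun - proj e m)"

lemma compress_apply [simp]:
  "blinfun_apply (compress e m A) x = blinfun_apply (proj e m) (blinfun_apply A (blinfun_apply (proj e m) x))"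
  by (simp add: compress_def)

lemma cinner_tail:
  "cinner (blinfun_apply (tail e m A) x) y
    = cinner (blinfun_apply A (x - blinfun_apply (proj e m) x)) (y - blinfun_apply (proj e m) y)"
  by (simp add: tail_def blinfun.diff_left cinner.diff_left cinner.diff_right proj_selfadjoint)

lemma compress_diff: "compress e m (A - B) = compress e m A - compress e m B"
  by (rule blinfun_eqI) (simp add: blinfun.diff_left blinfun.diff_right)

lemma compress_compress:
  assumes "orthonormal0 e" "n \<le> m"
  shows "compress e m (compress e n A) = compress e n A"
proof (rule blinfun_eqI)
  fix x
  have "blinfun_apply (proj e n) (blinfun_apply (proj e m) x) = blinfun_apply (proj e n) x"
  proof (rule cinner_eqI)
    fix z
    show "cinner (blinfun_apply (proj e n) (blinfun_apply (proj e m) x)) z = cinner (blinfun_apply (proj e n) x) z"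
      by (simp only: proj_selfadjoint proj_absorb[OF assms])
  qed
  then show "blinfun_apply (compress e m (compress e n A)) x = blinfun_apply (compress e n A) x"
    by (simp add: proj_absorb[OF assms])
qed

text \<open>Reduces the value of a functional at a compression to finitely many matrix coefficients,
  which can be integrated.\<close>

lemma compress_expansion:
  assumes "A \<in> bounded_ops"
  shows "compress e m A = (\<Sum>i<m. \<Sum>j<m. cinner (blinfun_apply A (e j)) (e i) *\<^sub>C rank_one (e j) (e i))"
proof (rule blinfun_eqI)
  fix x
  have "blinfun_apply (compress e m A) x
      = (\<Sum>i<m. (\<Sum>j<m. cinner x (e j) * cinner (blinfun_apply A (e j)) (e i)) *\<^sub>C e i)"
    unfolding compress_apply proj_apply[of e m x] blinfun.sum_right bounded_opsD[OF assms]
    unfolding proj_apply cinner.sum_left cinner_scaleC_left scaleC.sum_left by (rule sum.swap)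
  also have "\<dots> = (\<Sum>i<m. \<Sum>j<m. (cinner x (e j) * cinner (blinfun_apply A (e j)) (e i)) *\<^sub>C e i)"
    unfolding scaleC.sum_left ..
  also have "\<dots> = blinfun_apply (\<Sum>i<m. \<Sum>j<m. cinner (blinfun_apply A (e j)) (e i) *\<^sub>C rank_one (e j) (e i)) x"
    unfolding blinfun.sum_left by (intro sum.cong refl) (simp add: scaleC_scaleC mult.commute)
  finally show "blinfun_apply (compress e m A) x
      = blinfun_apply (\<Sum>i<m. \<Sum>j<m. cinner (blinfun_apply A (e j)) (e i) *\<^sub>C rank_one (e j) (e i)) x" .
qed

context
  fixes \<Phi> :: "(nat \<Rightarrow> complex) \<Rightarrow> real" and e :: "nat \<Rightarrow> 'h::chilbert_space"
  assumes \<Phi>: "sn_function \<Phi>" and on: "orthonormal0 e"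
begin

lemma compress_sn_ideal:
  fixes A :: "'h \<Rightarrow>\<^sub>L 'h"
  assumes A: "A \<in> sn_ideal \<Phi>"
  shows "compress e m A \<in> sn_ideal \<Phi>" and "sn_norm \<Phi> (compress e m A) \<le> sn_norm \<Phi> A"
proof -
  have "compact_op (compress e m A)"
    unfolding compress_def
    by (intro compact_op_compose_right compact_op_compose_left sn_ideal_compact[OF A] proj_bounded_ops)
  note dom = sn_dominance_image[where T = "blinfun_apply (proj e m)" and S = "blinfun_apply (proj e m)",
      OF \<Phi> A this zero_le_one]
  have le: "cmod (cinner (blinfun_apply (compress e m A) x) y)
      \<le> 1 * cmod (cinner (blinfun_apply A (blinfun_apply (proj e m) x)) (blinfun_apply (proj e m) y))" for x y
    by (simp add: proj_selfadjoint)
  show "compress e m A \<in> sn_ideal \<Phi>"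
    by (rule dom(1)[OF le]) (intro bessel_proj[OF on]; assumption)+
  have "sn_norm \<Phi> (compress e m A) \<le> 1 * sn_norm \<Phi> A"
    by (rule dom(2)[OF le]) (intro bessel_proj[OF on]; assumption)+
  then show "sn_norm \<Phi> (compress e m A) \<le> sn_norm \<Phi> A" by simp
qed

lemma tail_sn_ideal:
  fixes A :: "'h \<Rightarrow>\<^sub>L 'h"
  assumes A: "A \<in> sn_ideal \<Phi>"
  shows "tail e m A \<in> sn_ideal \<Phi>" and "sn_norm \<Phi> (tail e m A) \<le> sn_norm \<Phi> A"
proof -
  define T where "T x = x - blinfun_apply (proj e m) x" for x
  have T: "bessel n (\<lambda>k. T (u k))" if "bessel n u" for n u
    unfolding T_def by (rule bessel_proj_complement[OF on that])
  have "compact_op (tail e m A)"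
    unfolding tail_def
    by (intro compact_op_compose_right compact_op_compose_left sn_ideal_compact[OF A] bounded_ops_diff
        bounded_ops_id proj_bounded_ops)
  note dom = sn_dominance_image[where T = T and S = T, OF \<Phi> A this zero_le_one]
  have le: "cmod (cinner (blinfun_apply (tail e m A) x) y)
      \<le> 1 * cmod (cinner (blinfun_apply A (T x)) (T y))" for x y
    by (simp add: cinner_tail T_def)
  show "tail e m A \<in> sn_ideal \<Phi>"
    by (rule dom(1)[OF le T T])
  have "sn_norm \<Phi> (tail e m A) \<le> 1 * sn_norm \<Phi> A"
    by (rule dom(2)[OF le T T])
  then show "sn_norm \<Phi> (tail e m A) \<le> sn_norm \<Phi> A" by simp
qed

lemma compress_closure:
  fixes A :: "'h \<Rightarrow>\<^sub>L 'h"
  assumes "A \<in> bounded_ops"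
  shows "compress e m A \<in> sn_ideal \<Phi>" "finite_rank_op (compress e m A)" "compress e m A \<in> sn_ideal_closure \<Phi>"
proof -
  show 1: "compress e m A \<in> sn_ideal \<Phi>"
    unfolding compress_expansion[OF assms]
    by (intro sn_ideal_sum(1)[OF \<Phi>] sn_ideal_scaleC(1)[OF \<Phi>] sn_ideal_rank_one(1)[OF \<Phi>])
  show 2: "finite_rank_op (compress e m A)"
    unfolding compress_expansion[OF assms]
    by (intro finite_rank_op_sum finite_rank_op_scaleC finite_rank_op_rank_one)
  show "compress e m A \<in> sn_ideal_closure \<Phi>"
    by (rule sn_ideal_closure_finite_rank[OF \<Phi> 1 2])
qed

text \<open>With \<open>P\<close> the projection and \<open>Q = 1 - P\<close>, the difference is \<open>D Q + Q D P\<close>, and both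
  terms have a factor that domination bounds by \<open>Q B Q\<close>.\<close>

lemma dominated_diff_compress:
  fixes B D :: "'h \<Rightarrow>\<^sub>L 'h"
  assumes dom: "dominated D B" and B: "B \<in> sn_ideal \<Phi>" and "0 < r"
  shows "sn_norm \<Phi> (D - compress e m D) \<le> r * sn_norm \<Phi> (tail e m B) + (1 / r) * sn_norm \<Phi> B"
proof (rule sn_dominance(2)[OF \<Phi> _ tail_sn_ideal(1)[OF B] B])
  note D = dominated_sn_ideal(1)[OF \<Phi> dom B]
  show "compact_op (D - compress e m D)"
    by (rule sn_ideal_compact[OF sn_ideal_diff(1)[OF \<Phi> D compress_sn_ideal(1)[OF D]]])
  show "0 \<le> r" "0 \<le> 1 / r" using \<open>0 < r\<close> by simp_all
  define P where "P = blinfun_apply (proj e m)"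
  define q where "q A x = Re (cinner (blinfun_apply A x) x)" for A :: "'h \<Rightarrow>\<^sub>L 'h" and x
  fix n and u v :: "nat \<Rightarrow> 'h" assume u: "bessel n u" and v: "bessel n v"
  have diag: "(\<Sum>k<n. q A (u k)) \<le> (\<Sum>k<n. singular_values A k)"
    if "bessel n u" "A \<in> sn_ideal \<Phi>" for u :: "nat \<Rightarrow> 'h" and A
    unfolding q_def
    by (rule order_trans[OF sum_mono[OF complex_Re_le_cmod] ky_fan_upper[OF sn_ideal_compact[OF that(2)] that(1) that(1)]])
  have Pu: "bessel n (\<lambda>k. P (u k))"
    unfolding P_def by (rule bessel_proj[OF on u])
  have "2 * cmod (cinner (blinfun_apply (D - compress e m D) x) y)
      \<le> r * q (tail e m B) x + (1 / r) * q B y + (1 / r) * q B (P x) + r * q (tail e m B) y" for x y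
  proof -
    have "cinner (blinfun_apply (D - compress e m D) x) y
        = cinner (blinfun_apply D (x - P x)) y + cinner (blinfun_apply D (P x)) (y - P y)"
      by (simp add: blinfun.diff_left blinfun.diff_right cinner.diff_left cinner.diff_right proj_selfadjoint P_def)
    then have "cmod (cinner (blinfun_apply (D - compress e m D) x) y)
        \<le> cmod (cinner (blinfun_apply D (x - P x)) y) + cmod (cinner (blinfun_apply D (P x)) (y - P y))"
      by (simp add: norm_triangle_ineq)
    moreover have "2 * cmod (cinner (blinfun_apply D (x - P x)) y) \<le> r * q B (x - P x) + q B y / r"
      unfolding q_def by (rule dominated_scaled[OF dom \<open>0 < r\<close>])
    \<comment> \<open>The reciprocal parameter is used here, so that again the tail receives the
      factor \<open>r\<close> and the full form the factor \<open>1 / r\<close>.\<close>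
    moreover have "2 * cmod (cinner (blinfun_apply D (P x)) (y - P y)) \<le> (1 / r) * q B (P x) + q B (y - P y) / (1 / r)"
      unfolding q_def by (rule dominated_scaled[OF dom]) (use \<open>0 < r\<close> in simp)
    moreover have "q B (z - P z) = q (tail e m B) z" for z
      by (simp add: q_def cinner_tail P_def)
    ultimately show ?thesis by (simp add: mult.commute)
  qed
  then have "2 * (\<Sum>k<n. cmod (cinner (blinfun_apply (D - compress e m D) (u k)) (v k)))
      \<le> (\<Sum>k<n. r * q (tail e m B) (u k) + (1 / r) * q B (v k) + (1 / r) * q B (P (u k)) + r * q (tail e m B) (v k))"
    unfolding sum_distrib_left by (intro sum_mono)
  also have "\<dots> = r * (\<Sum>k<n. q (tail e m B) (u k)) + (1 / r) * (\<Sum>k<n. q B (v k))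
      + (1 / r) * (\<Sum>k<n. q B (P (u k))) + r * (\<Sum>k<n. q (tail e m B) (v k))"
    by (simp only: sum.distrib sum_distrib_left)
  also have "\<dots> \<le> r * (\<Sum>k<n. singular_values (tail e m B) k) + (1 / r) * (\<Sum>k<n. singular_values B k)
      + (1 / r) * (\<Sum>k<n. singular_values B k) + r * (\<Sum>k<n. singular_values (tail e m B) k)"
    using \<open>0 < r\<close> by (intro add_mono mult_left_mono diag u v Pu B tail_sn_ideal(1)) simp_all
  finally show "(\<Sum>k<n. cmod (cinner (blinfun_apply (D - compress e m D) (u k)) (v k)))
      \<le> r * (\<Sum>k<n. singular_values (tail e m B) k) + (1 / r) * (\<Sum>k<n. singular_values B k)"
    by linarith
qed

context
  assumes total: "\<And>x. (\<lambda>m. blinfun_apply (proj e m) x) \<longlonglongrightarrow> x"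
begin

text \<open>Tails are contractive in norm, so \<open>B\<close> may be replaced by a finite rank
  \<open>F\<close>. The tail of \<open>F\<close> is a sum of rank one operators whose vectors
  \<open>w i\<close> are hit by the complementary projection, which tends strongly to zero.\<close>

lemma tail_tendsto_0:
  fixes B :: "'h \<Rightarrow>\<^sub>L 'h"
  assumes B: "B \<in> sn_ideal_closure \<Phi>"
  shows "(\<lambda>m. sn_norm \<Phi> (tail e m B)) \<longlonglongrightarrow> 0"
proof (rule LIMSEQ_I)
  fix \<epsilon> :: real assume "0 < \<epsilon>"
  then have "0 < \<epsilon> / 2" by simp
  obtain F where F: "F \<in> sn_ideal \<Phi>" "finite_rank_op F" "sn_norm \<Phi> (B - F) < \<epsilon> / 2"
    using sn_ideal_closureE[OF \<Phi> B \<open>0 < \<epsilon> / 2\<close>] .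
  obtain w v and r :: nat where Fwv: "F = (\<Sum>i<r. rank_one (w i) (v i))" and v: "\<And>i. norm (v i) \<le> 1"
    by (rule finite_rank_op_expansion[OF F(2)]) blast
  define Q where "Q m x = x - blinfun_apply (proj e m) x" for m x
  have "(\<lambda>m. norm (Q m x)) \<longlonglongrightarrow> 0" for x
    unfolding Q_def using tendsto_norm[OF tendsto_diff[OF tendsto_const[of x] total[of x]]] by simp
  then have "(\<lambda>m. \<Sum>i<r. norm (Q m (w i))) \<longlonglongrightarrow> (\<Sum>i<r. 0)"
    by (intro tendsto_sum)
  then have "eventually (\<lambda>m. (\<Sum>i<r. norm (Q m (w i))) < \<epsilon> / 2) sequentially"
    by (rule order_tendstoD(2)) (use \<open>0 < \<epsilon>\<close> in simp)
  then obtain N where N: "\<And>m. N \<le> m \<Longrightarrow> (\<Sum>i<r. norm (Q m (w i))) < \<epsilon> / 2"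
    unfolding eventually_sequentially by blast
  have BF: "B - F \<in> sn_ideal \<Phi>"
    by (rule sn_ideal_diff(1)[OF \<Phi> sn_ideal_closure_subset[OF \<Phi> B] F(1)])
  have "norm (sn_norm \<Phi> (tail e m B) - 0) < \<epsilon>" if "N \<le> m" for m
  proof -
    have "tail e m F = (\<Sum>i<r. rank_one (Q m (w i)) (Q m (v i)))"
    proof (rule blinfun_eq_cinnerI)
      fix x y
      have "cinner (x - blinfun_apply (proj e m) x) (w i) = cinner x (Q m (w i))"
        and "cinner (v i) (y - blinfun_apply (proj e m) y) = cinner (Q m (v i)) y" for i
        by (simp_all add: Q_def cinner.diff_left cinner.diff_right proj_selfadjoint)
      then show "cinner (blinfun_apply (tail e m F) x) y
          = cinner (blinfun_apply (\<Sum>i<r. rank_one (Q m (w i)) (Q m (v i))) x) y"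
        by (simp add: cinner_tail Fwv blinfun.sum_left cinner.sum_left cinner_scaleC_left)
    qed
    then have "sn_norm \<Phi> (tail e m F) \<le> (\<Sum>i<r. sn_norm \<Phi> (rank_one (Q m (w i)) (Q m (v i))))"
      by (simp add: sn_ideal_sum(2)[OF \<Phi>] sn_ideal_rank_one(1)[OF \<Phi>])
    also have "\<dots> \<le> (\<Sum>i<r. norm (Q m (w i)))"
    proof (rule sum_mono)
      fix i
      have "sn_norm \<Phi> (rank_one (Q m (w i)) (Q m (v i))) \<le> norm (Q m (w i)) * norm (Q m (v i))"
        by (rule sn_ideal_rank_one(2)[OF \<Phi>])
      also have "\<dots> \<le> norm (Q m (w i)) * 1"
        unfolding Q_def using norm_proj_le(2)[OF on] v by (intro mult_left_mono order_trans[OF _ v]) simp_all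
      finally show "sn_norm \<Phi> (rank_one (Q m (w i)) (Q m (v i))) \<le> norm (Q m (w i))" by simp
    qed
    finally have "sn_norm \<Phi> (tail e m F) < \<epsilon> / 2" using N[OF that] by simp
    moreover have "sn_norm \<Phi> (tail e m (B - F)) \<le> sn_norm \<Phi> (B - F)"
      by (rule tail_sn_ideal(2)[OF BF])
    moreover have "tail e m B = tail e m (B - F) + tail e m F"
      by (rule blinfun_eqI) (simp add: tail_def blinfun.add_left blinfun.diff_left blinfun.diff_right)
    then have "sn_norm \<Phi> (tail e m B) \<le> sn_norm \<Phi> (tail e m (B - F)) + sn_norm \<Phi> (tail e m F)"
      by (simp only: sn_ideal_add(2)[OF \<Phi> tail_sn_ideal(1)[OF BF] tail_sn_ideal(1)[OF F(1)]])
    moreover have "0 \<le> sn_norm \<Phi> (tail e m B)"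
      by (rule sn_norm_nonneg[OF \<Phi> tail_sn_ideal(1)[OF sn_ideal_closure_subset[OF \<Phi> B]]])
    ultimately show ?thesis using F(3) by simp
  qed
  then show "\<exists>N. \<forall>m\<ge>N. norm (sn_norm \<Phi> (tail e m B) - 0) < \<epsilon>" by blast
qed

lemma dominated_diff_compress_uniform:
  fixes B :: "'h \<Rightarrow>\<^sub>L 'h"
  assumes B: "B \<in> sn_ideal_closure \<Phi>" and "0 < \<epsilon>"
  obtains N where "\<And>m D. N \<le> m \<Longrightarrow> dominated D B \<Longrightarrow> sn_norm \<Phi> (D - compress e m D) < \<epsilon>"
proof -
  note B' = sn_ideal_closure_subset[OF \<Phi> B]
  \<comment> \<open>This makes \<open>(1 / r) * sn_norm \<Phi> B\<close> at most
    \<open>\<epsilon> / 2\<close> independently of \<open>m\<close> and \<open>D\<close>; the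
    summand 1 keeps \<open>r\<close> positive when the norm is zero.\<close>
  define r where "r = 2 * (sn_norm \<Phi> B + 1) / \<epsilon>"
  have "0 < sn_norm \<Phi> B + 1" using sn_norm_nonneg[OF \<Phi> B'] by simp
  then have "0 < r" using \<open>0 < \<epsilon>\<close> by (simp add: r_def)
  have "(1 / r) * sn_norm \<Phi> B \<le> \<epsilon> / 2"
    using \<open>0 < sn_norm \<Phi> B + 1\<close> \<open>0 < \<epsilon>\<close> by (simp add: r_def field_simps)
  have "(\<lambda>m. r * sn_norm \<Phi> (tail e m B)) \<longlonglongrightarrow> r * 0"
    by (intro tendsto_intros tail_tendsto_0[OF B])
  then have "eventually (\<lambda>m. r * sn_norm \<Phi> (tail e m B) < \<epsilon> / 2) sequentially"
    by (rule order_tendstoD(2)) (use \<open>0 < \<epsilon>\<close> in simp)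
  then obtain N where N: "\<And>m. N \<le> m \<Longrightarrow> r * sn_norm \<Phi> (tail e m B) < \<epsilon> / 2"
    unfolding eventually_sequentially by blast
  show thesis
  proof (rule that)
    fix m D assume "N \<le> m" "dominated D B"
    show "sn_norm \<Phi> (D - compress e m D) < \<epsilon>"
      using dominated_diff_compress[OF \<open>dominated D B\<close> B' \<open>0 < r\<close>, of m] N[OF \<open>N \<le> m\<close>]
        \<open>(1 / r) * sn_norm \<Phi> B \<le> \<epsilon> / 2\<close> by linarith
  qed
qed

text \<open>The compressions of \<open>D\<close> are the finite rank approximations.\<close>

lemma dominated_closure:
  fixes B D :: "'h \<Rightarrow>\<^sub>L 'h"
  assumes B: "B \<in> sn_ideal_closure \<Phi>" and dom: "dominated D B"
  shows "D \<in> sn_ideal_closure \<Phi>"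
proof (rule sn_ideal_closureI[OF \<Phi>])
  show "D \<in> sn_ideal \<Phi>"
    by (rule dominated_sn_ideal(1)[OF \<Phi> dom sn_ideal_closure_subset[OF \<Phi> B]])
  have D: "D \<in> bounded_ops" using dom by (simp add: dominated_def)
  fix \<epsilon> :: real assume "0 < \<epsilon>"
  obtain N where "\<And>m D. N \<le> m \<Longrightarrow> dominated D B \<Longrightarrow> sn_norm \<Phi> (D - compress e m D) < \<epsilon>"
    by (rule dominated_diff_compress_uniform[OF B \<open>0 < \<epsilon>\<close>]) blast
  from this[OF order_refl dom] compress_closure(1,2)[OF D, of N]
  show "\<exists>F. F \<in> sn_ideal \<Phi> \<and> finite_rank_op F \<and> sn_norm \<Phi> (D - F) < \<epsilon>" by blast
qed

end

end

subsection \<open>Norming functionals\<close>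

definition sublinear :: "('a::real_vector \<Rightarrow> real) \<Rightarrow> bool" where
  "sublinear p \<longleftrightarrow> (\<forall>x y. p (x + y) \<le> p x + p y) \<and> (\<forall>r x. 0 \<le> r \<longrightarrow> p (r *\<^sub>R x) = r * p x)"

lemma sublinearD:
  assumes "sublinear p"
  shows "p (x + y) \<le> p x + p y" and "0 \<le> r \<Longrightarrow> p (r *\<^sub>R x) = r * p x"
    and "p 0 = 0" and "- p (- x) \<le> p x"
proof -
  show add: "p (x + y) \<le> p x + p y" for x y using assms unfolding sublinear_def by blast
  show scale: "p (r *\<^sub>R x) = r * p x" if "0 \<le> r" for r x using assms that unfolding sublinear_def by blast
  show 0: "p 0 = 0" using scale[of 0 0] by simp
  show "- p (- x) \<le> p x" using add[of x "- x"] 0 by simp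
qed

lemma sublinearI:
  assumes add: "\<And>x y. p (x + y) \<le> p x + p y" and 0: "p 0 = 0"
    and scale: "\<And>r x. 0 < r \<Longrightarrow> p (r *\<^sub>R x) \<le> r * p x"
  shows "sublinear p"
  unfolding sublinear_def
proof (intro conjI allI impI add)
  fix r :: real and x assume "0 \<le> r"
  show "p (r *\<^sub>R x) = r * p x"
  proof (cases "r = 0")
    case False
    with \<open>0 \<le> r\<close> have "0 < r" by simp
    have "p ((1 / r) *\<^sub>R r *\<^sub>R x) \<le> (1 / r) * p (r *\<^sub>R x)"
      by (rule scale) (use \<open>0 < r\<close> in simp)
    then have "r * p x \<le> p (r *\<^sub>R x)"
      using \<open>0 < r\<close> by (simp add: field_simps)
    with scale[OF \<open>0 < r\<close>] show ?thesis by (simp add: antisym)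
  qed (simp add: 0)
qed

text \<open>The largest sublinear functional below \<open>p\<close> whose value at \<open>-v\<close> is \<open>- p v\<close>.\<close>

definition straighten :: "'a::real_vector \<Rightarrow> ('a \<Rightarrow> real) \<Rightarrow> 'a \<Rightarrow> real" where
  "straighten v p x = (INF t\<in>{0..}. p (x + t *\<^sub>R v) - t * p v)"

lemma straighten:
  assumes p: "sublinear p"
  shows "sublinear (straighten v p)" and "straighten v p x \<le> p x" and "straighten v p (- v) \<le> - p v"
proof -
  note pD = sublinearD[OF p]
  \<comment> \<open>Subadditivity gives a bound independent of \<open>t\<close>, so the infimum is
    over a set bounded below.\<close>
  have lower: "- p (- x) \<le> p (x + t *\<^sub>R v) - t * p v" if "0 \<le> t" for x t
  proof -
    have "t * p v = p ((x + t *\<^sub>R v) + (- x))" using pD(2)[OF that] by simp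
    also have "\<dots> \<le> p (x + t *\<^sub>R v) + p (- x)" by (rule pD(1))
    finally show ?thesis by simp
  qed
  have bdd: "bdd_below ((\<lambda>t. p (x + t *\<^sub>R v) - t * p v) ` {0..})" for x
    by (rule bdd_belowI2[of _ "- p (- x)"]) (use lower in simp)
  have le: "straighten v p x \<le> p (x + t *\<^sub>R v) - t * p v" if "0 \<le> t" for x t
    unfolding straighten_def by (rule cINF_lower[OF bdd]) (use that in simp)
  have ge: "c \<le> straighten v p x" if "\<And>t. 0 \<le> t \<Longrightarrow> c \<le> p (x + t *\<^sub>R v) - t * p v" for c x
    unfolding straighten_def by (rule cINF_greatest) (use that in auto)
  show "straighten v p x \<le> p x" using le[of 0 x] by simp
  show "straighten v p (- v) \<le> - p v" using le[of 1 "- v"] pD(3) by simp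
  show "sublinear (straighten v p)"
  proof (rule sublinearI)
    fix x y
    have "straighten v p (x + y) - (p (y + t *\<^sub>R v) - t * p v) \<le> straighten v p x" if t: "0 \<le> t" for t
    proof (rule ge)
      fix s :: real assume s: "0 \<le> s"
      have "straighten v p (x + y) \<le> p ((x + y) + (s + t) *\<^sub>R v) - (s + t) * p v"
        by (rule le) (use s t in simp)
      also have "(x + y) + (s + t) *\<^sub>R v = (x + s *\<^sub>R v) + (y + t *\<^sub>R v)"
        by (simp add: algebra_simps)
      also have "p \<dots> \<le> p (x + s *\<^sub>R v) + p (y + t *\<^sub>R v)" by (rule pD(1))
      finally show "straighten v p (x + y) - (p (y + t *\<^sub>R v) - t * p v) \<le> p (x + s *\<^sub>R v) - s * p v"
        by (simp add: algebra_simps)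
    qed
    then have "straighten v p (x + y) - straighten v p x \<le> straighten v p y"
      by (intro ge) (simp add: algebra_simps)
    then show "straighten v p (x + y) \<le> straighten v p x + straighten v p y" by simp
  next
    show "straighten v p 0 = 0"
    proof (rule antisym)
      show "straighten v p 0 \<le> 0" using le[of 0 0] pD(3) by simp
      show "0 \<le> straighten v p 0" by (rule ge) (simp add: pD(2))
    qed
  next
    fix r :: real and x assume "0 < r"
    have "straighten v p (r *\<^sub>R x) / r \<le> straighten v p x"
    proof (rule ge)
      fix t :: real assume "0 \<le> t"
      have "straighten v p (r *\<^sub>R x) \<le> p (r *\<^sub>R x + (r * t) *\<^sub>R v) - (r * t) * p v"
        by (rule le) (use \<open>0 < r\<close> \<open>0 \<le> t\<close> in simp)
      also have "r *\<^sub>R x + (r * t) *\<^sub>R v = r *\<^sub>R (x + t *\<^sub>R v)"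
        by (simp add: scaleR_right_distrib)
      also have "p \<dots> = r * p (x + t *\<^sub>R v)"
        using \<open>0 < r\<close> by (intro pD(2)) simp
      finally have "straighten v p (r *\<^sub>R x) \<le> r * (p (x + t *\<^sub>R v) - t * p v)"
        by (simp add: algebra_simps)
      then show "straighten v p (r *\<^sub>R x) / r \<le> p (x + t *\<^sub>R v) - t * p v"
        using \<open>0 < r\<close> by (simp add: divide_le_eq mult.commute)
    qed
    then show "straighten v p (r *\<^sub>R x) \<le> r * straighten v p x"
      using \<open>0 < r\<close> by (simp add: divide_le_eq mult.commute)
  qed
qed

text \<open>Provides the bound that Zorn's lemma asks for. Of two members of the chain one lies
  below the other, and using the smaller one at both arguments gives subadditivity of the
  infimum.\<close>

lemma sublinear_Inf_chain:
  assumes C: "C \<noteq> {}" "\<And>q. q \<in> C \<Longrightarrow> sublinear q" "\<And>q x. q \<in> C \<Longrightarrow> q x \<le> p x"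
    and chain: "\<And>q q'. q \<in> C \<Longrightarrow> q' \<in> C \<Longrightarrow> (\<forall>x. q x \<le> q' x) \<or> (\<forall>x. q' x \<le> q x)"
  defines "u \<equiv> \<lambda>x. INF q\<in>C. q x"
  shows "sublinear u" and "\<And>q. q \<in> C \<Longrightarrow> u x \<le> q x"
proof -
  have bdd: "bdd_below ((\<lambda>q. q x) ` C)" for x
  proof (rule bdd_belowI2[of _ "- p (- x)"])
    fix q assume "q \<in> C"
    then show "- p (- x) \<le> q x"
      using sublinearD(4)[OF C(2), of q x] C(3)[of q "- x"] by linarith
  qed
  show le: "u x \<le> q x" if "q \<in> C" for q x
    unfolding u_def by (rule cINF_lower[OF bdd that])
  have ge: "c \<le> u x" if "\<And>q. q \<in> C \<Longrightarrow> c \<le> q x" for c x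
    unfolding u_def by (rule cINF_greatest[OF C(1) that])
  show "sublinear u"
  proof (rule sublinearI)
    fix x y
    have "u (x + y) - q' y \<le> u x" if q': "q' \<in> C" for q'
    proof (rule ge)
      fix q assume q: "q \<in> C"
      from chain[OF q q'] show "u (x + y) - q' y \<le> q x"
      proof
        assume "\<forall>x. q x \<le> q' x"
        then have "q y \<le> q' y" by blast
        then show ?thesis using le[OF q, of "x + y"] sublinearD(1)[OF C(2)[OF q], of x y] by linarith
      next
        assume "\<forall>x. q' x \<le> q x"
        then have "q' x \<le> q x" by blast
        then show ?thesis using le[OF q', of "x + y"] sublinearD(1)[OF C(2)[OF q'], of x y] by linarith
      qed
    qed
    then have "u (x + y) - u x \<le> u y"
      by (intro ge) (simp add: algebra_simps)
    then show "u (x + y) \<le> u x + u y" by simp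
  next
    have "(\<lambda>q. q 0) ` C = {0}"
      using C(1) sublinearD(3)[OF C(2)] by force
    then show "u 0 = 0" by (simp add: u_def)
  next
    fix r :: real and x assume "0 < r"
    have "u (r *\<^sub>R x) / r \<le> u x"
    proof (rule ge)
      fix q assume q: "q \<in> C"
      have "u (r *\<^sub>R x) \<le> q (r *\<^sub>R x)" by (rule le[OF q])
      also have "\<dots> = r * q x" using \<open>0 < r\<close> by (intro sublinearD(2)[OF C(2)[OF q]]) simp
      finally show "u (r *\<^sub>R x) / r \<le> q x"
        using \<open>0 < r\<close> by (simp add: divide_le_eq mult.commute)
    qed
    then show "u (r *\<^sub>R x) \<le> r * u x"
      using \<open>0 < r\<close> by (simp add: divide_le_eq mult.commute)
  qed
qed

text \<open>A minimal sublinear functional is linear, since straightening cannot decrease it.\<close>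

lemma Hahn_Banach_sublinear:
  fixes p :: "'a::real_vector \<Rightarrow> real"
  assumes p: "sublinear p"
  shows "\<exists>f. linear f \<and> (\<forall>x. f x \<le> p x) \<and> f v = p v"
proof -
  \<comment> \<open>Everything linear below the straightened functional satisfies
    \<open>f (- v) \<le> - p v\<close>, which together with \<open>f v \<le> p v\<close> yields
    equality at \<open>v\<close>.\<close>
  define q0 where "q0 = straighten v p"
  note q0 = straighten[OF p, of v, folded q0_def]
  define S where "S = {q. sublinear q \<and> (\<forall>x. q x \<le> q0 x)}"
  \<comment> \<open>The order is reversed, so that the maximal element supplied by Zorn's lemma is a
    minimal functional.\<close>
  define below :: "('a \<Rightarrow> real) \<Rightarrow> ('a \<Rightarrow> real) \<Rightarrow> bool" where "below q q' \<longleftrightarrow> (\<forall>x. q' x \<le> q x)" for q q'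
  have "\<exists>m\<in>S. \<forall>a\<in>S. below m a \<longrightarrow> a = m"
  proof (rule predicate_Zorn)
    show "partial_order_on S (relation_of below S)"
    proof (rule partial_order_on_relation_ofI)
      show "below a a" for a by (simp add: below_def)
      show "below a c" if "below a b" "below b c" for a b c
        using that unfolding below_def by (blast intro: order_trans)
      show "a = b" if "below a b" "below b a" for a b
        using that unfolding below_def by (intro ext antisym) blast+
    qed
    fix C assume C: "C \<in> Chains (relation_of below S)"
    show "\<exists>u\<in>S. \<forall>a\<in>C. below a u"
    proof (cases "C = {}")
      case True
      then show ?thesis using q0(1) by (intro bexI[of _ q0]) (simp_all add: S_def)
    next
      case False
      have CS: "q \<in> S" if "q \<in> C" for q
        using C that unfolding Chains_def relation_of_def by blast
      have ch: "(\<forall>x. q x \<le> q' x) \<or> (\<forall>x. q' x \<le> q x)" if "q \<in> C" "q' \<in> C" for q q'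
        using C that unfolding Chains_def relation_of_def below_def by blast
      have CD: "sublinear q" "q x \<le> q0 x" if "q \<in> C" for q x
        using CS[OF that] by (simp_all add: S_def)
      define u where "u x = (INF q\<in>C. q x)" for x
      note chain = sublinear_Inf_chain[of C q0, folded u_def]
      have u1: "sublinear u"
        by (rule chain(1)) (rule False | erule CD(1) | erule CD(2) | (rule ch; assumption))+
      have u2: "u x \<le> q x" if "q \<in> C" for q x
        by (rule chain(2)) (rule False that | erule CD(1) | erule CD(2) | (rule ch; assumption))+
      obtain q where "q \<in> C" using False by blast
      have "u x \<le> q0 x" for x
        using u2[OF \<open>q \<in> C\<close>, of x] CD(2)[OF \<open>q \<in> C\<close>, of x] by simp
      then have "u \<in> S" using u1 by (simp add: S_def)
      then show ?thesis using u2 unfolding below_def by blast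
    qed
  qed
  then obtain f where "f \<in> S" and min: "\<And>a. a \<in> S \<Longrightarrow> below f a \<Longrightarrow> a = f" by blast
  then have f: "sublinear f" "\<And>x. f x \<le> q0 x" by (simp_all add: S_def)
  note fD = sublinearD[OF f(1)]
  have "straighten w f = f" for w
  proof (rule min)
    note s = straighten[OF f(1), of w]
    show "straighten w f \<in> S"
      using s(1) order_trans[OF s(2) f(2)] by (simp add: S_def)
    show "below f (straighten w f)" using s(2) by (simp add: below_def)
  qed
  then have neg: "f (- w) = - f w" for w
    using straighten(3)[OF f(1), of w] fD(4)[of "- w"] by simp
  have "linear f"
  proof (rule linearI)
    fix x y
    have "- f (x + y) \<le> - f x + - f y"
      using fD(1)[of "- x" "- y"] neg[of "x + y"] neg[of x] neg[of y] by simp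
    with fD(1)[of x y] show "f (x + y) = f x + f y" by linarith
  next
    fix r x
    show "f (r *\<^sub>R x) = r *\<^sub>R f x"
    proof (cases "0 \<le> r")
      case True
      then show ?thesis by (simp add: fD(2))
    next
      case False
      then have "f ((- r) *\<^sub>R x) = (- r) * f x" by (intro fD(2)) simp
      then show ?thesis using neg[of "r *\<^sub>R x"] by simp
    qed
  qed
  moreover have fp: "f x \<le> p x" for x
    using f(2)[of x] q0(2)[of x] by simp
  moreover have "f v = p v"
    using fp[of v] f(2)[of "- v"] q0(3) neg[of v] by linarith
  ultimately show ?thesis by blast
qed

lemma ex_norming_functional:
  fixes X :: "'b::complex_vector set"
  assumes X: "complex_vector.subspace X"
    and add: "\<And>x y. x \<in> X \<Longrightarrow> y \<in> X \<Longrightarrow> N (x + y) \<le> N x + N y"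
    and scale: "\<And>c x. x \<in> X \<Longrightarrow> N (c *\<^sub>C x) = cmod c * N x"
    and b: "b \<in> X"
  shows "\<exists>f\<in>dual_space X N. f b = complex_of_real (N b) \<and> (\<forall>x\<in>X. cmod (f x) \<le> N x)"
proof -
  have XD: "x + y \<in> X" "c *\<^sub>C x \<in> X" "0 \<in> X" if "x \<in> X" "y \<in> X" for x y c
    using X that b by (auto simp: complex_vector.subspace_def)
  have "subspace X"
    unfolding subspace_def scaleR_scaleC using X by (simp add: complex_vector.subspace_def)
  \<comment> \<open>Composing \<open>N\<close> with a linear projection onto \<open>X\<close> extends it to the whole type.\<close>
  then obtain g :: "'b \<Rightarrow> 'b" where g: "range g \<subseteq> X" "linear g" "\<And>x. x \<in> X \<Longrightarrow> g x = x"
    using linear_exists_left_inverse_on[of "\<lambda>x. x" X] linear_ident by (metis inj_on_id2)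
  have gX: "g x \<in> X" for x using g(1) by blast
  have "sublinear (\<lambda>x. N (g x))"
    unfolding sublinear_def
  proof (intro conjI allI impI)
    show "N (g (x + y)) \<le> N (g x) + N (g y)" for x y
      unfolding linear_add[OF g(2)] by (rule add[OF gX gX])
    fix r :: real and x assume "0 \<le> r"
    have "g (r *\<^sub>R x) = complex_of_real r *\<^sub>C g x"
      unfolding linear_scale[OF g(2)] by (rule scaleR_scaleC)
    then show "N (g (r *\<^sub>R x)) = r * N (g x)"
      using scale[OF gX] \<open>0 \<le> r\<close> by simp
  qed
  from Hahn_Banach_sublinear[OF this, of b] obtain F
    where F: "linear F" "\<And>x. F x \<le> N (g x)" "F b = N (g b)" by blast
  have FX: "F x \<le> N x" if "x \<in> X" for x using F(2)[of x] g(3)[OF that] by simp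
  \<comment> \<open>The complex-linear functional with real part \<open>F\<close>. Its modulus at
    \<open>x\<close> is the value of \<open>F\<close> at a rotated \<open>x\<close>, so the bound
    for \<open>F\<close> carries over.\<close>
  define f where "f x = complex_of_real (F x) - \<i> * complex_of_real (F (\<i> *\<^sub>C x))" for x
  have f_add: "f (x + y) = f x + f y" for x y
    by (simp add: f_def linear_add[OF F(1)] scaleC_add_right algebra_simps)
  have f_scale: "f (c *\<^sub>C x) = c * f x" for c x
  proof -
    have Fc: "F (z *\<^sub>C x) = Re z * F x + Im z * F (\<i> *\<^sub>C x)" for z
    proof -
      have "z *\<^sub>C x = Re z *\<^sub>R x + Im z *\<^sub>R \<i> *\<^sub>C x"
        by (simp add: scaleR_scaleC scaleC_scaleC scaleC_add_left[symmetric]) (simp add: complex_eq mult.commute)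
      then show ?thesis by (simp add: linear_add[OF F(1)] linear_scale[OF F(1)])
    qed
    show ?thesis
      unfolding f_def scaleC_scaleC Fc[of c] Fc[of "\<i> * c"]
      by (rule complex_eqI) (simp_all add: algebra_simps)
  qed
  have bound: "cmod (f x) \<le> N x" if x: "x \<in> X" for x
  proof -
    obtain c where c: "cmod c = 1" "c * f x = complex_of_real (cmod (f x))"
      using ex_phase by blast
    have "cmod (f x) = Re (f (c *\<^sub>C x))" by (simp only: f_scale c(2) Re_complex_of_real)
    also have "\<dots> = F (c *\<^sub>C x)" by (simp add: f_def)
    also have "\<dots> \<le> N (c *\<^sub>C x)" by (rule FX[OF XD(2)[OF x x]])
    also have "\<dots> = N x" by (simp add: scale[OF x] c(1))
    finally show ?thesis .
  qed
  have "Re (f b) = N b" using F(3) g(3)[OF b] by (simp add: f_def)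
  \<comment> \<open>The real part already exhausts the bound
    \<open>cmod (f b) \<le> N b\<close>.\<close>
  moreover have "Im (f b) = 0"
  proof -
    have "(Re (f b))\<^sup>2 + (Im (f b))\<^sup>2 \<le> (N b)\<^sup>2"
      unfolding cmod_power2[symmetric] by (rule power_mono[OF bound[OF b]]) simp
    then show ?thesis using \<open>Re (f b) = N b\<close> by simp
  qed
  ultimately have "f b = complex_of_real (N b)" by (simp add: complex_eqI)
  moreover have "f \<in> dual_space X N"
    unfolding dual_space_def using f_add f_scale bound by (auto intro!: exI[of _ 1])
  ultimately show ?thesis using bound by blast
qed

subsection \<open>Measurability in the sense of Pettis\<close>

lemma mu_simple_simple_function:
  fixes f :: "'w \<Rightarrow> complex"
  assumes f: "simple_function M f" and fin: "emeasure M {t \<in> space M. f t \<noteq> 0} \<noteq> \<infinity>"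
  shows "mu_simple M f"
proof -
  define Y where "Y = f ` space M - {0}"
  have "finite Y" using f by (simp add: Y_def simple_function_def)
  then obtain h where h: "bij_betw h {0..<card Y} Y"
    using ex_bij_betw_nat_finite by blast
  define A where "A k = f -` {h k} \<inter> space M" for k
  have Ak: "A k \<in> sets M" for k
    unfolding A_def using f by (rule simple_functionD)
  have hY: "h k \<in> Y" if "k < card Y" for k
    using bij_betw_apply[OF h] that by simp
  show ?thesis
    unfolding mu_simple_def
  proof (intro exI[of _ "card Y"] exI[of _ h] exI[of _ A] conjI allI impI ballI Ak)
    fix k assume "k < card Y"
    then have "h k \<noteq> 0" using hY by (simp add: Y_def)
    then have "A k \<subseteq> {t \<in> space M. f t \<noteq> 0}" by (auto simp: A_def)
    moreover have "{t \<in> space M. f t \<noteq> 0} \<in> sets M"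
      using borel_measurable_simple_function[OF f] by measurable
    ultimately have "emeasure M (A k) \<le> emeasure M {t \<in> space M. f t \<noteq> 0}"
      by (rule emeasure_mono)
    then show "emeasure M (A k) < \<infinity>"
      by (rule le_less_trans) (use fin in \<open>simp add: less_top\<close>)
  next
    show "disjoint_family_on A {..<card Y}"
      unfolding disjoint_family_on_def
    proof (intro ballI impI)
      fix i j assume ij: "i \<in> {..<card Y}" "j \<in> {..<card Y}" "i \<noteq> j"
      have "h i \<noteq> h j"
        using inj_onD[OF bij_betw_imp_inj_on[OF h], of i j] ij by auto
      then show "A i \<inter> A j = {}" by (auto simp: A_def)
    qed
  next
    fix t assume t: "t \<in> space M"
    have "(\<Sum>k<card Y. h k * indicator (A k) t) = (\<Sum>k\<in>{0..<card Y}. (if h k = f t then f t else 0))"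
      by (rule sum.cong) (use t in \<open>auto simp: A_def indicator_def\<close>)
    also have "\<dots> = (\<Sum>y\<in>Y. if y = f t then f t else 0)"
      by (rule sum.reindex_bij_betw[OF h])
    also have "\<dots> = f t"
      using \<open>finite Y\<close> t by (auto simp: Y_def)
    finally show "f t = (\<Sum>k<card Y. h k * indicator (A k) t)" ..
  qed
qed

text \<open>An integrable function is a pointwise limit of simple functions with supports of finite
  measure, which is the notion of measurability that Pettis integrability refers to.\<close>

lemma integrable_imp_mu_measurable:
  fixes f :: "'w \<Rightarrow> complex"
  assumes "integrable M f"
  shows "mu_measurable M f"
proof -
  obtain s where s: "\<And>i. simple_function M (s i)" "\<And>i. emeasure M {t \<in> space M. s i t \<noteq> 0} \<noteq> \<infinity>"
    "\<And>t. t \<in> space M \<Longrightarrow> (\<lambda>i. s i t) \<longlonglongrightarrow> f t"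
    using integrable_implies_simple_function_sequence[OF assms] by metis
  show ?thesis
    unfolding mu_measurable_def using mu_simple_simple_function[OF s(1,2)] s(3) by blast
qed

subsection \<open>Weak* integrals of positive operator valued functions\<close>

lemma Baire_sequence:
  fixes S :: "nat \<Rightarrow> 'a::complete_space set"
  assumes "\<And>n. closed (S n)" "(\<Union>n. S n) = UNIV"
  shows "\<exists>n x r. 0 < r \<and> ball x r \<subseteq> S n"
proof (rule ccontr)
  assume no: "\<not> ?thesis"
  have int: "interior (S n) = {}" for n
  proof (rule ccontr)
    assume "interior (S n) \<noteq> {}"
    then obtain x where "x \<in> interior (S n)" by blast
    then obtain r where "0 < r" "ball x r \<subseteq> S n" unfolding mem_interior by blast
    with no show False by blast
  qed
  have "complete (UNIV :: 'a set)"
    unfolding complete_def by (simp add: Cauchy_convergent_iff convergent_def)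
  then have "Met_TC.mcomplete TYPE('a)" by simp
  have io: "euclidean interior_of T = interior T" for T :: "'a set"
    by (auto simp: interior_of_def interior_def)
  have "interior (\<Union>(range S)) = {}"
    by (rule Met_TC.metric_Baire_category_alt[OF \<open>Met_TC.mcomplete TYPE('a)\<close>,
          unfolded mtopology_is_euclidean io])
       (use assms(1) int in auto)
  then show False using assms(2) by simp
qed

lemma polarization:
  fixes B :: "'h::complex_inner \<Rightarrow>\<^sub>L 'h"
  assumes B: "B \<in> bounded_ops"
  defines "q \<equiv> \<lambda>z. cinner (blinfun_apply B z) z"
  shows "cinner (blinfun_apply B x) y
    = (q (x + y) - q (x - y) + \<i> * q (x + \<i> *\<^sub>C y) - \<i> * q (x - \<i> *\<^sub>C y)) / 4"
proof -
  have *: "q (x + c *\<^sub>C y) - q (x - c *\<^sub>C y)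
      = 2 * (cnj c * cinner (blinfun_apply B x) y + c * cinner (blinfun_apply B y) x)" for c
    by (simp add: q_def blinfun.add_right blinfun.diff_right cinner_add_left cinner_add_right
        cinner.diff_left cinner.diff_right bounded_opsD[OF B] cinner_scaleC_left cinner_scaleC_right algebra_simps)
  have "q (x + y) - q (x - y) + \<i> * q (x + \<i> *\<^sub>C y) - \<i> * q (x - \<i> *\<^sub>C y)
      = (q (x + 1 *\<^sub>C y) - q (x - 1 *\<^sub>C y)) + \<i> * (q (x + \<i> *\<^sub>C y) - q (x - \<i> *\<^sub>C y))"
    by (simp add: algebra_simps)
  also have "\<dots> = 4 * cinner (blinfun_apply B x) y"
    unfolding * by (simp add: algebra_simps)
  finally show ?thesis by simp
qed

lemma integrable_weighted:
  fixes w g :: "'w \<Rightarrow> complex"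
  assumes "w \<in> borel_measurable M" "\<And>t. cmod (w t) \<le> 1" "integrable M g"
  shows "integrable M (\<lambda>t. w t * g t)"
  by (rule Bochner_Integration.integrable_bound[OF assms(3)])
     (use assms in \<open>auto simp: norm_mult mult_left_le_one_le\<close>)

context
  fixes M :: "'w measure" and A :: "'w \<Rightarrow> ('h::chilbert_space \<Rightarrow>\<^sub>L 'h)"
  assumes wsi: "weak_star_integrable M A"
    and pos: "\<And>t. t \<in> space M \<Longrightarrow> positive_op (A t)"
begin

text \<open>The assumption concerns diagonal coefficients only; polarization supplies the
  others.\<close>

lemma integrable_cinner: "integrable M (\<lambda>t. cinner (blinfun_apply (A t) x) y)"
proof -
  have diag: "integrable M (\<lambda>t. cinner (blinfun_apply (A t) z) z)" for z
    using wsi by (simp add: weak_star_integrable_def)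
  have "integrable M (\<lambda>t. (cinner (blinfun_apply (A t) (x + y)) (x + y) - cinner (blinfun_apply (A t) (x - y)) (x - y)
      + \<i> * cinner (blinfun_apply (A t) (x + \<i> *\<^sub>C y)) (x + \<i> *\<^sub>C y)
      - \<i> * cinner (blinfun_apply (A t) (x - \<i> *\<^sub>C y)) (x - \<i> *\<^sub>C y)) / 4)"
    by (intro integrable_divide Bochner_Integration.integrable_add Bochner_Integration.integrable_diff
        integrable_mult_right diag)
  then show ?thesis
    by (rule Bochner_Integration.integrable_cong[OF refl, THEN iffD1, rotated])
       (use positive_opD(1)[OF pos] polarization in metis)
qed

text \<open>The quadratic form of the total weak* integral, available before that operator is known
  to exist.\<close>

definition weak_form :: "'h \<Rightarrow> real" where
  "weak_form x = (LINT t|M. Re (cinner (blinfun_apply (A t) x) x))"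

lemma integrable_Re_cinner: "integrable M (\<lambda>t. Re (cinner (blinfun_apply (A t) x) x))"
  by (rule integrable_Re[OF integrable_cinner])

lemma nn_integral_weak_form:
  "(\<integral>\<^sup>+ t. ennreal (Re (cinner (blinfun_apply (A t) x) x)) \<partial>M) = ennreal (weak_form x)"
  unfolding weak_form_def
  by (rule nn_integral_eq_integral[OF integrable_Re_cinner]) (use positive_opD(2)[OF pos] in auto)

lemma weak_form_scaleR: "weak_form (r *\<^sub>R x) = r\<^sup>2 * weak_form x"
  unfolding weak_form_def
  by (simp add: blinfun.scaleR_right cinner_scaleR_left cinner_scaleR_right power2_eq_square mult.assoc)

lemma weak_form_nonneg: "0 \<le> weak_form x"
  unfolding weak_form_def by (rule integral_nonneg_AE) (use positive_opD(2)[OF pos] in auto)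

text \<open>The parallelogram law for the integrated form, with the nonnegative term at
  \<open>x + y\<close> dropped.\<close>

lemma weak_form_diff_le: "weak_form (x - y) \<le> 2 * weak_form x + 2 * weak_form y"
proof -
  have "weak_form (x - y) + weak_form (x + y)
      = (LINT t|M. Re (cinner (blinfun_apply (A t) (x - y)) (x - y)) + Re (cinner (blinfun_apply (A t) (x + y)) (x + y)))"
    unfolding weak_form_def by (rule Bochner_Integration.integral_add[symmetric]; rule integrable_Re_cinner)
  also have "\<dots> = (LINT t|M. 2 * Re (cinner (blinfun_apply (A t) x) x) + 2 * Re (cinner (blinfun_apply (A t) y) y))"
    by (rule Bochner_Integration.integral_cong[OF refl])
       (simp add: blinfun.add_right blinfun.diff_right cinner_add_left cinner_add_right cinner.diff_left cinner.diff_right)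
  also have "\<dots> = 2 * weak_form x + 2 * weak_form y"
    unfolding weak_form_def by (simp add: integrable_Re_cinner)
  finally show ?thesis using weak_form_nonneg[of "x + y"] by simp
qed

text \<open>Each integrand is continuous in the vector and nonnegative, so Fatou's lemma makes the
  integrated form lower semicontinuous.\<close>

lemma closed_weak_form_le:
  assumes "0 \<le> c"
  shows "closed {x. weak_form x \<le> c}"
  unfolding closed_sequential_limits
proof (intro allI impI, elim conjE)
  fix x :: "nat \<Rightarrow> 'h" and l
  assume x: "\<forall>n. x n \<in> {x. weak_form x \<le> c}" and l: "x \<longlonglongrightarrow> l"
  let ?p = "\<lambda>t z. ennreal (Re (cinner (blinfun_apply (A t) z) z))"
  have lim: "liminf (\<lambda>n. ?p t (x n)) = ?p t l" for t
    by (rule lim_imp_Liminf[OF trivial_limit_sequentially])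
       (intro tendsto_ennrealI tendsto_Re cinner.tendsto blinfun.tendsto tendsto_const l)
  have "ennreal (weak_form l) = (\<integral>\<^sup>+ t. liminf (\<lambda>n. ?p t (x n)) \<partial>M)"
    unfolding lim by (rule nn_integral_weak_form[symmetric])
  also have "\<dots> \<le> liminf (\<lambda>n. \<integral>\<^sup>+ t. ?p t (x n) \<partial>M)"
    by (rule nn_integral_liminf) (use integrable_Re_cinner in measurable)
  also have "\<dots> \<le> liminf (\<lambda>n. ennreal c)"
    unfolding nn_integral_weak_form using x by (intro Liminf_mono always_eventually allI ennreal_leI) simp
  also have "\<dots> = ennreal c"
    by (rule Liminf_const) simp
  finally show "l \<in> {x. weak_form x \<le> c}"
    using \<open>0 \<le> c\<close> by simp
qed

text \<open>The form is finite everywhere, so its closed sublevel sets cover the space and by Baire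
  one of them contains a ball. Writing a short \<open>h\<close> as the difference of
  \<open>x0 + h\<close> and \<open>x0\<close> gives the bound \<open>4 * n\<close> near zero;
  scaling to norm \<open>r / 2\<close> produces the constant
  \<open>16 * n / r\<^sup>2\<close>.\<close>

lemma weak_form_bounded: "\<exists>K. \<forall>x. weak_form x \<le> K * (norm x)\<^sup>2"
proof -
  have "(\<Union>n. {x. weak_form x \<le> real n}) = UNIV"
    using real_arch_simple by auto
  from Baire_sequence[OF closed_weak_form_le this] obtain n x0 r
    where r: "0 < r" and ball: "ball x0 r \<subseteq> {x. weak_form x \<le> real n}"
    by auto
  have small: "weak_form h \<le> 4 * n" if "norm h < r" for h
  proof -
    have "x0 + h \<in> ball x0 r" "x0 \<in> ball x0 r" using that r by (simp_all add: dist_norm)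
    then have "weak_form (x0 + h) \<le> n" "weak_form x0 \<le> n" using ball by blast+
    then show ?thesis using weak_form_diff_le[of "x0 + h" x0] by simp
  qed
  have "weak_form x \<le> (16 * n / r\<^sup>2) * (norm x)\<^sup>2" for x
  proof (cases "x = 0")
    case True
    then show ?thesis using weak_form_scaleR[of 0 0] by simp
  next
    case False
    define s where "s = r / (2 * norm x)"
    have s: "0 < s" "s * norm x = r / 2" using r False by (simp_all add: s_def)
    have "s\<^sup>2 * weak_form x = weak_form (s *\<^sub>R x)" by (rule weak_form_scaleR[symmetric])
    also have "\<dots> \<le> 4 * n" by (rule small) (use s r in simp)
    finally have "weak_form x \<le> 4 * n / s\<^sup>2"
      using s(1) by (simp add: pos_le_divide_eq mult.commute)
    also have "\<dots> = (16 * n / r\<^sup>2) * (norm x)\<^sup>2"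
      using r False by (simp add: s_def power_divide power_mult_distrib)
    finally show ?thesis .
  qed
  then show ?thesis by blast
qed

text \<open>Each positive value of \<open>A\<close> dominates itself, and a weight of modulus at
  most one does not spoil the inequality; integration preserves it.\<close>

lemma weighted_form_le:
  fixes w :: "'w \<Rightarrow> complex"
  assumes w: "w \<in> borel_measurable M" "\<And>t. cmod (w t) \<le> 1"
  shows "2 * cmod (LINT t|M. w t * cinner (blinfun_apply (A t) x) y) \<le> weak_form x + weak_form y"
proof -
  have "cmod (LINT t|M. w t * cinner (blinfun_apply (A t) x) y)
      \<le> (LINT t|M. cmod (w t * cinner (blinfun_apply (A t) x) y))"
    by (rule integral_norm_bound)
  also have "\<dots> \<le> (LINT t|M. (Re (cinner (blinfun_apply (A t) x) x) + Re (cinner (blinfun_apply (A t) y) y)) / 2)"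
  proof (rule integral_mono)
    show "integrable M (\<lambda>t. cmod (w t * cinner (blinfun_apply (A t) x) y))"
      by (intro integrable_norm integrable_weighted w integrable_cinner)
    show "integrable M (\<lambda>t. (Re (cinner (blinfun_apply (A t) x) x) + Re (cinner (blinfun_apply (A t) y) y)) / 2)"
      by (intro integrable_divide Bochner_Integration.integrable_add integrable_Re_cinner)
    fix t assume "t \<in> space M"
    have "cmod (w t * cinner (blinfun_apply (A t) x) y) \<le> cmod (cinner (blinfun_apply (A t) x) y)"
      unfolding norm_mult using w(2)[of t] by (intro mult_left_le_one_le) simp_all
    then show "cmod (w t * cinner (blinfun_apply (A t) x) y)
        \<le> (Re (cinner (blinfun_apply (A t) x) x) + Re (cinner (blinfun_apply (A t) y) y)) / 2"
      using dominatedD(2)[OF positive_op_dominated[OF pos[OF \<open>t \<in> space M\<close>]], of x y]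
      unfolding pos_le_divide_eq[OF zero_less_numeral] by linarith
  qed
  also have "\<dots> = (weak_form x + weak_form y) / 2"
    unfolding weak_form_def by (simp add: integrable_Re_cinner)
  finally show ?thesis by simp
qed

text \<open>Existence of the weak* integral of the weighted function. The weight 1 gives the total
  integral, indicators the integrals over measurable sets, and phases the operators on which a
  functional attains its mean modulus.\<close>

lemma ex_weighted_op:
  fixes w :: "'w \<Rightarrow> complex"
  assumes w: "w \<in> borel_measurable M" "\<And>t. cmod (w t) \<le> 1"
  shows "\<exists>D\<in>bounded_ops. \<forall>x y. cinner (blinfun_apply D x) y = (LINT t|M. w t * cinner (blinfun_apply (A t) x) y)"
proof -
  obtain K where K: "\<And>x. weak_form x \<le> K * (norm x)\<^sup>2" using weak_form_bounded by blast
  define b where "b x y = (LINT t|M. w t * cinner (blinfun_apply (A t) x) y)" for x y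
  have int: "integrable M (\<lambda>t. w t * cinner (blinfun_apply (A t) x) y)" for x y
    by (intro integrable_weighted w integrable_cinner)
  have scale: "b (c *\<^sub>C x) y = c * b x y" "b x (c *\<^sub>C y) = cnj c * b x y" for c x y
  proof -
    have "b (c *\<^sub>C x) y = (LINT t|M. c * (w t * cinner (blinfun_apply (A t) x) y))"
      unfolding b_def by (rule Bochner_Integration.integral_cong[OF refl])
        (simp add: bounded_opsD[OF positive_opD(1)[OF pos]] cinner_scaleC_left)
    then show "b (c *\<^sub>C x) y = c * b x y" by (simp add: b_def)
    have "b x (c *\<^sub>C y) = (LINT t|M. cnj c * (w t * cinner (blinfun_apply (A t) x) y))"
      unfolding b_def by (rule Bochner_Integration.integral_cong[OF refl]) (simp add: cinner_scaleC_right)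
    then show "b x (c *\<^sub>C y) = cnj c * b x y" by (simp add: b_def)
  qed
  have add: "b (x + y) z = b x z + b y z" "b x (y + z) = b x y + b x z" for x y z
    unfolding b_def
    by (simp_all add: blinfun.add_right cinner_add_left cinner_add_right distrib_left int)
  have bound: "cmod (b x y) \<le> \<bar>K\<bar> * norm x * norm y" for x y
  proof -
    have K1: "weak_form (sgn z) \<le> \<bar>K\<bar>" for z
      using K[of "sgn z"] by (cases "z = 0") (auto simp: norm_sgn)
    have "2 * cmod (b (sgn x) (sgn y)) \<le> weak_form (sgn x) + weak_form (sgn y)"
      unfolding b_def by (rule weighted_form_le[OF w])
    then have le: "cmod (b (sgn x) (sgn y)) \<le> \<bar>K\<bar>"
      using K1[of x] K1[of y] by linarith
    have "b x y = b (complex_of_real (norm x) *\<^sub>C sgn x) (complex_of_real (norm y) *\<^sub>C sgn y)"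
      unfolding scaleR_scaleC[symmetric] scaleR_norm_sgn ..
    also have "\<dots> = complex_of_real (norm x) * complex_of_real (norm y) * b (sgn x) (sgn y)"
      by (simp add: scale)
    finally have "cmod (b x y) = norm x * norm y * cmod (b (sgn x) (sgn y))"
      by (simp add: norm_mult)
    also have "\<dots> \<le> norm x * norm y * \<bar>K\<bar>"
      using le by (intro mult_left_mono) simp_all
    finally show ?thesis by (simp add: ac_simps)
  qed
  show ?thesis
    using ex_bounded_op_of_form[of b, OF add scale bound] unfolding b_def .
qed

lemma weak_star_integral_space_eqI:
  assumes "B \<in> bounded_ops" "\<And>x y. cinner (blinfun_apply B x) y = (LINT t|M. cinner (blinfun_apply (A t) x) y)"
  shows "weak_star_integral M (space M) A = B"
proof -
  have eq: "(LINT t:space M|M. cinner (blinfun_apply (A t) x) y) = (LINT t|M. cinner (blinfun_apply (A t) x) y)" for x y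
    unfolding set_lebesgue_integral_def by (rule Bochner_Integration.integral_cong) simp_all
  show ?thesis
    unfolding weak_star_integral_def eq
  proof (rule the_equality)
    show "B \<in> bounded_ops \<and> (\<forall>f g. cinner (blinfun_apply B f) g = (LINT t|M. cinner (blinfun_apply (A t) f) g))"
      using assms by blast
    fix C assume "C \<in> bounded_ops \<and> (\<forall>f g. cinner (blinfun_apply C f) g = (LINT t|M. cinner (blinfun_apply (A t) f) g))"
    then show "C = B"
      by (intro blinfun_eq_cinnerI) (simp add: assms(2))
  qed
qed

lemma weak_star_integral_space:
  "weak_star_integral M (space M) A \<in> bounded_ops"
  "cinner (blinfun_apply (weak_star_integral M (space M) A) x) y = (LINT t|M. cinner (blinfun_apply (A t) x) y)"
proof -
  obtain B where B: "B \<in> bounded_ops" "\<And>x y. cinner (blinfun_apply B x) y = (LINT t|M. cinner (blinfun_apply (A t) x) y)"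
    using ex_weighted_op[of "\<lambda>_. 1"] by auto
  show "weak_star_integral M (space M) A \<in> bounded_ops"
    "cinner (blinfun_apply (weak_star_integral M (space M) A) x) y = (LINT t|M. cinner (blinfun_apply (A t) x) y)"
    unfolding weak_star_integral_space_eqI[OF B] by (rule B)+
qed

lemma weighted_op_dominated:
  fixes w :: "'w \<Rightarrow> complex"
  assumes w: "w \<in> borel_measurable M" "\<And>t. cmod (w t) \<le> 1"
    and D: "D \<in> bounded_ops" "\<And>x y. cinner (blinfun_apply D x) y = (LINT t|M. w t * cinner (blinfun_apply (A t) x) y)"
  shows "dominated D (weak_star_integral M (space M) A)"
proof -
  have "Re (cinner (blinfun_apply (weak_star_integral M (space M) A) x) x) = weak_form x" for x
    unfolding weak_star_integral_space(2) weak_form_def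
    by (rule integral_Re[symmetric, OF integrable_cinner])
  then show ?thesis
    unfolding dominated_def D(2) using D(1) weighted_form_le[OF w] by simp
qed

end

subsection \<open>Functionals on the ideal\<close>

lemma cnj_sgn_mult: "cnj (sgn z) * z = complex_of_real (cmod z)"
proof (cases "z = 0")
  case False
  have "cnj (sgn z) * z = complex_of_real ((cmod z)\<^sup>2) / complex_of_real (cmod z)"
    by (simp add: sgn_eq complex_norm_square mult.commute del: of_real_power)
  also have "\<dots> = complex_of_real (cmod z)" using False by (simp add: power2_eq_square)
  finally show ?thesis .
qed simp

lemma borel_measurable_cnj_sgn:
  fixes h :: "'w \<Rightarrow> complex"
  assumes h: "h \<in> borel_measurable M"
  shows "(\<lambda>t. cnj (sgn (h t))) \<in> borel_measurable M"
proof -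
  have "(\<lambda>t. sgn (h t)) \<in> borel_measurable M"
    unfolding sgn_div_norm using h by measurable
  then show ?thesis
    using borel_measurable_continuous_onI[OF continuous_on_cnj[OF continuous_on_id]]
    by (rule measurable_compose)
qed

context
  fixes \<Phi> :: "(nat \<Rightarrow> complex) \<Rightarrow> real"
  assumes \<Phi>: "sn_function \<Phi>"
begin

lemma subspace_sn_ideal_closure:
  "complex_vector.subspace (sn_ideal_closure \<Phi> :: ('h::chilbert_space \<Rightarrow>\<^sub>L 'h) set)"
  unfolding complex_vector.subspace_def
proof (intro conjI ballI allI)
  show "(0 :: 'h \<Rightarrow>\<^sub>L 'h) \<in> sn_ideal_closure \<Phi>"
    by (rule sn_ideal_closure_finite_rank[OF \<Phi> sn_ideal_zero(1)[OF \<Phi>] finite_rank_op_zero])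
qed (rule sn_ideal_closure_add[OF \<Phi>] sn_ideal_closure_scaleC[OF \<Phi>]; assumption)+

text \<open>Matrix coefficients are among the test functionals, so a Pettis integral with values in
  the ideal has to coincide with the weak* integral.\<close>

lemma cinner_dual_space:
  "(\<lambda>T. cinner (blinfun_apply T x) y) \<in> dual_space (sn_ideal_closure \<Phi> :: ('h::chilbert_space \<Rightarrow>\<^sub>L 'h) set) (sn_norm \<Phi>)"
  unfolding dual_space_def
proof (intro CollectI conjI ballI allI exI[of _ "norm x * norm y"])
  fix T :: "'h \<Rightarrow>\<^sub>L 'h" assume "T \<in> sn_ideal_closure \<Phi>"
  from cinner_le_sn_norm[OF \<Phi> sn_ideal_closure_subset[OF \<Phi> this], of x y]
  show "cmod (cinner (blinfun_apply T x) y) \<le> norm x * norm y * sn_norm \<Phi> T"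
    by (simp only: mult.commute)
qed (simp_all add: blinfun.add_left cinner_add_left cinner_scaleC_left)

lemma dual_spaceD:
  fixes S T :: "'h::chilbert_space \<Rightarrow>\<^sub>L 'h"
  assumes f: "f \<in> dual_space (sn_ideal_closure \<Phi>) (sn_norm \<Phi>)"
  shows "S \<in> sn_ideal_closure \<Phi> \<Longrightarrow> T \<in> sn_ideal_closure \<Phi> \<Longrightarrow> f (S + T) = f S + f T"
    and "T \<in> sn_ideal_closure \<Phi> \<Longrightarrow> f (c *\<^sub>C T) = c * f T"
    and "S \<in> sn_ideal_closure \<Phi> \<Longrightarrow> T \<in> sn_ideal_closure \<Phi> \<Longrightarrow> f (S - T) = f S - f T"
proof -
  show add: "S \<in> sn_ideal_closure \<Phi> \<Longrightarrow> T \<in> sn_ideal_closure \<Phi> \<Longrightarrow> f (S + T) = f S + f T" for S T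
    using f unfolding dual_space_def by blast
  show scale: "T \<in> sn_ideal_closure \<Phi> \<Longrightarrow> f (c *\<^sub>C T) = c * f T" for c T
    using f unfolding dual_space_def by blast
  show "S \<in> sn_ideal_closure \<Phi> \<Longrightarrow> T \<in> sn_ideal_closure \<Phi> \<Longrightarrow> f (S - T) = f S - f T"
    unfolding diff_eq_scaleC[of S T] by (simp only: add scale sn_ideal_closure_scaleC[OF \<Phi>]) simp
qed

lemma dual_space_sum:
  fixes T :: "'i \<Rightarrow> ('h::chilbert_space \<Rightarrow>\<^sub>L 'h)"
  assumes f: "f \<in> dual_space (sn_ideal_closure \<Phi>) (sn_norm \<Phi>)"
    and T: "\<And>i. i \<in> I \<Longrightarrow> T i \<in> sn_ideal_closure \<Phi>"
  shows "f (\<Sum>i\<in>I. T i) = (\<Sum>i\<in>I. f (T i))"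
proof -
  note X = subspace_sn_ideal_closure
  have f0: "f 0 = 0"
    using dual_spaceD(2)[OF f complex_vector.subspace_0[OF X], of 0]
    by (simp add: complex_vector.scale_zero_left)
  show ?thesis
    using T
  proof (induction I rule: infinite_finite_induct)
    case (insert i I)
    have "f (T i + (\<Sum>i\<in>I. T i)) = f (T i) + f (\<Sum>i\<in>I. T i)"
      by (rule dual_spaceD(1)[OF f]) (intro complex_vector.subspace_sum[OF X] insert.prems; simp)+
    then show ?case using insert by simp
  qed (simp_all add: f0)
qed

lemma dual_space_compress:
  fixes T :: "'h::chilbert_space \<Rightarrow>\<^sub>L 'h"
  assumes f: "f \<in> dual_space (sn_ideal_closure \<Phi>) (sn_norm \<Phi>)" and T: "T \<in> bounded_ops"
  shows "f (compress e m T) = (\<Sum>i<m. \<Sum>j<m. cinner (blinfun_apply T (e j)) (e i) * f (rank_one (e j) (e i)))"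
proof -
  have R: "rank_one (e j) (e i) \<in> sn_ideal_closure \<Phi>" for i j
    by (rule sn_ideal_closure_finite_rank[OF \<Phi> sn_ideal_rank_one(1)[OF \<Phi>] finite_rank_op_rank_one])
  note S = sn_ideal_closure_scaleC[OF \<Phi> R]
  have "f (compress e m T) = (\<Sum>i<m. f (\<Sum>j<m. cinner (blinfun_apply T (e j)) (e i) *\<^sub>C rank_one (e j) (e i)))"
    unfolding compress_expansion[OF T]
    by (rule dual_space_sum[OF f]) (intro complex_vector.subspace_sum[OF subspace_sn_ideal_closure] S)
  then show ?thesis
    by (simp only: dual_space_sum[OF f S] dual_spaceD(2)[OF f R])
qed

text \<open>The values of \<open>f\<close> at the compressions of \<open>A t\<close> converge in the mean, because a
  weighted integral of \<open>A\<close> with weights of modulus at most one is dominated by the total integral,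
  and the compressions converge uniformly on dominated operators.\<close>

lemma functional_weighted_integral:
  fixes M :: "'w measure" and A :: "'w \<Rightarrow> ('h::chilbert_space \<Rightarrow>\<^sub>L 'h)"
  assumes sep: "separable_space (euclidean :: 'h topology)"
    and wsi: "weak_star_integrable M A"
    and pos: "\<And>t. t \<in> space M \<Longrightarrow> positive_op (A t)"
    and AX: "\<And>t. t \<in> space M \<Longrightarrow> A t \<in> sn_ideal_closure \<Phi>"
    and BX: "weak_star_integral M (space M) A \<in> sn_ideal_closure \<Phi>"
    and f: "f \<in> dual_space (sn_ideal_closure \<Phi>) (sn_norm \<Phi>)"
  shows "integrable M (\<lambda>t. f (A t))"
    and "\<And>w D. w \<in> borel_measurable M \<Longrightarrow> (\<And>t. cmod (w t) \<le> 1) \<Longrightarrow> D \<in> bounded_ops \<Longrightarrow>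
      (\<And>x y. cinner (blinfun_apply D x) y = (LINT t|M. w t * cinner (blinfun_apply (A t) x) y)) \<Longrightarrow>
      D \<in> sn_ideal_closure \<Phi> \<and> sn_norm \<Phi> D \<le> sn_norm \<Phi> (weak_star_integral M (space M) A) \<and>
        f D = (LINT t|M. w t * f (A t))"
proof -
  define B where "B = weak_star_integral M (space M) A"
  note BX' = BX[folded B_def]
  obtain e :: "nat \<Rightarrow> 'h" where on: "orthonormal0 e" and total: "\<And>x. (\<lambda>m. blinfun_apply (proj e m) x) \<longlonglongrightarrow> x"
    using ex_total_orthonormal0[OF sep] by blast
  obtain K0 where K0: "\<And>T. T \<in> sn_ideal_closure \<Phi> \<Longrightarrow> cmod (f T) \<le> K0 * sn_norm \<Phi> T"
    using f unfolding dual_space_def by blast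
  define K where "K = \<bar>K0\<bar> + 1"
  have "0 < K" by (simp add: K_def add_nonneg_pos)
  have K: "cmod (f T) \<le> K * sn_norm \<Phi> T" if "T \<in> sn_ideal_closure \<Phi>" for T
  proof -
    have "K0 * sn_norm \<Phi> T \<le> K * sn_norm \<Phi> T"
      by (intro mult_right_mono sn_norm_nonneg[OF \<Phi> sn_ideal_closure_subset[OF \<Phi> that]]) (simp add: K_def)
    with K0[OF that] show ?thesis by simp
  qed
  have bo: "T \<in> bounded_ops" if "T \<in> sn_ideal_closure \<Phi>" for T :: "'h \<Rightarrow>\<^sub>L 'h"
    by (rule compact_op_bounded_ops[OF sn_ideal_compact[OF sn_ideal_closure_subset[OF \<Phi> that]]])
  note cX = compress_closure(3)[OF \<Phi> on bo]
  have f_diff: "cmod (f T - f (compress e m T)) \<le> K * sn_norm \<Phi> (T - compress e m T)"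
    if "T \<in> sn_ideal_closure \<Phi>" for T :: "'h \<Rightarrow>\<^sub>L 'h" and m
    using K[OF sn_ideal_closure_diff[OF \<Phi> that cX[OF that]]] dual_spaceD(3)[OF f that cX[OF that]] by simp

  \<comment> \<open>Matrix coefficients are integrable, and a weight passes through the finite sum;
    \<open>g\<close> below identifies the sum with \<open>f\<close> at the compression.\<close>
  define g where "g m t = (\<Sum>i<m. \<Sum>j<m. cinner (blinfun_apply (A t) (e j)) (e i) * f (rank_one (e j) (e i)))" for m t
  have g: "g m t = f (compress e m (A t))" if "t \<in> space M" for m t
    unfolding g_def by (rule dual_space_compress[OF f bo[OF AX[OF that]], symmetric])
  have g_int: "integrable M (g m)" for m
    unfolding g_def
    by (intro Bochner_Integration.integrable_sum integrable_mult_left integrable_cinner[OF wsi pos])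
  \<comment> \<open>A positive operator is dominated by itself, so the uniform estimate applies with
    \<open>A t\<close> in place of \<open>B\<close>.\<close>
  have g_lim: "(\<lambda>m. g m t) \<longlonglongrightarrow> f (A t)" if t: "t \<in> space M" for t
  proof (rule LIMSEQ_I)
    fix r :: real assume "0 < r"
    then have "0 < r / K" using \<open>0 < K\<close> by simp
    obtain N where N: "\<And>m D. N \<le> m \<Longrightarrow> dominated D (A t) \<Longrightarrow> sn_norm \<Phi> (D - compress e m D) < r / K"
      by (rule dominated_diff_compress_uniform[OF \<Phi> on total AX[OF t] \<open>0 < r / K\<close>]) blast
    have "norm (g m t - f (A t)) < r" if "N \<le> m" for m
    proof -
      have "norm (g m t - f (A t)) \<le> K * sn_norm \<Phi> (A t - compress e m (A t))"
        unfolding g[OF t] using f_diff[OF AX[OF t], of m] by (simp add: norm_minus_commute)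
      also have "\<dots> < K * (r / K)"
        using N[OF that positive_op_dominated[OF pos[OF t]]] \<open>0 < K\<close> by (intro mult_strict_left_mono)
      also have "\<dots> = r" using \<open>0 < K\<close> by simp
      finally show ?thesis .
    qed
    then show "\<exists>N. \<forall>m\<ge>N. norm (g m t - f (A t)) < r" by blast
  qed
  \<comment> \<open>Measurability comes solely from the pointwise limit of integrable
    functions.\<close>
  have fA_meas: "(\<lambda>t. f (A t)) \<in> borel_measurable M"
    by (rule borel_measurable_LIMSEQ_metric[OF borel_measurable_integrable[OF g_int] g_lim])

  have weighted: "D \<in> sn_ideal_closure \<Phi> \<and> dominated D B \<and> (\<forall>m. f (compress e m D) = (LINT t|M. w t * g m t))"
    if w: "w \<in> borel_measurable M" "\<And>t. cmod (w t) \<le> 1" and D: "D \<in> bounded_ops"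
      "\<And>x y. cinner (blinfun_apply D x) y = (LINT t|M. w t * cinner (blinfun_apply (A t) x) y)" for w D
  proof -
    have dom: "dominated D B"
      unfolding B_def by (rule weighted_op_dominated[OF wsi pos w D])
    have int: "integrable M (\<lambda>t. w t * cinner (blinfun_apply (A t) x) y)" for x y
      by (rule integrable_weighted[OF w integrable_cinner[OF wsi pos]])
    have "f (compress e m D) = (LINT t|M. w t * g m t)" for m
    proof -
      have "f (compress e m D)
          = (\<Sum>i<m. \<Sum>j<m. (LINT t|M. (w t * cinner (blinfun_apply (A t) (e j)) (e i)) * f (rank_one (e j) (e i))))"
        unfolding dual_space_compress[OF f D(1)] D(2) by simp
      also have "\<dots> = (LINT t|M. (\<Sum>i<m. \<Sum>j<m. (w t * cinner (blinfun_apply (A t) (e j)) (e i)) * f (rank_one (e j) (e i))))"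
        by (simp add: Bochner_Integration.integral_sum int)
      also have "\<dots> = (LINT t|M. w t * g m t)"
        unfolding g_def sum_distrib_left mult.assoc ..
      finally show ?thesis .
    qed
    then show ?thesis
      using dominated_closure[OF \<Phi> on total BX' dom] dom by blast
  qed

  \<comment> \<open>With the conjugate phase of \<open>g m t - g n t\<close> as weight, the mean
    distance becomes a value of \<open>f\<close>. For \<open>n \<le> m\<close> its argument is the
    compression to level \<open>m\<close> of \<open>D - compress e n D\<close>, so the bound depends
    on \<open>n\<close> alone.\<close>
  have Cauchy: "(LINT t|M. cmod (g m t - g n t)) \<le> K * \<epsilon>"
    if N: "\<And>D. dominated D B \<Longrightarrow> sn_norm \<Phi> (D - compress e n D) < \<epsilon>" and "n \<le> m" for m n \<epsilon>
  proof -
    define w where "w t = cnj (sgn (g m t - g n t))" for t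
    have w: "w \<in> borel_measurable M" "\<And>t. cmod (w t) \<le> 1"
    proof -
      show "w \<in> borel_measurable M"
        unfolding w_def
        by (intro borel_measurable_cnj_sgn borel_measurable_diff borel_measurable_integrable g_int)
      show "cmod (w t) \<le> 1" for t by (simp add: w_def norm_sgn)
    qed
    obtain D where "D \<in> bounded_ops"
      "\<And>x y. cinner (blinfun_apply D x) y = (LINT t|M. w t * cinner (blinfun_apply (A t) x) y)"
      using ex_weighted_op[OF wsi pos w] by blast
    from weighted[OF w this] have D: "D \<in> sn_ideal_closure \<Phi>" "dominated D B"
      and fD: "\<And>m. f (compress e m D) = (LINT t|M. w t * g m t)"
      by blast+
    have int: "integrable M (\<lambda>t. w t * g m t)" for m
      by (rule integrable_weighted[OF w g_int])
    have "complex_of_real (LINT t|M. cmod (g m t - g n t)) = (LINT t|M. complex_of_real (cmod (g m t - g n t)))"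
      by simp
    also have "\<dots> = (LINT t|M. w t * g m t - w t * g n t)"
    proof (rule Bochner_Integration.integral_cong[OF refl])
      fix t
      show "complex_of_real (cmod (g m t - g n t)) = w t * g m t - w t * g n t"
        by (simp add: w_def right_diff_distrib[symmetric] cnj_sgn_mult)
    qed
    also have "\<dots> = f (compress e m D) - f (compress e n D)"
      unfolding fD by (rule Bochner_Integration.integral_diff[OF int int])
    also have "\<dots> = f (compress e m D - compress e n D)"
      by (rule dual_spaceD(3)[OF f cX[OF D(1)] cX[OF D(1)], symmetric])
    also have "compress e m D - compress e n D = compress e m (D - compress e n D)"
      unfolding compress_diff compress_compress[OF on \<open>n \<le> m\<close>] ..
    finally have "cmod (complex_of_real (LINT t|M. cmod (g m t - g n t))) = cmod (f (compress e m (D - compress e n D)))"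
      by simp
    moreover have "0 \<le> (LINT t|M. cmod (g m t - g n t))"
      by (rule integral_nonneg_AE) simp
    ultimately have "(LINT t|M. cmod (g m t - g n t)) = cmod (f (compress e m (D - compress e n D)))"
      by (simp only: norm_of_real abs_of_nonneg)
    also have "\<dots> \<le> K * sn_norm \<Phi> (compress e m (D - compress e n D))"
      by (rule K[OF cX[OF sn_ideal_closure_diff[OF \<Phi> D(1) cX[OF D(1)]]]])
    also have "\<dots> \<le> K * sn_norm \<Phi> (D - compress e n D)"
      using \<open>0 < K\<close> sn_ideal_closure_subset[OF \<Phi> sn_ideal_closure_diff[OF \<Phi> D(1) cX[OF D(1)]]]
      by (intro mult_left_mono compress_sn_ideal(2)[OF \<Phi> on]) simp_all
    also have "\<dots> \<le> K * \<epsilon>"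
      using N[OF D(2)] \<open>0 < K\<close> by (intro mult_left_mono) simp_all
    finally show ?thesis .
  qed

  \<comment> \<open>Fatou's lemma lets \<open>m\<close> tend to infinity, since the Cauchy bound is
    the same for all \<open>m \<ge> n\<close>.\<close>
  have mean: "(\<integral>\<^sup>+ t. ennreal (cmod (f (A t) - g n t)) \<partial>M) \<le> ennreal (K * \<epsilon>)"
    if N: "\<And>D. dominated D B \<Longrightarrow> sn_norm \<Phi> (D - compress e n D) < \<epsilon>" for n \<epsilon>
  proof -
    have "(\<integral>\<^sup>+ t. ennreal (cmod (f (A t) - g n t)) \<partial>M) = (\<integral>\<^sup>+ t. liminf (\<lambda>m. ennreal (cmod (g m t - g n t))) \<partial>M)"
    proof (rule nn_integral_cong)
      fix t assume t: "t \<in> space M"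
      have "(\<lambda>m. ennreal (cmod (g m t - g n t))) \<longlonglongrightarrow> ennreal (cmod (f (A t) - g n t))"
        by (intro tendsto_ennrealI tendsto_norm tendsto_diff tendsto_const g_lim t)
      then show "ennreal (cmod (f (A t) - g n t)) = liminf (\<lambda>m. ennreal (cmod (g m t - g n t)))"
        by (rule lim_imp_Liminf[OF trivial_limit_sequentially, symmetric])
    qed
    also have "\<dots> \<le> liminf (\<lambda>m. \<integral>\<^sup>+ t. ennreal (cmod (g m t - g n t)) \<partial>M)"
      by (rule nn_integral_liminf) (use borel_measurable_integrable[OF g_int] in measurable)
    also have "\<dots> \<le> liminf (\<lambda>m. ennreal (K * \<epsilon>))"
    proof (rule Liminf_mono)
      have "(\<integral>\<^sup>+ t. ennreal (cmod (g m t - g n t)) \<partial>M) \<le> ennreal (K * \<epsilon>)" if "n \<le> m" for m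
      proof -
        have "(\<integral>\<^sup>+ t. ennreal (cmod (g m t - g n t)) \<partial>M) = ennreal (LINT t|M. cmod (g m t - g n t))"
          by (rule nn_integral_eq_integral) (intro integrable_norm Bochner_Integration.integrable_diff g_int, simp)
        also have "\<dots> \<le> ennreal (K * \<epsilon>)" by (intro ennreal_leI Cauchy N that)
        finally show ?thesis .
      qed
      then show "eventually (\<lambda>m. (\<integral>\<^sup>+ t. ennreal (cmod (g m t - g n t)) \<partial>M) \<le> ennreal (K * \<epsilon>)) sequentially"
        unfolding eventually_sequentially by blast
    qed
    also have "\<dots> = ennreal (K * \<epsilon>)" by (rule Liminf_const) simp
    finally show ?thesis .
  qed
  have diff_int: "integrable M (\<lambda>t. f (A t) - g n t)"
    if N: "\<And>D. dominated D B \<Longrightarrow> sn_norm \<Phi> (D - compress e n D) < \<epsilon>" for n \<epsilon>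
    by (rule integrableI_bounded)
       (use fA_meas borel_measurable_integrable[OF g_int] in measurable, use mean[OF N] in \<open>auto intro: le_less_trans\<close>)

  \<comment> \<open>Any finite bound suffices for integrability: one integrable \<open>g N1\<close>
    at finite mean distance from \<open>f (A t)\<close>.\<close>
  obtain N1 where "\<And>m D. N1 \<le> m \<Longrightarrow> dominated D B \<Longrightarrow> sn_norm \<Phi> (D - compress e m D) < 1"
    by (rule dominated_diff_compress_uniform[OF \<Phi> on total BX' zero_less_one]) blast
  from Bochner_Integration.integrable_add[OF diff_int[OF this[OF order_refl]] g_int[of N1]]
  show fA_int: "integrable M (\<lambda>t. f (A t))" by simp

  fix w :: "'w \<Rightarrow> complex" and D :: "'h \<Rightarrow>\<^sub>L 'h"
  assume w: "w \<in> borel_measurable M" "\<And>t. cmod (w t) \<le> 1" and D_op: "D \<in> bounded_ops"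
    "\<And>x y. cinner (blinfun_apply D x) y = (LINT t|M. w t * cinner (blinfun_apply (A t) x) y)"
  from weighted[OF w D_op] have D: "D \<in> sn_ideal_closure \<Phi>" "dominated D B"
    and fD: "\<And>m. f (compress e m D) = (LINT t|M. w t * g m t)"
    by blast+
  have "cmod (f D - (LINT t|M. w t * f (A t))) \<le> \<epsilon>" if "0 < \<epsilon>" for \<epsilon>
  proof -
    \<comment> \<open>Replacing \<open>D\<close> by its compression and \<open>f (A t)\<close> by
      \<open>g n t\<close> costs \<open>K * \<delta>\<close> each.\<close>
    define \<delta> where "\<delta> = \<epsilon> / (2 * K)"
    have \<delta>: "0 < \<delta>" "K * \<delta> + K * \<delta> = \<epsilon>" using that \<open>0 < K\<close> by (simp_all add: \<delta>_def)
    obtain n where n: "\<And>m D. n \<le> m \<Longrightarrow> dominated D B \<Longrightarrow> sn_norm \<Phi> (D - compress e m D) < \<delta>"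
      by (rule dominated_diff_compress_uniform[OF \<Phi> on total BX' \<delta>(1)]) blast
    note n = n[OF order_refl]
    have "cmod (f (compress e n D) - (LINT t|M. w t * f (A t))) = cmod (LINT t|M. w t * (f (A t) - g n t))"
    proof -
      have "(LINT t|M. w t * (f (A t) - g n t)) = (LINT t|M. w t * f (A t)) - (LINT t|M. w t * g n t)"
        unfolding right_diff_distrib
        by (rule Bochner_Integration.integral_diff[OF integrable_weighted[OF w fA_int] integrable_weighted[OF w g_int]])
      then show ?thesis by (simp add: fD norm_minus_commute)
    qed
    also have "\<dots> \<le> (LINT t|M. cmod (w t * (f (A t) - g n t)))"
      by (rule integral_norm_bound)
    also have "\<dots> \<le> (LINT t|M. cmod (f (A t) - g n t))"
    proof (rule integral_mono)
      show "integrable M (\<lambda>t. cmod (w t * (f (A t) - g n t)))"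
        by (intro integrable_norm integrable_weighted[OF w] diff_int[OF n])
      show "integrable M (\<lambda>t. cmod (f (A t) - g n t))"
        by (intro integrable_norm diff_int[OF n])
      show "cmod (w t * (f (A t) - g n t)) \<le> cmod (f (A t) - g n t)" for t
        unfolding norm_mult using w(2)[of t] by (intro mult_left_le_one_le) simp_all
    qed
    also have "\<dots> \<le> K * \<delta>"
    proof -
      have "ennreal (LINT t|M. cmod (f (A t) - g n t)) = (\<integral>\<^sup>+ t. ennreal (cmod (f (A t) - g n t)) \<partial>M)"
        by (rule nn_integral_eq_integral[OF integrable_norm[OF diff_int[OF n]], symmetric]) simp_all
      also have "\<dots> \<le> ennreal (K * \<delta>)" by (rule mean[OF n])
      finally show ?thesis using \<open>0 < K\<close> \<open>0 < \<delta>\<close> by (simp add: ennreal_le_iff)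
    qed
    finally have 1: "cmod (f (compress e n D) - (LINT t|M. w t * f (A t))) \<le> K * \<delta>" .
    have "cmod (f D - f (compress e n D)) \<le> K * sn_norm \<Phi> (D - compress e n D)"
      by (rule f_diff[OF D(1)])
    also have "\<dots> \<le> K * \<delta>"
      using n[OF D(2)] \<open>0 < K\<close> by (intro mult_left_mono) simp_all
    finally have 2: "cmod (f D - f (compress e n D)) \<le> K * \<delta>" .
    have "f D - (LINT t|M. w t * f (A t)) = (f D - f (compress e n D)) + (f (compress e n D) - (LINT t|M. w t * f (A t)))"
      by simp
    then have "cmod (f D - (LINT t|M. w t * f (A t)))
        \<le> cmod (f D - f (compress e n D)) + cmod (f (compress e n D) - (LINT t|M. w t * f (A t)))"
      by (metis norm_triangle_ineq)
    then show ?thesis using 1 2 \<delta>(2) by linarith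
  qed
  then have "cmod (f D - (LINT t|M. w t * f (A t))) \<le> 0"
    by (rule field_le_epsilon[of _ 0, simplified])
  then have "f D = (LINT t|M. w t * f (A t))" by simp
  moreover have "sn_norm \<Phi> D \<le> sn_norm \<Phi> B"
    by (rule dominated_sn_ideal(2)[OF \<Phi> D(2) sn_ideal_closure_subset[OF \<Phi> BX']])
  ultimately show "D \<in> sn_ideal_closure \<Phi> \<and> sn_norm \<Phi> D \<le> sn_norm \<Phi> (weak_star_integral M (space M) A) \<and>
      f D = (LINT t|M. w t * f (A t))"
    using D(1) unfolding B_def by blast
qed

end

section \<open>The dual norm and its value at a norming functional\<close>

lemma dual_normD:
  fixes X :: "'b::complex_vector set"
  assumes X: "complex_vector.subspace X"
    and N0: "\<And>x. x \<in> X \<Longrightarrow> 0 \<le> N x"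
    and scale: "\<And>c x. x \<in> X \<Longrightarrow> N (c *\<^sub>C x) = cmod c * N x"
    and f: "f \<in> dual_space X N" and x: "x \<in> X"
  shows "cmod (f x) \<le> dual_norm X N f * N x"
proof -
  obtain K where K: "\<And>x. x \<in> X \<Longrightarrow> cmod (f x) \<le> K * N x"
    using f unfolding dual_space_def by blast
  have fs: "f (c *\<^sub>C x) = c * f x" for c
    using f x unfolding dual_space_def by blast
  show ?thesis
  proof (cases "N x = 0")
    \<comment> \<open>Boundedness by some multiple of \<open>N\<close> forces \<open>f x = 0\<close>
      here, where normalising \<open>x\<close> is impossible.\<close>
    case True
    then show ?thesis using K[OF x] by simp
  next
    case False
    with N0[OF x] have pos: "0 < N x" by simp
    define y where "y = complex_of_real (1 / N x) *\<^sub>C x"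
    have y: "y \<in> X" unfolding y_def by (rule complex_vector.subspace_scale[OF X x])
    have Ny: "N y = 1" using pos by (simp add: y_def scale[OF x] norm_divide)
    have "cmod (f y) \<le> dual_norm X N f"
      unfolding dual_norm_def
    proof (rule cSUP_upper)
      show "y \<in> {x \<in> X. N x \<le> 1}" using y Ny by simp
      show "bdd_above ((\<lambda>x. cmod (f x)) ` {x \<in> X. N x \<le> 1})"
      proof (rule bdd_aboveI2)
        fix z assume "z \<in> {x \<in> X. N x \<le> 1}"
        then have z: "z \<in> X" "N z \<le> 1" by simp_all
        have "cmod (f z) \<le> K * N z" by (rule K[OF z(1)])
        also have "\<dots> \<le> \<bar>K\<bar> * N z" by (intro mult_right_mono N0 z) simp
        also have "\<dots> \<le> \<bar>K\<bar> * 1" by (intro mult_left_mono z) simp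
        finally show "cmod (f z) \<le> \<bar>K\<bar>" by simp
      qed
    qed
    moreover have "cmod (f y) * N x = cmod (f x)"
      using pos by (simp add: y_def fs norm_mult norm_divide)
    ultimately show ?thesis
      using pos by (metis less_imp_le mult_right_mono)
  qed
qed

lemma dual_norm_eq_1I:
  assumes b: "b \<in> X" "0 < N b" "cmod (f b) = N b" and le: "\<And>x. x \<in> X \<Longrightarrow> cmod (f x) \<le> N x"
    and X: "complex_vector.subspace X" and scale: "\<And>c x. x \<in> X \<Longrightarrow> N (c *\<^sub>C x) = cmod c * N x"
    and f: "f \<in> dual_space X N"
  shows "dual_norm X N f = 1"
proof -
  define y where "y = complex_of_real (1 / N b) *\<^sub>C b"
  have y: "y \<in> X" unfolding y_def by (rule complex_vector.subspace_scale[OF X b(1)])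
  have "N y = 1" using b by (simp add: y_def scale norm_divide)
  have "f y = complex_of_real (1 / N b) * f b"
    unfolding y_def using f b(1) unfolding dual_space_def by blast
  then have fy: "cmod (f y) = 1" using b by (simp add: norm_mult norm_divide)
  have le1: "cmod (f x) \<le> 1" if "x \<in> {x \<in> X. N x \<le> 1}" for x
    using le[of x] that by simp
  show ?thesis
    unfolding dual_norm_def
  proof (rule antisym)
    show "(SUP x\<in>{x \<in> X. N x \<le> 1}. cmod (f x)) \<le> 1"
      by (rule cSUP_least) (use y \<open>N y = 1\<close> le1 in auto)
    have "cmod (f y) \<le> (SUP x\<in>{x \<in> X. N x \<le> 1}. cmod (f x))"
      by (rule cSUP_upper) (use y \<open>N y = 1\<close> le1 in \<open>auto intro!: bdd_aboveI2[of _ _ 1]\<close>)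
    then show "1 \<le> (SUP x\<in>{x \<in> X. N x \<le> 1}. cmod (f x))" by (simp only: fy)
  qed
qed

theorem theorem5p2:
  fixes M :: "'w measure"
    and \<Phi> :: "(nat \<Rightarrow> complex) \<Rightarrow> real"
    and \<A> :: "'w \<Rightarrow> ('h::chilbert_space \<Rightarrow>\<^sub>L 'h)"
  assumes "separable_space (euclidean :: 'h topology)"
    and "\<not> (\<exists>S :: 'h set. finite S \<and> cspan S = UNIV)"
    and "complete_measure M"
    and "sn_function \<Phi>"
    and "weak_star_integrable M \<A>"
    and "\<And>t. t \<in> space M \<Longrightarrow> positive_op (\<A> t)"
    and "\<And>t. t \<in> space M \<Longrightarrow> \<A> t \<in> sn_ideal_closure \<Phi>"
  shows "(pettis_integrable M (sn_ideal_closure \<Phi>) (sn_norm \<Phi>) \<A> \<longleftrightarrow>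
            weak_star_integral M (space M) \<A> \<in> sn_ideal_closure \<Phi>) \<and>
         (pettis_integrable M (sn_ideal_closure \<Phi>) (sn_norm \<Phi>) \<A> \<longrightarrow>
            pettis_norm M (sn_ideal_closure \<Phi>) (sn_norm \<Phi>) \<A> =
              ennreal (sn_norm \<Phi> (weak_star_integral M (space M) \<A>)))"
proof -
  note \<Phi> = assms(4) and pos = assms(6) and AX = assms(7)
  define X :: "('h \<Rightarrow>\<^sub>L 'h) set" where "X = sn_ideal_closure \<Phi>"
  define N :: "('h \<Rightarrow>\<^sub>L 'h) \<Rightarrow> real" where "N = sn_norm \<Phi>"
  define B where "B = weak_star_integral M (space M) \<A>"
  have B: "B \<in> bounded_ops"
    "cinner (blinfun_apply B x) y = (LINT t|M. cinner (blinfun_apply (\<A> t) x) y)" for x y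
    unfolding B_def by (rule weak_star_integral_space[OF assms(5) pos]; assumption)+
  have X: "complex_vector.subspace X"
    unfolding X_def by (rule subspace_sn_ideal_closure[OF \<Phi>])
  have XI: "T \<in> sn_ideal \<Phi>" if "T \<in> X" for T
    using that unfolding X_def by (rule sn_ideal_closure_subset[OF \<Phi>])
  have N0: "0 \<le> N T" if "T \<in> X" for T
    unfolding N_def by (rule sn_norm_nonneg[OF \<Phi> XI[OF that]])
  have N_scale: "N (c *\<^sub>C T) = cmod c * N T" if "T \<in> X" for c T
    unfolding N_def by (rule sn_ideal_scaleC(2)[OF \<Phi> XI[OF that]])
  have N_add: "N (S + T) \<le> N S + N T" if "S \<in> X" "T \<in> X" for S T
    unfolding N_def by (rule sn_ideal_add(2)[OF \<Phi> XI[OF that(1)] XI[OF that(2)]])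
  \<comment> \<open>Only the integral over the whole space is used; matrix coefficients identify it
    with \<open>B\<close>.\<close>
  have forward: "B \<in> X" if P: "pettis_integrable M X N \<A>"
  proof -
    obtain Y where Y: "Y \<in> X" "\<forall>f\<in>dual_space X N. f Y = (LINT t:space M|M. f (\<A> t))"
      using P unfolding pettis_integrable_def by (metis sets.top)
    have "Y = B"
    proof (rule blinfun_eq_cinnerI)
      fix x y
      have "(\<lambda>T. cinner (blinfun_apply T x) y) \<in> dual_space X N"
        unfolding X_def N_def by (rule cinner_dual_space[OF \<Phi>])
      with Y(2) have "cinner (blinfun_apply Y x) y = (LINT t:space M|M. cinner (blinfun_apply (\<A> t) x) y)"
        by (rule bspec)
      also have "\<dots> = cinner (blinfun_apply B x) y"
        unfolding B(2) set_lebesgue_integral_def by (rule Bochner_Integration.integral_cong) simp_all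
      finally show "cinner (blinfun_apply Y x) y = cinner (blinfun_apply B x) y" .
    qed
    with Y(1) show ?thesis by simp
  qed
  note main = functional_weighted_integral[OF \<Phi> assms(1,5) pos AX, folded B_def X_def N_def]
  have backward: "pettis_integrable M X N \<A>" if BX: "B \<in> X"
    unfolding pettis_integrable_def
  proof (intro conjI ballI)
    show "\<A> t \<in> X" if "t \<in> space M" for t unfolding X_def by (rule AX[OF that])
  next
    fix f assume f: "f \<in> dual_space X N"
    show int: "integrable M (\<lambda>t. f (\<A> t))" by (rule main(1)[OF _ _ BX f])
    then show "mu_measurable M (\<lambda>t. f (\<A> t))" by (rule integrable_imp_mu_measurable)
  next
    fix E assume E: "E \<in> sets M"
    define w :: "'w \<Rightarrow> complex" where "w = indicator E"
    have w: "w \<in> borel_measurable M" "\<And>t. cmod (w t) \<le> 1"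
      using E by (auto simp: w_def indicator_def)
    obtain D where D: "D \<in> bounded_ops"
      "\<And>x y. cinner (blinfun_apply D x) y = (LINT t|M. w t * cinner (blinfun_apply (\<A> t) x) y)"
      using ex_weighted_op[OF assms(5) pos w] by blast
    have fD: "D \<in> X" "f D = (LINT t:E|M. f (\<A> t))" if f: "f \<in> dual_space X N" for f
    proof -
      have *: "D \<in> X \<and> N D \<le> N B \<and> f D = (LINT t|M. w t * f (\<A> t))"
        by (rule main(2)[OF _ _ BX f w D])
      then show "D \<in> X" by blast
      have "(LINT t:E|M. f (\<A> t)) = (LINT t|M. w t * f (\<A> t))"
        unfolding set_lebesgue_integral_def
        by (rule Bochner_Integration.integral_cong) (simp_all add: w_def indicator_def)
      with * show "f D = (LINT t:E|M. f (\<A> t))" by simp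
    qed
    \<comment> \<open>Membership of \<open>D\<close> in \<open>X\<close> was obtained relative to
      some functional, and the zero functional serves for that.\<close>
    have "(\<lambda>_. 0) \<in> dual_space X N" by (auto simp: dual_space_def intro!: exI[of _ 0])
    then show "\<exists>Y\<in>X. \<forall>f\<in>dual_space X N. f Y = (LINT t:E|M. f (\<A> t))"
      using fD by blast
  qed
  have norm: "pettis_norm M X N \<A> = ennreal (N B)" if BX: "B \<in> X"
    unfolding pettis_norm_def
  proof (rule antisym)
    show "(SUP f\<in>{f \<in> dual_space X N. dual_norm X N f = 1}. \<integral>\<^sup>+ t. ennreal (cmod (f (\<A> t))) \<partial>M) \<le> ennreal (N B)"
    proof (rule SUP_least, elim CollectE conjE)
      fix f assume f: "f \<in> dual_space X N" and f1: "dual_norm X N f = 1"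
      have int: "integrable M (\<lambda>t. f (\<A> t))" by (rule main(1)[OF _ _ BX f])
      \<comment> \<open>This weight makes \<open>f D\<close> the integral of the modulus of
        \<open>f (\<A> t)\<close>, while the norm of \<open>D\<close> stays below that of
        \<open>B\<close>.\<close>
      define w where "w t = cnj (sgn (f (\<A> t)))" for t
      have w: "w \<in> borel_measurable M" "\<And>t. cmod (w t) \<le> 1"
      proof -
        show "w \<in> borel_measurable M"
          unfolding w_def using borel_measurable_cnj_sgn[OF borel_measurable_integrable[OF int]] .
        show "cmod (w t) \<le> 1" for t by (simp add: w_def norm_sgn)
      qed
      obtain D where D: "D \<in> bounded_ops"
        "\<And>x y. cinner (blinfun_apply D x) y = (LINT t|M. w t * cinner (blinfun_apply (\<A> t) x) y)"
        using ex_weighted_op[OF assms(5) pos w] by blast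
      have fD: "D \<in> X \<and> N D \<le> N B \<and> f D = (LINT t|M. w t * f (\<A> t))"
        by (rule main(2)[OF _ _ BX f w D])
      have "f D = (LINT t|M. complex_of_real (cmod (f (\<A> t))))"
        unfolding fD[THEN conjunct2, THEN conjunct2] w_def cnj_sgn_mult ..
      also have "\<dots> = complex_of_real (LINT t|M. cmod (f (\<A> t)))" by simp
      finally have "(LINT t|M. cmod (f (\<A> t))) \<le> cmod (f D)" by simp
      also have "\<dots> \<le> dual_norm X N f * N D"
        using fD by (intro dual_normD[OF X N0 N_scale f]) simp_all
      also have "\<dots> \<le> N B" using fD f1 by simp
      finally have "(LINT t|M. cmod (f (\<A> t))) \<le> N B" .
      moreover have "(\<integral>\<^sup>+ t. ennreal (cmod (f (\<A> t))) \<partial>M) = ennreal (LINT t|M. cmod (f (\<A> t)))"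
        by (rule nn_integral_eq_integral[OF integrable_norm[OF int]]) simp_all
      ultimately show "(\<integral>\<^sup>+ t. ennreal (cmod (f (\<A> t))) \<partial>M) \<le> ennreal (N B)"
        by (simp add: ennreal_leI)
    qed
    show "ennreal (N B) \<le> (SUP f\<in>{f \<in> dual_space X N. dual_norm X N f = 1}. \<integral>\<^sup>+ t. ennreal (cmod (f (\<A> t))) \<partial>M)"
    \<comment> \<open>A norming functional has dual norm exactly 1 only if \<open>N B\<close> is
      positive; for \<open>N B = 0\<close> the lower bound is trivial.\<close>
    proof (cases "N B = 0")
      case False
      with N0[OF BX] have "0 < N B" by simp
      obtain f where f: "f \<in> dual_space X N" "f B = complex_of_real (N B)" "\<And>T. T \<in> X \<Longrightarrow> cmod (f T) \<le> N T"
        using ex_norming_functional[where X = X and N = N and b = B, OF X N_add N_scale BX] by blast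
      have fB: "cmod (f B) = N B" using f(2) \<open>0 < N B\<close> by simp
      have f1: "dual_norm X N f = 1"
        by (rule dual_norm_eq_1I[OF BX \<open>0 < N B\<close> fB f(3) X N_scale f(1)])
      have int: "integrable M (\<lambda>t. f (\<A> t))" by (rule main(1)[OF _ _ BX f(1)])
      \<comment> \<open>For the constant weight 1 the weighted operator is \<open>B\<close>
        itself.\<close>
      have "f B = (LINT t|M. 1 * f (\<A> t))"
        using main(2)[OF _ _ BX f(1), of "\<lambda>_. 1" B] B by simp
      then have "N B = cmod (LINT t|M. f (\<A> t))" using fB by simp
      also have "\<dots> \<le> (LINT t|M. cmod (f (\<A> t)))" by (rule integral_norm_bound)
      finally have "ennreal (N B) \<le> ennreal (LINT t|M. cmod (f (\<A> t)))" by (rule ennreal_leI)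
      also have "\<dots> = (\<integral>\<^sup>+ t. ennreal (cmod (f (\<A> t))) \<partial>M)"
        by (rule nn_integral_eq_integral[OF integrable_norm[OF int], symmetric]) simp_all
      also have "\<dots> \<le> (SUP f\<in>{f \<in> dual_space X N. dual_norm X N f = 1}. \<integral>\<^sup>+ t. ennreal (cmod (f (\<A> t))) \<partial>M)"
        by (rule SUP_upper) (simp add: f f1)
      finally show ?thesis .
    qed simp
  qed
  show ?thesis
    unfolding X_def[symmetric] N_def[symmetric] B_def[symmetric]
    using forward backward norm by blast
qed

end
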